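(* Let $1<q<p<\infty$. (i) (Sufficiency) Suppose $\mu\in A_p$ and $\lambda\in A_q$, and set $\nu^{\frac1p+\frac1{q'}}:=\mu^{\frac1p}\lambda^{-\frac1q}$. Then there is a constant $C>0$, depending only on $p,q,d$, such that for every $b\in L^1_{\mathrm{loc}}(\mathbb{R}^d)$, $$\|\Pi_b\|_{L^p(\mu)\to L^q(\lambda)}\le C\,[\mu]_{A_p}^{\frac1{p-1}}[\lambda]_{A_q}[\nu]_{A_\infty}^{1/q-1/p}\cdot\inf_c\|f\mapsto(b-c)f\|_{L^p(\mu)\to L^q(\lambda)},$$ where the infimum is over all constants $c$. (ii) (Non-necessity) There are $\mu\in A_p$, $\lambda\in A_q$ and $b\in L^1_{\mathrm{loc}}(\mathbb{R}^d)$ such that $$\inf_c\|f\mapsto(b-c)f\|_{L^p(\mu)\to L^q(\lambda)}=\infty\quad\text{and}\quad\|\Pi_b\|_{L^p(\mu)\to L^q(\lambda)}<\infty.$$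
   Context: A dyadic lattice $\mathcal D=\bigcup_{k\in\mathbb Z}\mathcal D_k$ on $\mathbb{R}^d$ is fixed: $\mathcal D_k$ is a partition of $\mathbb{R}^d$ into (axis-parallel) cubes of side length $2^{-k}$ and $\mathcal D_{k+1}$ refines $\mathcal D_k$. For $Q\in\mathcal D$, $\widehat Q$ is the smallest $R\in\mathcal D$ with $Q\subsetneq R$. All suprema over cubes below are over $Q\in\mathcal D$. $\langle f\rangle_Q:=\frac1{|Q|}\int_Qf\,dx$; $p'$ is the conjugate exponent. A weight is a locally integrable $w:\mathbb{R}^d\to(0,\infty)$; $w(E):=\int_Ew\,dx$; $\|f\|_{L^p(w)}:=(\int|f|^pw\,dx)^{1/p}$. $[w]_{A_p}:=\sup_{Q}\langle w\rangle_Q\langle w^{-p'/p}\rangle_Q^{p/p'}$ for $p\in(1,\infty)$, and $[w]_{A_\infty}:=\sup_{Q}\frac1{w(Q)}\int_Q\sup_{R\in\mathcal D,\,x\in R\subseteq Q}\frac{w(R)}{|R|}\,dx$; $w\in A_p$ means $w$ is a weight with $[w]_{A_p}<\infty$. Paraproduct: $D_Qb:=\sum_{R\in\mathcal D:\widehat R=Q}\langle b\rangle_R\mathbf 1_R-\langle b\rangle_Q\mathbf 1_Q$ and $\Pi_bf:=\sum_{Q\in\mathcal D}D_Qb\,\langle f\rangle_Q$ for $f\in L^\infty_c$ (bounded, compactly supported). $\Pi_b$ is well defined if for each $f\in L^\infty_c$ this sum converges unconditionally in $L^1(K)$ for every compact $K$. $\|\Pi_b\|_{L^p(\mu)\to L^q(\lambda)}$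 is the least $N$ with $\|\Pi_bf\|_{L^q(\lambda)}\le N\|f\|_{L^p(\mu)}$ for all $f\in L^\infty_c$; it is $+\infty$ if there is no such $N$ or if $\Pi_b$ is not well defined. The multiplication-operator norm $\|f\mapsto(b-c)f\|_{L^p(\mu)\to L^q(\lambda)}\in[0,\infty]$ is the least $N$ with $\|(b-c)f\|_{L^q(\lambda)}\le N\|f\|_{L^p(\mu)}$ for all $f\in L^p(\mu)$ ($\infty$ if there is none). *)

theory Defs
  imports "HOL-Analysis.Analysis" "HOL-Library.Disjoint_Sets"
begin

text \<open>
  Functions live on \<open>real ^ 'n\<close> with Lebesgue measure.  The scalars form a type \<open>'k\<close> of sort
  \<open>{real_normed_field, euclidean_space}\<close>, which has the instances \<open>real\<close> and \<open>complex\<close>.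
  Weights are real-valued; norms and weight characteristics take values in \<open>ennreal\<close>.
\<close>

section \<open>Dyadic lattices\<close>

text \<open>
  A product of intervals of length \<open>l > 0\<close>; each interval may be open, closed or half-open.
\<close>

definition axis_cube :: "real \<Rightarrow> (real ^ 'n) set \<Rightarrow> bool" where
  "axis_cube l Q \<longleftrightarrow> (\<exists>(a :: real ^ 'n) (J :: 'n \<Rightarrow> real set).
     (\<forall>i. {a $ i <..< a $ i + l} \<subseteq> J i \<and> J i \<subseteq> {a $ i .. a $ i + l}) \<and>
     Q = {x. \<forall>i. x $ i \<in> J i})"

definition dyadic_lattice :: "(real ^ 'n) set set \<Rightarrow> bool" where
  "dyadic_lattice \<D> \<longleftrightarrow> (\<exists>D :: int \<Rightarrow> (real ^ 'n) set set.
     \<D> = (\<Union>k. D k) \<and>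
     (\<forall>k. partition_on UNIV (D k) \<and> (\<forall>Q\<in>D k. axis_cube (2 powi (- k)) Q) \<and>
          refines UNIV (D (k + 1)) (D k)))"

definition dyadic_parent :: "'a set set \<Rightarrow> 'a set \<Rightarrow> 'a set" where
  "dyadic_parent \<D> Q = (LEAST R. R \<in> \<D> \<and> Q \<subset> R)"


section \<open>Function spaces and weights\<close>

text \<open>
  Powers of extended nonnegative reals, for positive exponents only.
\<close>

definition epowr :: "ennreal \<Rightarrow> real \<Rightarrow> ennreal" where
  "epowr x a = (if x = top then top else ennreal (enn2real x powr a))"

definition conj_exp :: "real \<Rightarrow> real" where
  "conj_exp p = p / (p - 1)"

definition L1loc :: "(real ^ 'n \<Rightarrow> 'k :: euclidean_space) set" where
  "L1loc = {f. f \<in> borel_measurable lebesgue \<and>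
               (\<forall>K. compact K \<longrightarrow> set_integrable lebesgue K f)}"

definition Linfc :: "(real ^ 'n \<Rightarrow> 'k :: euclidean_space) set" where
  "Linfc = {f. f \<in> borel_measurable lebesgue \<and> bounded (range f) \<and>
               (\<exists>K. compact K \<and> (\<forall>x. x \<notin> K \<longrightarrow> f x = 0))}"

definition weight :: "(real ^ 'n \<Rightarrow> real) \<Rightarrow> bool" where
  "weight w \<longleftrightarrow> w \<in> L1loc \<and> (\<forall>x. w x > 0)"

definition Lp_norm :: "real \<Rightarrow> (real ^ 'n \<Rightarrow> real) \<Rightarrow> (real ^ 'n \<Rightarrow> 'k :: euclidean_space) \<Rightarrow> ennreal" where
  "Lp_norm p w f = epowr (\<integral>\<^sup>+x. ennreal (norm (f x) powr p * w x) \<partial>lebesgue) (1 / p)"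

definition Lp :: "real \<Rightarrow> (real ^ 'n \<Rightarrow> real) \<Rightarrow> (real ^ 'n \<Rightarrow> 'k :: euclidean_space) set" where
  "Lp p w = {f. f \<in> borel_measurable lebesgue \<and> Lp_norm p w f < top}"

text \<open>
  The average is a Bochner integral, used for locally integrable functions; for nonnegative
  functions that need not be integrable the \<open>ennreal\<close>-valued version is used.
\<close>

definition average :: "(real ^ 'n) set \<Rightarrow> (real ^ 'n \<Rightarrow> 'k :: euclidean_space) \<Rightarrow> 'k" where
  "average Q f = (1 / measure lebesgue Q) *\<^sub>R (LINT x:Q|lebesgue. f x)"

definition mass :: "(real ^ 'n \<Rightarrow> real) \<Rightarrow> (real ^ 'n) set \<Rightarrow> ennreal" where
  "mass w E = (\<integral>\<^sup>+x\<in>E. ennreal (w x) \<partial>lebesgue)"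

definition eaverage :: "(real ^ 'n) set \<Rightarrow> (real ^ 'n \<Rightarrow> real) \<Rightarrow> ennreal" where
  "eaverage Q w = mass w Q / emeasure lebesgue Q"

definition Ap_char :: "(real ^ 'n) set set \<Rightarrow> real \<Rightarrow> (real ^ 'n \<Rightarrow> real) \<Rightarrow> ennreal" where
  "Ap_char \<D> p w = (SUP Q\<in>\<D>. eaverage Q w *
     epowr (eaverage Q (\<lambda>x. w x powr (- conj_exp p / p))) (p / conj_exp p))"

definition Ainf_char :: "(real ^ 'n) set set \<Rightarrow> (real ^ 'n \<Rightarrow> real) \<Rightarrow> ennreal" where
  "Ainf_char \<D> w = (SUP Q\<in>\<D>.
     (\<integral>\<^sup>+x\<in>Q. (SUP R\<in>{R \<in> \<D>. x \<in> R \<and> R \<subseteq> Q}. mass w R / emeasure lebesgue R) \<partial>lebesgue)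
       / mass w Q)"

definition Ap_weights :: "(real ^ 'n) set set \<Rightarrow> real \<Rightarrow> (real ^ 'n \<Rightarrow> real) set" where
  "Ap_weights \<D> p = {w. weight w \<and> Ap_char \<D> p w < top}"


section \<open>Paraproducts and operator norms\<close>

text \<open>
  Every cube has only finitely many dyadic children, so the finite sum is the intended one.
\<close>

definition mart_diff :: "(real ^ 'n) set set \<Rightarrow> (real ^ 'n) set \<Rightarrow>
    (real ^ 'n \<Rightarrow> 'k :: euclidean_space) \<Rightarrow> real ^ 'n \<Rightarrow> 'k" where
  "mart_diff \<D> Q b x =
     (\<Sum>R\<in>{R \<in> \<D>. dyadic_parent \<D> R = Q}. indicat_real R x *\<^sub>R average R b)
       - indicat_real Q x *\<^sub>R average Q b"

text \<open>
  \<open>g\<close> is the sum of the paraproduct series: for every compact \<open>K\<close> the series converges to \<open>g\<close>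
  unconditionally in \<open>L\<^sup>1(K)\<close>, i.e. the net of its finite partial sums converges (the same
  reading of unconditional convergence as in \<open>has_sum\<close>).  Such a \<open>g\<close> is unique up to null sets.
\<close>

definition has_paraproduct :: "(real ^ 'n) set set \<Rightarrow>
    (real ^ 'n \<Rightarrow> 'k :: {real_normed_field, euclidean_space}) \<Rightarrow> (real ^ 'n \<Rightarrow> 'k) \<Rightarrow>
    (real ^ 'n \<Rightarrow> 'k) \<Rightarrow> bool" where
  "has_paraproduct \<D> b f g \<longleftrightarrow> g \<in> L1loc \<and>
     (\<forall>K. compact K \<longrightarrow>
       ((\<lambda>F. \<integral>\<^sup>+x\<in>K. ennreal (norm ((\<Sum>Q\<in>F. mart_diff \<D> Q b x * average Q f) - g x)) \<partial>lebesgue)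
          \<longlongrightarrow> 0) (finite_subsets_at_top \<D>))"

definition paraproduct_well_defined :: "(real ^ 'n) set set \<Rightarrow>
    (real ^ 'n \<Rightarrow> 'k :: {real_normed_field, euclidean_space}) \<Rightarrow> bool" where
  "paraproduct_well_defined \<D> b \<longleftrightarrow> (\<forall>f\<in>Linfc. \<exists>g. has_paraproduct \<D> b f g)"

definition paraproduct :: "(real ^ 'n) set set \<Rightarrow>
    (real ^ 'n \<Rightarrow> 'k :: {real_normed_field, euclidean_space}) \<Rightarrow> (real ^ 'n \<Rightarrow> 'k) \<Rightarrow>
    real ^ 'n \<Rightarrow> 'k" where
  "paraproduct \<D> b f = (SOME g. has_paraproduct \<D> b f g)"

text \<open>
  The least \<open>N \<in> [0,\<infinity>)\<close> bounding \<open>T\<close> on the domain \<open>X\<close> from \<open>L\<^sup>p(\<mu>)\<close> to \<open>L\<^sup>q(w)\<close>;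
  it is \<open>top\<close>, the infimum of the empty set, if there is none.
\<close>

definition op_norm :: "(real ^ 'n \<Rightarrow> 'k :: euclidean_space) set \<Rightarrow>
    real \<Rightarrow> (real ^ 'n \<Rightarrow> real) \<Rightarrow> real \<Rightarrow> (real ^ 'n \<Rightarrow> real) \<Rightarrow>
    ((real ^ 'n \<Rightarrow> 'k) \<Rightarrow> (real ^ 'n \<Rightarrow> 'k)) \<Rightarrow> ennreal" where
  "op_norm X p \<mu> q w T =
     Inf {ennreal N | N. 0 \<le> N \<and> (\<forall>f\<in>X. Lp_norm q w (T f) \<le> ennreal N * Lp_norm p \<mu> f)}"

definition paraproduct_norm :: "(real ^ 'n) set set \<Rightarrow>
    real \<Rightarrow> (real ^ 'n \<Rightarrow> real) \<Rightarrow> real \<Rightarrow> (real ^ 'n \<Rightarrow> real) \<Rightarrow>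
    (real ^ 'n \<Rightarrow> 'k :: {real_normed_field, euclidean_space}) \<Rightarrow> ennreal" where
  "paraproduct_norm \<D> p \<mu> q w b =
     (if paraproduct_well_defined \<D> b then op_norm Linfc p \<mu> q w (paraproduct \<D> b) else top)"

definition mult_norm :: "real \<Rightarrow> (real ^ 'n \<Rightarrow> real) \<Rightarrow> real \<Rightarrow> (real ^ 'n \<Rightarrow> real) \<Rightarrow>
    (real ^ 'n \<Rightarrow> 'k :: {real_normed_field, euclidean_space}) \<Rightarrow> ennreal" where
  "mult_norm p \<mu> q w h = op_norm (Lp p \<mu>) p \<mu> q w (\<lambda>f x. h x * f x)"

end

theory Submission
  imports Defs
begin

text \<open>
  Put \<open>1/r = 1/q - 1/p\<close>.  Testing the multiplication norm on its extremal function shows that it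
  dominates the norm of \<open>(b - c)/\<nu>\<close> in \<open>L\<^sup>r(\<nu>)\<close>, and \<open>\<Pi>\<^sub>b\<close> does not change when a constant is
  subtracted from \<open>b\<close>.  By duality it remains to bound
  \<open>\<Sum>\<^sub>Q |\<langle>f\<rangle>\<^sub>Q| |\<langle>D\<^sub>Q b, D\<^sub>Q g\<rangle>|\<close>.  Stopping when the average of \<open>|b|\<close>, \<open>|f|\<close> or \<open>|g|\<close> has grown by
  a factor 6, and using that the square sums of the martingale differences telescope inside a stopping
  tree, one dominates this form by \<open>\<Sum> \<langle>|b|\<rangle>\<^sub>S \<langle>|f|\<rangle>\<^sub>S \<langle>|g|\<rangle>\<^sub>S |S|\<close> over a sparse family.  Since
  \<open>\<nu>(S)^(1/r') \<le> \<mu>(S)^(1/p) \<lambda>'(S)^(1/q')\<close>, with \<open>\<lambda>'\<close> the dual weight of \<open>\<lambda>\<close>, Hoelder's inequality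
  splits the sparse form into three sums, each controlled by the Carleson embedding theorem, for the
  weights \<open>\<nu>\<close>, the dual weight of \<open>\<mu>\<close>, and \<open>\<lambda>\<close>.

  For the converse take \<open>\<mu> = 1\<close>, \<open>b\<close> the indicator of a cube \<open>P\<^sub>0\<close>, and \<open>\<lambda>\<close> a dyadic \<open>A\<^sub>1\<close> weight with a
  strong singularity inside \<open>P\<^sub>0\<close> that equals 1 outside.  Multiplication by \<open>b\<close> feels the singularity,
  multiplication by \<open>b - c\<close> with \<open>c \<noteq> 0\<close> is unbounded at infinity, but \<open>D\<^sub>Q b = 0\<close> unless \<open>Q\<close>
  strictly contains \<open>P\<^sub>0\<close>.
\<close>

text \<open>Besides an estimate, finiteness of \<open>paraproduct_norm\<close> asks for
  unconditional convergence in L^1(K). The sparse bound is uniform over finite families of cubes;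
  convergence is obtained separately, from L^2 orthogonality for bounded, compactly supported
  symbols and a local L^1 bound for the small remainder. Fatou then carries the L^q bound to the
  limit. All products live in \<open>ennreal\<close>: the infimum over c may be 0 while the
  characteristic of \<nu> is infinite. The right-hand side is then 0, and all averages of b must be
  shown to agree. The factor 6 lets three stopping rules discard a sixth of a cube each, hence at
  most half. The embedding for an A_P weight costs \<open>A powr (P / (P - 1))\<close>, so its P-th
  root gives \<open>A powr (1 / (P - 1))\<close>; for \<open>lam\<close> it is applied to the dual
  weight, whose characteristic is \<open>L powr (s - 1)\<close>, and the root returns exactly L. In
  the counterexample the layers \<open>\<theta> ^ j\<close> on the j-th chain cube give an A_1
  weight when \<theta> < 2^n, and multiplication is unbounded when \<theta> > 2^(n (1 - q/p)); the
  exponent 1 - q/(2p) lies halfway.\<close>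

lemma holder_nn:
  fixes a b :: "'a \<Rightarrow> real"
  assumes [measurable]: "a \<in> borel_measurable M" "b \<in> borel_measurable M"
    and a0: "\<And>x. 0 \<le> a x" and b0: "\<And>x. 0 \<le> b x"
    and A: "(\<integral>\<^sup>+x. ennreal (a x) \<partial>M) \<le> ennreal A" and B: "(\<integral>\<^sup>+x. ennreal (b x) \<partial>M) \<le> ennreal B"
    and "0 \<le> A" "0 \<le> B" and s: "0 < s" "0 < t" "s + t = 1"
  shows "(\<integral>\<^sup>+x. ennreal (a x powr s * b x powr t) \<partial>M) \<le> ennreal (A powr s * B powr t)"
proof (cases "A = 0 \<or> B = 0")
  case True
  have "AE x in M. a x powr s * b x powr t = 0"
  proof (cases "A = 0")
    case True
    then have "(\<integral>\<^sup>+x. ennreal (a x) \<partial>M) = 0" using A by simp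
    then have "AE x in M. ennreal (a x) = 0" by (subst (asm) nn_integral_0_iff_AE) auto
    then show ?thesis by eventually_elim (use a0 s in \<open>auto simp: ennreal_eq_0_iff dual_order.antisym\<close>)
  next
    case False
    then have "(\<integral>\<^sup>+x. ennreal (b x) \<partial>M) = 0" using B \<open>A = 0 \<or> B = 0\<close> by simp
    then have "AE x in M. ennreal (b x) = 0" by (subst (asm) nn_integral_0_iff_AE) auto
    then show ?thesis by eventually_elim (use b0 s in \<open>auto simp: ennreal_eq_0_iff dual_order.antisym\<close>)
  qed
  then have "(\<integral>\<^sup>+x. ennreal (a x powr s * b x powr t) \<partial>M) = (\<integral>\<^sup>+x. 0 \<partial>M)"
    by (intro nn_integral_cong_AE) auto
  then show ?thesis by simp
next
  case False
  then have AB: "A > 0" "B > 0" using assms by auto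
  define c where "c = A powr s * B powr t"
  have c: "c > 0" using AB by (simp add: c_def)
  have "a x powr s * b x powr t \<le> c * s / A * a x + c * t / B * b x" for x
  proof -
    have "(a x / A) powr s * (b x / B) powr t \<le> s * (a x / A) + t * (b x / B)"
    proof (cases "a x = 0 \<or> b x = 0")
      case True
      then show ?thesis using a0[of x] b0[of x] AB s by auto
    next
      case False
      then show ?thesis using a0[of x] b0[of x] AB s by (intro Youngs_inequality_0) auto
    qed
    then have "c * ((a x / A) powr s * (b x / B) powr t) \<le> c * (s * (a x / A) + t * (b x / B))"
      using c by (intro mult_left_mono) auto
    moreover have "c * ((a x / A) powr s * (b x / B) powr t) = a x powr s * b x powr t"
      using AB a0 b0 by (simp add: c_def powr_divide)
    ultimately show ?thesis by (simp add: algebra_simps)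
  qed
  then have "(\<integral>\<^sup>+x. ennreal (a x powr s * b x powr t) \<partial>M)
      \<le> (\<integral>\<^sup>+x. ennreal (c * s / A) * ennreal (a x) + ennreal (c * t / B) * ennreal (b x) \<partial>M)"
    using AB c s a0 b0 
    by (intro nn_integral_mono) (auto simp flip: ennreal_mult'' ennreal_plus intro!: ennreal_leI)
  also have "\<dots> = ennreal (c * s / A) * (\<integral>\<^sup>+x. ennreal (a x) \<partial>M) + ennreal (c * t / B) * (\<integral>\<^sup>+x. ennreal (b x) \<partial>M)"
    by (simp add: nn_integral_add nn_integral_cmult)
  also have "\<dots> \<le> ennreal (c * s / A) * ennreal A + ennreal (c * t / B) * ennreal B"
    using A B by (intro add_mono mult_left_mono) auto
  also have "\<dots> = ennreal (c * s + c * t)"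
    using AB c s by (simp flip: ennreal_mult'' ennreal_plus)
  also have "c * s + c * t = c" using s by (simp flip: distrib_left)
  finally show ?thesis by (simp add: c_def)
qed

lemma holder_sum:
  fixes a b :: "'a \<Rightarrow> real"
  assumes "finite I" and a0: "\<And>i. i \<in> I \<Longrightarrow> 0 \<le> a i" and b0: "\<And>i. i \<in> I \<Longrightarrow> 0 \<le> b i"
    and s: "0 < s" "0 < t" "s + t = 1"
  shows "(\<Sum>i\<in>I. a i powr s * b i powr t) \<le> (\<Sum>i\<in>I. a i) powr s * (\<Sum>i\<in>I. b i) powr t"
proof -
  \<comment> \<open>\<open>holder_nn\<close> wants nonnegativity on the whole type, while the
    hypotheses give it only on \<open>I\<close>.\<close>
  let ?a = "\<lambda>i. \<bar>a i\<bar>" and ?b = "\<lambda>i. \<bar>b i\<bar>"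
  have "(\<integral>\<^sup>+i. ennreal (?a i powr s * ?b i powr t) \<partial>count_space I)
      \<le> ennreal ((\<Sum>i\<in>I. a i) powr s * (\<Sum>i\<in>I. b i) powr t)"
    using assms by (intro holder_nn) (auto simp: nn_integral_count_space_finite intro!: sum_nonneg)
  then show ?thesis
    using assms by (simp add: nn_integral_count_space_finite sum_nonneg)
qed

lemma holder_sum3:
  fixes a b c :: "'a \<Rightarrow> real"
  assumes "finite I" and a0: "\<And>i. i \<in> I \<Longrightarrow> 0 \<le> a i" and b0: "\<And>i. i \<in> I \<Longrightarrow> 0 \<le> b i"
    and c0: "\<And>i. i \<in> I \<Longrightarrow> 0 \<le> c i"
    and s: "0 < s" "0 < t" "0 < u" "s + t + u = 1"
  shows "(\<Sum>i\<in>I. a i powr s * b i powr t * c i powr u)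
    \<le> (\<Sum>i\<in>I. a i) powr s * (\<Sum>i\<in>I. b i) powr t * (\<Sum>i\<in>I. c i) powr u"
proof -
  define d where "d i = b i powr (t / (t + u)) * c i powr (u / (t + u))" for i
  have "(\<Sum>i\<in>I. a i powr s * b i powr t * c i powr u) = (\<Sum>i\<in>I. a i powr s * d i powr (t + u))"
    using s by (intro sum.cong) (auto simp: d_def powr_mult powr_powr)
  also have "\<dots> \<le> (\<Sum>i\<in>I. a i) powr s * (\<Sum>i\<in>I. d i) powr (t + u)"
    using assms by (intro holder_sum) (auto simp: d_def)
  also have "\<dots> \<le> (\<Sum>i\<in>I. a i) powr s *
      ((\<Sum>i\<in>I. b i) powr (t / (t + u)) * (\<Sum>i\<in>I. c i) powr (u / (t + u))) powr (t + u)"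
    unfolding d_def using assms
    by (intro mult_left_mono powr_mono2 holder_sum) (auto intro!: sum_nonneg simp flip: add_divide_distrib)
  also have "\<dots> = (\<Sum>i\<in>I. a i) powr s * (\<Sum>i\<in>I. b i) powr t * (\<Sum>i\<in>I. c i) powr u"
    using s assms by (simp add: powr_mult powr_powr sum_nonneg)
  finally show ?thesis .
qed

lemma sum_measure_le:
  assumes "finite C" "disjoint C" "C \<subseteq> sets M" "\<Union>C \<subseteq> S" "S \<in> fmeasurable M"
  shows "(\<Sum>R\<in>C. measure M R) \<le> measure M S"
proof -
  have "C \<subseteq> fmeasurable M" 
    using assms by (meson Sup_le_iff fmeasurableI2 subset_iff)
  then have "(\<Sum>R\<in>C. measure M R) = measure M (\<Union>C)"
    using assms
    by (subst measure_Union') (auto simp: disjoint_def pairwise_def disjnt_def)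
  also have "\<dots> \<le> measure M S"
    using assms by (intro measure_mono_fmeasurable sets.finite_Union) auto
  finally show ?thesis .
qed

text \<open>A convex function lies above its tangent, here at \<open>t = 1\<close>. This is the only
  source of gain in the Bellman induction of \<open>carleson_tree\<close>.\<close>

lemma powr_tangent:
  fixes s t :: real
  assumes "0 < t" "0 \<le> s"
  shows "t powr (- s) \<ge> 1 + s * (1 - t)"
proof -
  have "1 + s * (1 - t) \<le> 1 - s * ln t" using assms ln_le_minus_one[of t] 
    by (smt (verit) mult_left_mono mult_minus_right right_diff_distrib)
  also have "\<dots> \<le> exp (- s * ln t)" using exp_ge_add_one_self[of "- s * ln t"] by simp
  finally show ?thesis using assms by (simp add: powr_def)
qed

section \<open>Dyadic cubes\<close>

text \<open>Which faces belong to the cube is left open, but it lies between an open box and the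
  closed one, and these differ by a negligible frontier.\<close>

lemma axis_cubeD:
  fixes Q :: "(real ^ 'n) set"
  assumes "axis_cube l Q" "l > 0"
  shows "Q \<in> lmeasurable" "measure lebesgue Q = l ^ CARD('n)" "bounded Q"
proof -
  obtain a :: "real ^ 'n" and J where
    *: "(\<forall>i. {a $ i <..< a $ i + l} \<subseteq> J i \<and> J i \<subseteq> {a $ i .. a $ i + l}) \<and> Q = {x. \<forall>i. x $ i \<in> J i}"
    using assms(1) unfolding axis_cube_def by blast
  then have J: "\<And>i. {a $ i <..< a $ i + l} \<subseteq> J i" "\<And>i. J i \<subseteq> {a $ i .. a $ i + l}"
    and Q: "Q = {x. \<forall>i. x $ i \<in> J i}" by blast+
  define b where "b = a + (\<chi> i. l)"
  have sub: "box a b \<subseteq> Q" "Q \<subseteq> cbox a b"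
    using J unfolding Q b_def by (fastforce simp: mem_box_cart subset_iff)+
  have neg: "negligible (Q - box a b)"
    using negligible_frontier_interval by (rule negligible_subset) (use sub in auto)
  have Qe: "Q = box a b \<union> (Q - box a b)" using sub by auto
  show Qm: "Q \<in> lmeasurable"
    using neg by (subst Qe) (intro fmeasurable.Un lmeasurable_box negligible_imp_measurable)
  have "measure lebesgue Q = measure lebesgue (box a b)"
    using neg by (subst Qe, subst measure_Un_null_set) (auto simp: negligible_iff_null_sets)
  also have "\<dots> = measure lebesgue (box a b \<union> (cbox a b - box a b))"
    using negligible_frontier_interval[of a b]
    by (subst measure_Un_null_set) (auto simp: negligible_iff_null_sets)
  also have "box a b \<union> (cbox a b - box a b) = cbox a b" using box_subset_cbox by blast
  also have "measure lebesgue (cbox a b) = measure lborel (cbox a b)" by simp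
  also have "\<dots> = l ^ CARD('n)"
  proof -
    have "a \<in> cbox a b" using assms by (simp add: mem_box_cart b_def)
    then show ?thesis by (subst content_cbox_cart) (auto simp: b_def)
  qed
  finally show "measure lebesgue Q = l ^ CARD('n)" .
  show "bounded Q" using sub bounded_cbox bounded_subset by blast
qed

lemma axis_cube_diam:
  fixes Q :: "(real ^ 'n) set"
  assumes "axis_cube l Q" "x \<in> Q" "y \<in> Q"
  shows "norm (x - y) \<le> l * CARD('n)"
proof -
  obtain a :: "real ^ 'n" and J where
    *: "(\<forall>i. {a $ i <..< a $ i + l} \<subseteq> J i \<and> J i \<subseteq> {a $ i .. a $ i + l}) \<and> Q = {x. \<forall>i. x $ i \<in> J i}"
    using assms(1) unfolding axis_cube_def by blast
  have "\<bar>(x - y) $ i\<bar> \<le> l" for i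
  proof -
    have "x $ i \<in> {a $ i .. a $ i + l}" "y $ i \<in> {a $ i .. a $ i + l}" using * assms by blast+
    then show ?thesis by auto
  qed
  then have "(\<Sum>i\<in>UNIV. \<bar>(x - y) $ i\<bar>) \<le> (\<Sum>i\<in>(UNIV :: 'n set). l)" by (intro sum_mono)
  then show ?thesis using norm_le_l1_cart[of "x - y"] by (simp add: mult.commute)
qed

text \<open>\<open>dyadic_lattice\<close> only asserts that some indexing by generations exists;
  here one is fixed. It is in fact determined by the volumes, see
  \<open>level_unique\<close>.\<close>

locale dyadic =
  fixes D :: "int \<Rightarrow> (real ^ 'n) set set"
  assumes part: "partition_on UNIV (D k)"
    and cube: "Q \<in> D k \<Longrightarrow> axis_cube (2 powi (- k)) Q"
    and refs: "refines UNIV (D (k + 1)) (D k)"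
begin

definition cubes :: "(real ^ 'n) set set" where "cubes = (\<Union>k. D k)"
definition lev :: "(real ^ 'n) set \<Rightarrow> int" where "lev Q = (THE k. Q \<in> D k)"
definition ch :: "(real ^ 'n) set \<Rightarrow> (real ^ 'n) set set" where
  "ch Q = {R \<in> cubes. dyadic_parent cubes R = Q}"
text \<open>Cutting the tree below Q at generation K makes it finite and allows induction from the
  leaves upwards. The estimates do not depend on K.\<close>

definition sub :: "int \<Rightarrow> (real ^ 'n) set \<Rightarrow> (real ^ 'n) set set" where
  "sub K Q = {R \<in> cubes. R \<subseteq> Q \<and> lev R < K}"

abbreviation vol :: "(real ^ 'n) set \<Rightarrow> real" where "vol \<equiv> measure lebesgue"

lemma cube_lmeasurable: "Q \<in> cubes \<Longrightarrow> Q \<in> lmeasurable"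
  using axis_cubeD(1) cube unfolding cubes_def by fastforce

lemma cube_sets [measurable]: "Q \<in> cubes \<Longrightarrow> Q \<in> sets lebesgue"
  using cube_lmeasurable by blast

lemma cube_bounded: "Q \<in> cubes \<Longrightarrow> bounded Q"
  using axis_cubeD(3) cube unfolding cubes_def by fastforce

lemma vol_level: "Q \<in> D k \<Longrightarrow> vol Q = 2 powi (- k * int CARD('n))"
  using axis_cubeD(2)[OF cube, of Q k] power_int_mult[of "2::real" "- k" "int CARD('n)"] by simp

lemma vol_pos: "Q \<in> cubes \<Longrightarrow> vol Q > 0"
  by (auto simp: cubes_def vol_level)

text \<open>The volume of a cube reveals its side length and hence its generation.\<close>

lemma level_unique: "Q \<in> D k \<Longrightarrow> Q \<in> D j \<Longrightarrow> k = j"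
  using vol_level[of Q k] vol_level[of Q j] power_int_strict_increasing[of "- k * int CARD('n)" "- j * int CARD('n)" "2::real"]
    power_int_strict_increasing[of "- j * int CARD('n)" "- k * int CARD('n)" "2::real"]
  by (cases k j rule: linorder_cases) auto

lemma lev_eq: "Q \<in> D k \<Longrightarrow> lev Q = k"
  unfolding lev_def by (rule the_equality) (auto dest: level_unique)

lemma cube_lev: "Q \<in> cubes \<Longrightarrow> Q \<in> D (lev Q)"
  unfolding cubes_def using lev_eq by auto

lemma level_cubes: "Q \<in> D k \<Longrightarrow> Q \<in> cubes"
  unfolding cubes_def by auto

lemma vol_eq: "Q \<in> cubes \<Longrightarrow> vol Q = 2 powi (- lev Q * int CARD('n))"
  using vol_level cube_lev by auto

lemma cube_nonempty: "Q \<in> cubes \<Longrightarrow> Q \<noteq> {}"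
  using vol_pos by fastforce

lemma level_disjoint: "Q \<in> D k \<Longrightarrow> R \<in> D k \<Longrightarrow> Q \<inter> R \<noteq> {} \<Longrightarrow> Q = R"
  using partition_onD2[OF part] by (auto simp: disjoint_def)

lemma level_cover: "\<exists>Q\<in>D k. x \<in> Q"
  using partition_onD1[OF part[of k]] by auto

lemma level_below: "R \<in> D (k + int m) \<Longrightarrow> \<exists>Q\<in>D k. R \<subseteq> Q"
proof (induction m arbitrary: R)
  case (Suc m)
  have "R \<in> D ((k + int m) + 1)" using Suc.prems by (simp add: algebra_simps)
  then obtain Q where Q: "Q \<in> D (k + int m)" "R \<subseteq> Q"
    using refs[of "k + int m"] unfolding refines_def by meson
  obtain P where "P \<in> D k" "Q \<subseteq> P" using Suc.IH[OF Q(1)] by auto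
  then show ?case using Q by (intro bexI[of _ P]) auto
qed auto

lemma level_nest: "Q \<in> D k \<Longrightarrow> R \<in> D j \<Longrightarrow> k \<le> j \<Longrightarrow> Q \<inter> R \<noteq> {} \<Longrightarrow> R \<subseteq> Q"
  using level_below[of R k "nat (j - k)"] level_disjoint by fastforce

lemma cube_nest: "Q \<in> cubes \<Longrightarrow> R \<in> cubes \<Longrightarrow> Q \<inter> R \<noteq> {} \<Longrightarrow> Q \<subseteq> R \<or> R \<subseteq> Q"
  using level_nest[of Q "lev Q" R "lev R"] level_nest[of R "lev R" Q "lev Q"] cube_lev by fastforce

lemma cube_lev_mono: assumes "Q \<in> cubes" "R \<in> cubes" "R \<subseteq> Q" shows "lev Q \<le> lev R"
proof (rule ccontr)
  assume neg: "\<not> ?thesis"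
  moreover have "R \<inter> Q \<noteq> {}" using assms cube_nonempty by blast
  ultimately have "Q \<subseteq> R"
    using level_nest[OF cube_lev[OF assms(2)] cube_lev[OF assms(1)]] by linarith
  then show False using assms neg by auto
qed

lemma cube_lev_less: assumes "Q \<in> cubes" "R \<in> cubes" "R \<subset> Q" shows "lev Q < lev R"
proof -
  have "lev Q \<noteq> lev R"
  proof
    assume *: "lev Q = lev R"
    have "Q \<inter> R \<noteq> {}" using assms cube_nonempty by blast
    then show False
      using level_disjoint[of Q "lev R" R] cube_lev[OF assms(1)] cube_lev[OF assms(2)] assms(3) * by auto
  qed
  then show ?thesis using cube_lev_mono[of Q R] assms by auto
qed

lemma ex_parent: "R \<in> D (k + 1) \<Longrightarrow> \<exists>Q\<in>D k. R \<subseteq> Q"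
  using refs[of k] unfolding refines_def by meson

text \<open>The order behind \<open>LEAST\<close> is inclusion. Any cube strictly containing R has a
  smaller generation than R, hence at most that of Q, and by nesting it contains Q.\<close>

lemma dyadic_parent_eq: assumes "R \<in> D (k + 1)" "Q \<in> D k" "R \<subseteq> Q"
  shows "dyadic_parent cubes R = Q"
  unfolding dyadic_parent_def
proof (rule Least_equality)
  have "R \<noteq> Q" using level_unique[of Q k "k+1"] assms by auto
  then show "Q \<in> cubes \<and> R \<subset> Q" using assms level_cubes by auto
next
  fix P assume P: "P \<in> cubes \<and> R \<subset> P"
  then have "lev P < k + 1" using cube_lev_less[of P R] level_cubes lev_eq assms(1) by metis
  moreover have "R \<noteq> {}" using assms(1) level_cubes cube_nonempty by blast
  ultimately show "Q \<le> P"
    using level_nest[of P "lev P" Q k] P cube_lev assms by fastforce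
qed

lemma ch_eq: assumes "Q \<in> D k" shows "ch Q = {R \<in> D (k + 1). R \<subseteq> Q}"
proof -
  have "R \<in> D (k + 1) \<and> R \<subseteq> Q" if R: "R \<in> cubes" "dyadic_parent cubes R = Q" for R
  proof -
    obtain P where P: "P \<in> D (lev R - 1)" "R \<subseteq> P"
      using ex_parent[of R "lev R - 1"] cube_lev R by auto
    then have "P = Q" using dyadic_parent_eq[of R "lev R - 1" P] cube_lev R by auto
    then show ?thesis using P R assms cube_lev[of R] level_unique[of Q k "lev R - 1"] by auto
  qed
  then show ?thesis
    using dyadic_parent_eq[OF _ assms] level_cubes unfolding ch_def by blast
qed

lemma ch_cubes: "R \<in> ch Q \<Longrightarrow> R \<in> cubes" by (simp add: ch_def)

lemma ch_iff: "Q \<in> cubes \<Longrightarrow> R \<in> ch Q \<longleftrightarrow> R \<in> D (lev Q + 1) \<and> R \<subseteq> Q"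
  using ch_eq[OF cube_lev] by auto

lemma ch_lev: "Q \<in> cubes \<Longrightarrow> R \<in> ch Q \<Longrightarrow> lev R = lev Q + 1"
  using ch_iff lev_eq by auto

lemma ch_sub: "Q \<in> cubes \<Longrightarrow> R \<in> ch Q \<Longrightarrow> R \<subseteq> Q"
  using ch_iff by auto

lemma ch_disjoint: "Q \<in> cubes \<Longrightarrow> disjoint (ch Q)"
  unfolding disjoint_def by (metis ch_iff level_disjoint)

lemma ch_Union: assumes "Q \<in> cubes" shows "\<Union>(ch Q) = Q"
proof
  show "\<Union>(ch Q) \<subseteq> Q" using ch_sub assms by blast
next
  show "Q \<subseteq> \<Union>(ch Q)"
  proof
    fix x assume x: "x \<in> Q"
    obtain R where "R \<in> D (lev Q + 1)" "x \<in> R" using level_cover by blast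
    moreover have "R \<subseteq> Q" using level_nest[OF cube_lev[OF assms] \<open>R \<in> _\<close>] x \<open>x \<in> R\<close> by auto
    ultimately show "x \<in> \<Union>(ch Q)" using ch_iff assms by auto
  qed
qed

text \<open>Packing: cubes of one generation are disjoint and share the volume \<open>c\<close>, so
  at most \<open>vol S / c\<close> of them fit into S.\<close>

lemma finite_level_within:
  assumes S: "S \<in> lmeasurable" shows "finite {R \<in> D j. R \<subseteq> S}"
proof (rule ccontr)
  define c :: real where "c = 2 powi (- j * int CARD('n))"
  have c: "c > 0" by (simp add: c_def)
  assume inf: "infinite {R \<in> D j. R \<subseteq> S}"
  obtain C where C: "C \<subseteq> {R \<in> D j. R \<subseteq> S}" "finite C" "card C = nat \<lceil>vol S / c\<rceil> + 1"
    using infinite_arbitrarily_large[OF inf, of "nat \<lceil>vol S / c\<rceil> + 1"] by metis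
  have "(\<Sum>R\<in>C. vol R) \<le> vol S"
  proof (intro sum_measure_le)
    show "disjoint C" using C(1) level_disjoint[of _ j] unfolding disjoint_def by blast
    show "C \<subseteq> sets lebesgue" using C(1) level_cubes cube_sets by blast
  qed (use C S in auto)
  moreover have "(\<Sum>R\<in>C. vol R) = card C * c"
    using C by (subst sum.cong[OF refl, of C _ "\<lambda>_. c"]) (auto simp: vol_level c_def)
  moreover have "vol S / c < card C" using C by linarith
  ultimately show False using c by (simp add: pos_divide_less_eq)
qed

lemma finite_ch: "Q \<in> cubes \<Longrightarrow> finite (ch Q)"
  using finite_level_within[OF cube_lmeasurable, of Q "lev Q + 1"] ch_eq[OF cube_lev] by simp

text \<open>Cubes of one generation that meet S stay within one diameter of it, so this reduces to
  packing in a large ball.\<close>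

lemma finite_level_meets:
  assumes "bounded S" shows "finite {R \<in> D j. R \<inter> S \<noteq> {}}"
proof -
  define l :: real where "l = 2 powi (- j) * CARD('n)"
  obtain B where B: "\<And>x. x \<in> S \<Longrightarrow> norm x \<le> B" using assms unfolding bounded_iff by blast
  have "{R \<in> D j. R \<inter> S \<noteq> {}} \<subseteq> {R \<in> D j. R \<subseteq> cball 0 (B + l)}"
  proof (safe, simp)
    fix R x y assume *: "R \<in> D j" "x \<in> R" "x \<in> S" "y \<in> R"
    have "norm (y - x) \<le> l" using axis_cube_diam[OF cube] * by (simp add: l_def)
    then show "norm y \<le> B + l" using B[OF *(3)] norm_triangle_sub[of y x] by linarith
  qed
  then show ?thesis using finite_level_within[of "cball 0 (B + l)" j] finite_subset by auto
qed

lemma finite_sub: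
  assumes "Q \<in> cubes" shows "finite (sub K Q)"
proof -
  have "sub K Q \<subseteq> (\<Union>j\<in>{lev Q..<K}. {R \<in> D j. R \<subseteq> Q})"
  proof
    fix R assume "R \<in> sub K Q"
    then have "R \<in> D (lev R)" "lev Q \<le> lev R" "lev R < K" "R \<subseteq> Q"
      using cube_lev[of R] cube_lev_mono[OF assms, of R] by (auto simp: sub_def)
    then show "R \<in> (\<Union>j\<in>{lev Q..<K}. {R \<in> D j. R \<subseteq> Q})" by auto
  qed
  then show ?thesis
    by (rule finite_subset) (intro finite_UN_I finite_level_within cube_lmeasurable assms; simp)
qed

lemma vol_ch: assumes "Q \<in> cubes" "R \<in> ch Q" shows "vol Q = 2 ^ CARD('n) * vol R"
proof -
  have "vol R = 2 powi (- (lev Q + 1) * int CARD('n))" 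
    using vol_eq[OF ch_cubes[OF assms(2)]] ch_lev[OF assms] by simp
  moreover have "- lev Q * int CARD('n) = int CARD('n) + (- (lev Q + 1) * int CARD('n))"
    by (simp add: algebra_simps)
  ultimately show ?thesis
    using vol_eq[OF assms(1)] by (simp add: power_int_add)
qed

lemma sub_self: "Q \<in> cubes \<Longrightarrow> lev Q < K \<Longrightarrow> Q \<in> sub K Q"
  by (auto simp: sub_def)

lemma sub_rec: assumes "Q \<in> cubes" "lev Q < K"
  shows "sub K Q = insert Q (\<Union>R\<in>ch Q. sub K R)"
proof
  show "insert Q (\<Union>R\<in>ch Q. sub K R) \<subseteq> sub K Q"
    using assms ch_sub[OF assms(1)] unfolding sub_def by auto
next
  show "sub K Q \<subseteq> insert Q (\<Union>R\<in>ch Q. sub K R)"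
  proof
    fix P assume P: "P \<in> sub K Q"
    show "P \<in> insert Q (\<Union>R\<in>ch Q. sub K R)"
    proof (cases "P = Q")
      case False
      then have 1: "lev Q < lev P" using P assms cube_lev_less by (auto simp: sub_def)
      obtain x where x: "x \<in> P" using P cube_nonempty by (auto simp: sub_def)
      then obtain R where R: "R \<in> ch Q" "x \<in> R" using ch_Union[OF assms(1)] P by (auto simp: sub_def)
      have "P \<subseteq> R"
        using level_nest[of R "lev R" P "lev P"] 1 x R ch_lev[OF assms(1) R(1)] P cube_lev[of P] 
          cube_lev[OF ch_cubes[OF R(1)]] by (auto simp: sub_def)
      then show ?thesis using P R by (auto simp: sub_def)
    qed simp
  qed
qed

lemma sub_empty: "Q \<in> cubes \<Longrightarrow> K \<le> lev Q \<Longrightarrow> sub K Q = {}"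
  using cube_lev_mono[of Q] by (force simp: sub_def)

lemma sub_ch_disjoint:
  assumes "Q \<in> cubes" "R \<in> ch Q" "R' \<in> ch Q" "R \<noteq> R'" shows "sub K R \<inter> sub K R' = {}"
proof -
  have "R \<inter> R' = {}" using ch_disjoint[OF assms(1)] assms by (auto simp: disjoint_def)
  moreover have "P = {}" if "P \<subseteq> R" "P \<subseteq> R'" for P using that calculation by blast
  ultimately show ?thesis using cube_nonempty unfolding sub_def by blast
qed

lemma not_in_sub_ch: assumes "Q \<in> cubes" "R \<in> ch Q" shows "Q \<notin> sub K R"
  using cube_lev_mono[OF ch_cubes[OF assms(2)] assms(1)] ch_lev[OF assms] by (auto simp: sub_def)

lemma sum_sub_rec:
  fixes g :: "(real ^ 'n) set \<Rightarrow> real"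
  assumes "Q \<in> cubes" "lev Q < K"
  shows "(\<Sum>P\<in>sub K Q. g P) = g Q + (\<Sum>R\<in>ch Q. \<Sum>P\<in>sub K R. g P)"
proof -
  have "(\<Sum>P\<in>sub K Q. g P) = g Q + (\<Sum>P\<in>(\<Union>R\<in>ch Q. sub K R). g P)"
    unfolding sub_rec[OF assms]
    using not_in_sub_ch finite_ch finite_sub assms ch_cubes by (subst sum.insert) auto
  also have "(\<Sum>P\<in>(\<Union>R\<in>ch Q. sub K R). g P) = (\<Sum>R\<in>ch Q. \<Sum>P\<in>sub K R. g P)"
    using sub_ch_disjoint finite_ch finite_sub assms ch_cubes by (subst sum.UNION_disjoint) auto
  finally show ?thesis .
qed

lemma cube_induct [consumes 1, case_names leaf node]:
  assumes "Q \<in> cubes"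
    and "\<And>Q. Q \<in> cubes \<Longrightarrow> K \<le> lev Q \<Longrightarrow> P Q"
    and "\<And>Q. Q \<in> cubes \<Longrightarrow> lev Q < K \<Longrightarrow> (\<And>R. R \<in> ch Q \<Longrightarrow> P R) \<Longrightarrow> P Q"
  shows "P Q"
  using assms(1)
proof (induction "nat (K - lev Q)" arbitrary: Q rule: less_induct)
  case less
  show ?case
  proof (cases "K \<le> lev Q")
    case False
    have "P R" if R: "R \<in> ch Q" for R
      using less.hyps[of R] ch_lev[OF less.prems R] ch_cubes[OF R] False by linarith
    then show ?thesis using False by (intro assms(3)[OF less.prems]) auto
  qed (use less assms(2) in auto)
qed

text \<open>Stopping cubes may lie many generations below their top cube, so the recursion over them
  requires the hypothesis for all strictly smaller cubes and not just for children.\<close>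

lemma cube_less_induct [consumes 1, case_names leaf node]:
  assumes "Q \<in> cubes"
    and "\<And>Q. Q \<in> cubes \<Longrightarrow> K \<le> lev Q \<Longrightarrow> P Q"
    and "\<And>Q. Q \<in> cubes \<Longrightarrow> lev Q < K \<Longrightarrow> (\<And>R. R \<in> cubes \<Longrightarrow> R \<subset> Q \<Longrightarrow> P R) \<Longrightarrow> P Q"
  shows "P Q"
  using assms(1)
proof (induction "nat (K - lev Q)" arbitrary: Q rule: less_induct)
  case less
  show ?case
  proof (cases "K \<le> lev Q")
    case False
    have "P R" if R: "R \<in> cubes" "R \<subset> Q" for R
      using less.hyps[of R] cube_lev_less[OF less.prems R] R(1) False by linarith
    then show ?thesis using False by (intro assms(3)[OF less.prems]) auto
  qed (use less assms(2) in auto)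
qed

end

section \<open>Sparse domination\<close>

lemma sum_UN_le:
  fixes g :: "'a \<Rightarrow> real"
  assumes "finite I" "\<And>i. i \<in> I \<Longrightarrow> finite (A i)" "\<And>x. 0 \<le> g x"
  shows "(\<Sum>x\<in>(\<Union>i\<in>I. A i). g x) \<le> (\<Sum>i\<in>I. \<Sum>x\<in>A i. g x)"
  using assms
proof (induction I rule: finite_induct)
  case (insert i I)
  have "(\<Sum>x\<in>A i \<union> (\<Union>i\<in>I. A i). g x) \<le> (\<Sum>x\<in>A i. g x) + (\<Sum>x\<in>(\<Union>i\<in>I. A i). g x)"
    using insert by (subst sum_Un) (auto intro!: sum_nonneg)
  then show ?case using insert by (simp add: insert.hyps)
qed simp

context dyadic begin

lemma ch_pairwise_disjnt: "Q \<in> cubes \<Longrightarrow> pairwise disjnt (ch Q)"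
  using ch_disjoint by (auto simp: disjoint_def pairwise_def disjnt_def)

text \<open>Stated for any measure on the Lebesgue sets, so that it serves volume and all the
  weighted measures below alike.\<close>

lemma measure_ch:
  assumes Q: "Q \<in> cubes" and M: "sets M = sets lebesgue" "emeasure M Q < top"
  shows "measure M Q = (\<Sum>R\<in>ch Q. measure M R)"
proof -
  have "R \<in> fmeasurable M" if "R \<in> ch Q" for R
  proof (rule fmeasurableI2)
    show "Q \<in> fmeasurable M" using M cube_sets[OF Q] by (auto intro: fmeasurableI)
  qed (use that M ch_sub[OF Q] ch_cubes cube_sets in auto)
  then have "measure M (\<Union>(ch Q)) = (\<Sum>R\<in>ch Q. measure M R)"
    by (intro measure_Union' finite_ch Q ch_pairwise_disjnt)
  then show ?thesis using ch_Union[OF Q] by simp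
qed

lemma vol_sum_ch: "Q \<in> cubes \<Longrightarrow> vol Q = (\<Sum>R\<in>ch Q. vol R)"
  using measure_ch[of Q lebesgue] cube_lmeasurable[of Q] by (auto simp: fmeasurable_def)

lemma average_ch:
  fixes b :: "real ^ 'n \<Rightarrow> 'k :: euclidean_space"
  assumes Q: "Q \<in> cubes" and b: "set_integrable lebesgue Q b"
  shows "vol Q *\<^sub>R average Q b = (\<Sum>R\<in>ch Q. vol R *\<^sub>R average R b)"
proof -
  have av: "vol P *\<^sub>R average P b = (LINT x:P|lebesgue. b x)" if "P \<in> cubes" for P
    using vol_pos[OF that] by (simp add: average_def)
  have "(LINT x:(\<Union>R\<in>ch Q. R)|lebesgue. b x) = (\<Sum>R\<in>ch Q. LINT x:R|lebesgue. b x)"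
  proof (rule set_integral_finite_Union)
    show "disjoint_family_on (\<lambda>R. R) (ch Q)"
      using ch_disjoint[OF Q] by (auto simp: disjoint_family_on_def disjoint_def)
    show "set_integrable lebesgue R b" if "R \<in> ch Q" for R
      using b set_integrable_subset[OF b] ch_sub[OF Q that] cube_sets[OF ch_cubes[OF that]] by auto
    show "R \<in> sets lebesgue" if "R \<in> ch Q" for R
      using cube_sets[OF ch_cubes[OF that]] .
  qed (use finite_ch Q in auto)
  then show ?thesis using av Q ch_Union[OF Q] ch_cubes by simp
qed

text \<open>This is the squared L^2 norm of \<open>mart_diff cubes Q b\<close>.\<close>

definition osc :: "(real ^ 'n \<Rightarrow> 'k :: euclidean_space) \<Rightarrow> (real ^ 'n) set \<Rightarrow> real" where
  "osc b Q = (\<Sum>R\<in>ch Q. vol R * (norm (average R b - average Q b))\<^sup>2)"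

lemma osc_nonneg: "osc b Q \<ge> 0"
  unfolding osc_def by (intro sum_nonneg) auto

text \<open>Pythagoras: the average over Q is the volume-weighted mean of the averages over the
  children, which evaluates the cross term. In this form the sum over a tree telescopes.\<close>

lemma osc_eq:
  fixes b :: "real ^ 'n \<Rightarrow> 'k :: euclidean_space"
  assumes Q: "Q \<in> cubes" and b: "set_integrable lebesgue Q b"
  shows "osc b Q = (\<Sum>R\<in>ch Q. vol R * (norm (average R b))\<^sup>2) - vol Q * (norm (average Q b))\<^sup>2"
proof -
  define m where "m = average Q b"
  have "(\<Sum>R\<in>ch Q. vol R * inner (average R b) m) = inner (\<Sum>R\<in>ch Q. vol R *\<^sub>R average R b) m"
    by (simp add: inner_sum_left)
  also have "\<dots> = vol Q * (norm m)\<^sup>2"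
    unfolding average_ch[OF assms, symmetric] m_def by (simp add: power2_norm_eq_inner)
  finally have 1: "(\<Sum>R\<in>ch Q. vol R * inner (average R b) m) = vol Q * (norm m)\<^sup>2" .
  have "osc b Q = (\<Sum>R\<in>ch Q. vol R * (norm (average R b))\<^sup>2 - 2 * (vol R * inner (average R b) m)
      + vol R * (norm m)\<^sup>2)"
    unfolding osc_def m_def[symmetric]
    by (intro sum.cong refl) (simp add: power2_norm_eq_inner inner_diff inner_commute algebra_simps)
  also have "\<dots> = (\<Sum>R\<in>ch Q. vol R * (norm (average R b))\<^sup>2) - 2 * (vol Q * (norm m)\<^sup>2)
      + (\<Sum>R\<in>ch Q. vol R) * (norm m)\<^sup>2"
    by (simp add: sum.distrib sum_subtractf 1 sum_distrib_right flip: sum_distrib_left)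
  finally show ?thesis using vol_sum_ch[OF Q] by (simp add: m_def)
qed

text \<open>The shape of a tree cut off at stopping cubes: once a cube has left T, no cube below it
  can return to T.\<close>

definition up_closed :: "(real ^ 'n) set \<Rightarrow> (real ^ 'n) set set \<Rightarrow> bool" where
  "up_closed S T \<longleftrightarrow> (\<forall>P\<in>T. \<forall>Q\<in>cubes. P \<subseteq> Q \<longrightarrow> Q \<subseteq> S \<longrightarrow> Q \<in> T)"

text \<open>The sum of the oscillations telescopes along the tree.\<close>

lemma osc_sum_le:
  fixes b :: "real ^ 'n \<Rightarrow> 'k :: euclidean_space"
  assumes S: "S \<in> cubes" and b: "set_integrable lebesgue S b"
    and \<Phi>: "\<And>Q. Q \<in> cubes \<Longrightarrow> Q \<subseteq> S \<Longrightarrow> \<Phi> Q = (\<Sum>R\<in>ch Q. \<Phi> R)"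
    and T: "up_closed S T"
    and top: "vol S * (norm (average S b))\<^sup>2 \<le> \<Phi> S"
    and step: "\<And>Q R. Q \<in> T \<Longrightarrow> Q \<in> cubes \<Longrightarrow> Q \<subseteq> S \<Longrightarrow> R \<in> ch Q \<Longrightarrow>
      vol R * (norm (average R b))\<^sup>2 \<le> \<Phi> R"
  shows "(\<Sum>Q\<in>sub K S \<inter> T. osc b Q) \<le> \<Phi> S"
proof -
  define g where "g Q = (if Q \<in> T then osc b Q else 0)" for Q
  \<comment> \<open>The subtracted square makes the induction close: by \<open>osc_eq\<close> the
    squares of the children cancel against \<open>osc b Q\<close>. The majorant
    \<open>\<Phi>\<close> must dominate the square also at children that have just left T, which is
    what \<open>step\<close> provides.\<close>
  have "Q \<subseteq> S \<longrightarrow> vol Q * (norm (average Q b))\<^sup>2 \<le> \<Phi> Q \<longrightarrow>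
      (\<Sum>P\<in>sub K Q. g P) \<le> \<Phi> Q - vol Q * (norm (average Q b))\<^sup>2" if "Q \<in> cubes" for Q
    using that
  proof (induction Q rule: cube_induct[where K = K])
    case (leaf Q)
    then show ?case by (simp add: sub_empty)
  next
    case (node Q)
    show ?case
    proof (intro impI)
      assume Q: "Q \<subseteq> S" "vol Q * (norm (average Q b))\<^sup>2 \<le> \<Phi> Q"
      show "(\<Sum>P\<in>sub K Q. g P) \<le> \<Phi> Q - vol Q * (norm (average Q b))\<^sup>2"
      proof (cases "Q \<in> T")
        case False
        have "g P = 0" if "P \<in> sub K Q" for P
          using T False that Q node by (auto simp: g_def up_closed_def sub_def)
        then show ?thesis using Q by simp
      next
        case True
        have bQ: "set_integrable lebesgue Q b"
          using set_integrable_subset[OF b] Q node cube_sets by auto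
        have "(\<Sum>P\<in>sub K R. g P) \<le> \<Phi> R - vol R * (norm (average R b))\<^sup>2" if "R \<in> ch Q" for R
          using node.IH[OF that] step[OF True _ Q(1) that] ch_sub[OF _ that] node.hyps Q by blast
        then have "(\<Sum>R\<in>ch Q. \<Sum>P\<in>sub K R. g P)
            \<le> (\<Sum>R\<in>ch Q. \<Phi> R - vol R * (norm (average R b))\<^sup>2)"
          by (intro sum_mono)
        then have "(\<Sum>P\<in>sub K Q. g P) \<le> osc b Q + (\<Phi> Q - (\<Sum>R\<in>ch Q. vol R * (norm (average R b))\<^sup>2))"
          using True node \<Phi>[of Q] Q by (simp add: sum_sub_rec g_def sum_subtractf)
        then show ?thesis using osc_eq[OF _ bQ] node by simp
      qed
    qed
  qed
  then have "(\<Sum>P\<in>sub K S. g P) \<le> \<Phi> S - vol S * (norm (average S b))\<^sup>2"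
    using S top by auto
  moreover have "(\<Sum>P\<in>sub K S. g P) = (\<Sum>Q\<in>sub K S \<inter> T. osc b Q)"
    unfolding g_def using finite_sub[OF S] by (simp add: sum.inter_restrict)
  moreover have "vol S * (norm (average S b))\<^sup>2 \<ge> 0" by simp
  ultimately show ?thesis by linarith
qed

text \<open>An upper bound for the pairing of the two martingale differences on Q. With the norms
  inside the sum it also controls the pairing after multiplication by a scalar such as
  \<open>average Q f\<close>.\<close>

definition osc2 :: "(real ^ 'n \<Rightarrow> 'k :: euclidean_space) \<Rightarrow> (real ^ 'n \<Rightarrow> 'k) \<Rightarrow> (real ^ 'n) set \<Rightarrow> real" where
  "osc2 b g Q = (\<Sum>R\<in>ch Q. vol R * (norm (average R b - average Q b) * norm (average R g - average Q g)))"

lemma osc2_nonneg: "osc2 b g Q \<ge> 0"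
  unfolding osc2_def by (intro sum_nonneg) auto

lemma osc2_sum_le:
  assumes "finite F"
  shows "(\<Sum>Q\<in>F. osc2 b g Q) \<le> sqrt (\<Sum>Q\<in>F. osc b Q) * sqrt (\<Sum>Q\<in>F. osc g Q)"
proof -
  have 1: "osc2 b g Q \<le> sqrt (osc b Q) * sqrt (osc g Q)" for Q
  proof -
    have "(osc2 b g Q)\<^sup>2 = (\<Sum>R\<in>ch Q. (sqrt (vol R) * norm (average R b - average Q b)) *
        (sqrt (vol R) * norm (average R g - average Q g)))\<^sup>2"
      unfolding osc2_def by (intro arg_cong[where f="\<lambda>x. x\<^sup>2"] sum.cong) (auto simp: algebra_simps simp flip: real_sqrt_mult)
    also have "\<dots> \<le> osc b Q * osc g Q"
      unfolding osc_def 
      by (rule order_trans[OF Cauchy_Schwarz_ineq_sum]) (simp add: power_mult_distrib)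
    finally show ?thesis
      using real_le_rsqrt by (simp flip: real_sqrt_mult)
  qed
  have "(\<Sum>Q\<in>F. osc2 b g Q) \<le> (\<Sum>Q\<in>F. sqrt (osc b Q) * sqrt (osc g Q))"
    by (intro sum_mono 1)
  also have "\<dots> \<le> sqrt ((\<Sum>Q\<in>F. osc b Q) * (\<Sum>Q\<in>F. osc g Q))"
    by (intro real_le_rsqrt order_trans[OF Cauchy_Schwarz_ineq_sum]) (simp add: osc_nonneg)
  finally show ?thesis by (simp add: real_sqrt_mult)
qed

text \<open>C consists of the maximal cubes on which one of the three averages exceeds 6 times its
  value on S. Being disjoint, those that are bad for one measure fill at most a sixth of S, so all
  together at most half. The set in the last two claims collects the cubes with no bad cube between
  them and S.\<close>

lemma stopping_cubes:
  fixes M :: "nat \<Rightarrow> (real ^ 'n) measure"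
  assumes S: "S \<in> cubes" and M: "\<And>i. i < 3 \<Longrightarrow> sets (M i) = sets lebesgue"
    and fin: "\<And>i. i < 3 \<Longrightarrow> emeasure (M i) S < top"
  defines "a \<equiv> \<lambda>i Q. measure (M i) Q / vol Q"
  obtains C where "C \<subseteq> sub K S" "S \<notin> C" "disjoint C" "2 * (\<Sum>R\<in>C. vol R) \<le> vol S"
    "up_closed S {Q. \<forall>P\<in>cubes. Q \<subseteq> P \<longrightarrow> P \<subseteq> S \<longrightarrow> (\<forall>i<3. a i P \<le> 6 * a i S)}"
    "\<And>Q. Q \<in> sub K S \<Longrightarrow> (\<exists>R\<in>C. Q \<subseteq> R) \<or>
      Q \<in> {Q. \<forall>P\<in>cubes. Q \<subseteq> P \<longrightarrow> P \<subseteq> S \<longrightarrow> (\<forall>i<3. a i P \<le> 6 * a i S)}"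
proof -
  define bad where "bad i = {P \<in> sub K S. a i P > 6 * a i S}" for i
  define B where "B = (\<Union>i<3. bad i)"
  define C where "C = {R \<in> B. \<forall>P\<in>B. R \<subseteq> P \<longrightarrow> P = R}"
  have finB: "finite B" unfolding B_def bad_def using finite_sub[OF S] by auto
  have BS: "B \<subseteq> sub K S" unfolding B_def bad_def by auto
  have CB: "C \<subseteq> B" unfolding C_def by auto
  have a0: "a i P \<ge> 0" for i P by (simp add: a_def)
  have "S \<notin> B" using a0 by (auto simp: B_def bad_def not_less)
  then have 1: "S \<notin> C" using CB by blast
  have dis: "disjoint C"
    unfolding disjoint_def
  proof (intro ballI impI)
    fix P R assume "P \<in> C" "R \<in> C" "P \<noteq> R"
    moreover from this have "P \<in> cubes" "R \<in> cubes" using CB BS by (auto simp: sub_def)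
    ultimately show "P \<inter> R = {}" using cube_nest[of P R] unfolding C_def by blast
  qed
  have max: "\<exists>R\<in>C. Q \<subseteq> R" if QB: "Q \<in> B" for Q
  proof -
    obtain R where "R \<in> B" "Q \<subseteq> R" "\<And>P. P \<in> B \<Longrightarrow> R \<subseteq> P \<Longrightarrow> P = R"
      using finite_has_maximal2[OF finB QB] by metis
    then show ?thesis unfolding C_def by blast
  qed
  have Cbad: "6 * (\<Sum>R\<in>C \<inter> bad i. vol R) \<le> vol S" if "i < 3" for i
  proof -
    have cub: "R \<in> cubes" if "R \<in> C \<inter> bad i" for R using that by (auto simp: bad_def sub_def)
    have "(\<Sum>R\<in>C \<inter> bad i. 6 * a i S * vol R) \<le> (\<Sum>R\<in>C \<inter> bad i. measure (M i) R)"
    proof (intro sum_mono)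
      fix R assume R: "R \<in> C \<inter> bad i"
      then have "6 * a i S < measure (M i) R / vol R" by (simp add: bad_def a_def)
      then show "6 * a i S * vol R \<le> measure (M i) R"
        using vol_pos[OF cub[OF R]] by (simp add: pos_less_divide_eq)
    qed
    also have "\<dots> \<le> measure (M i) S"
    proof (rule sum_measure_le)
      show "finite (C \<inter> bad i)" using finB CB finite_subset by blast
      show "disjoint (C \<inter> bad i)" using dis by (auto simp: disjoint_def)
      show "C \<inter> bad i \<subseteq> sets (M i)" using cub cube_sets M that by auto
      show "\<Union>(C \<inter> bad i) \<subseteq> S" by (auto simp: bad_def sub_def)
      show "S \<in> fmeasurable (M i)" using M fin that cube_sets[OF S] by (auto intro!: fmeasurableI)
    qed
    also have "\<dots> = a i S * vol S" using vol_pos[OF S] by (simp add: a_def)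
    finally have *: "a i S * (6 * (\<Sum>R\<in>C \<inter> bad i. vol R)) \<le> a i S * vol S"
      by (simp add: sum_distrib_left[symmetric] mult_ac)
    show ?thesis
    proof (cases "a i S = 0")
      case False
      then have "a i S > 0" using a0[of i S] by linarith
      with * show ?thesis by (simp only: mult_le_cancel_left_pos)
    next
      \<comment> \<open>The Chebyshev estimate cannot be divided by \<open>a i S = 0\<close>, but
        then the measure vanishes on S and no cube is bad for it.\<close>
      case True
      then have S0: "measure (M i) S = 0" using vol_pos[OF S] by (simp add: a_def)
      have "bad i = {}"
      proof (rule ccontr)
        assume "bad i \<noteq> {}"
        then obtain R where R: "R \<in> sub K S" "a i R > 0" using True by (auto simp: bad_def)
        have "measure (M i) R \<le> measure (M i) S"
          using R M fin that cube_sets[OF S] cube_sets[of R]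
          by (intro measure_mono_fmeasurable) (auto simp: sub_def intro!: fmeasurableI)
        then show False using S0 R by (auto simp: a_def measure_le_0_iff)
      qed
      then show ?thesis by simp
    qed
  qed
  have "(\<Sum>R\<in>C. vol R) \<le> (\<Sum>i<3. \<Sum>R\<in>C \<inter> bad i. vol R)"
  proof -
    have "C = (\<Union>i\<in>{..<3}. C \<inter> bad i)" using CB by (auto simp: B_def)
    then have "(\<Sum>R\<in>C. vol R) = (\<Sum>R\<in>(\<Union>i\<in>{..<3}. C \<inter> bad i). vol R)" by simp
    also have "\<dots> \<le> (\<Sum>i<3. \<Sum>R\<in>C \<inter> bad i. vol R)"
      using finB CB finite_subset by (intro sum_UN_le) (auto intro: finite_subset)
    finally show ?thesis .
  qed
  also have "\<dots> \<le> (\<Sum>i<(3::nat). vol S / 6)" using Cbad by (intro sum_mono) force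
  finally have 2: "2 * (\<Sum>R\<in>C. vol R) \<le> vol S" by simp
  show thesis
  proof (rule that[of C])
    show "up_closed S {Q. \<forall>P\<in>cubes. Q \<subseteq> P \<longrightarrow> P \<subseteq> S \<longrightarrow> (\<forall>i<3. a i P \<le> 6 * a i S)}"
      unfolding up_closed_def by blast
  next
    fix Q assume Q: "Q \<in> sub K S"
    show "(\<exists>R\<in>C. Q \<subseteq> R) \<or> Q \<in> {Q. \<forall>P\<in>cubes. Q \<subseteq> P \<longrightarrow> P \<subseteq> S \<longrightarrow> (\<forall>i<3. a i P \<le> 6 * a i S)}"
    proof (rule disjCI)
      assume "Q \<notin> {Q. \<forall>P\<in>cubes. Q \<subseteq> P \<longrightarrow> P \<subseteq> S \<longrightarrow> (\<forall>i<3. a i P \<le> 6 * a i S)}"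
      then obtain P i where P: "P \<in> cubes" "Q \<subseteq> P" "P \<subseteq> S" "i < 3" "\<not> a i P \<le> 6 * a i S" by blast
      have "lev P < K" using cube_lev_mono[of P Q] P Q by (auto simp: sub_def)
      then have PB: "P \<in> B" using P by (auto simp: B_def bad_def sub_def not_le)
      then show "\<exists>R\<in>C. Q \<subseteq> R" using max[OF PB] P(2) by (meson order_trans)
    qed
  qed (use 1 dis 2 CB BS in auto)
qed

text \<open>The disjoint portions \<open>E Q\<close> are part of the notion because they are
  measured twice more: by a Muckenhoupt pair in \<open>sparse_ap_sum\<close>, and under a maximal
  function in \<open>sparse_Ainf_carleson\<close>.\<close>

definition sparse :: "(real ^ 'n) set set \<Rightarrow> bool" where
  "sparse \<S> \<longleftrightarrow> (\<exists>E. (\<forall>Q\<in>\<S>. E Q \<subseteq> Q \<and> E Q \<in> sets lebesgue \<and> vol Q \<le> 2 * vol (E Q)) \<and>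
     disjoint_family_on E \<S>)"

lemma sparse_UN_disjoint:
  assumes C: "disjoint C" and R: "\<And>R. R \<in> C \<Longrightarrow> sparse (s R) \<and> s R \<subseteq> Pow R \<inter> cubes"
  shows "sparse (\<Union>R\<in>C. s R)"
proof -
  obtain E where E: "\<And>R. R \<in> C \<Longrightarrow> (\<forall>Q\<in>s R. E R Q \<subseteq> Q \<and> E R Q \<in> sets lebesgue \<and> vol Q \<le> 2 * vol (E R Q)) \<and>
     disjoint_family_on (E R) (s R)"
    using R unfolding sparse_def by metis
  \<comment> \<open>Portions were chosen family by family; \<open>r Q\<close> fixes one family that
    contains Q, so that Q receives a single portion.\<close>
  define r where "r Q = (SOME R. R \<in> C \<and> Q \<in> s R)" for Q
  have r: "r Q \<in> C \<and> Q \<in> s (r Q)" if "Q \<in> (\<Union>R\<in>C. s R)" for Q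
  proof -
    have "\<exists>R. R \<in> C \<and> Q \<in> s R" using that by auto
    then show ?thesis unfolding r_def by (rule someI_ex)
  qed
  have "E (r Q) Q \<inter> E (r P) P = {}" if Q: "Q \<in> (\<Union>R\<in>C. s R)" and P: "P \<in> (\<Union>R\<in>C. s R)" and "Q \<noteq> P" for Q P
  proof (cases "r Q = r P")
    case True
    then show ?thesis using E[of "r P"] r[OF Q] r[OF P] \<open>Q \<noteq> P\<close> unfolding disjoint_family_on_def by simp
  next
    case False
    then have "r Q \<inter> r P = {}" using C r[OF Q] r[OF P] unfolding disjoint_def by blast
    moreover have "E (r Q) Q \<subseteq> r Q" "E (r P) P \<subseteq> r P"
      using E[of "r Q"] r[OF Q] E[of "r P"] r[OF P] R[of "r Q"] R[of "r P"] by (metis PowD IntD1 order_trans subset_iff)+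
    ultimately show ?thesis by blast
  qed
  then show ?thesis
    unfolding sparse_def
    using E r by (intro exI[of _ "\<lambda>Q. E (r Q) Q"]) (auto simp: disjoint_family_on_def)
qed

text \<open>The new cube receives \<open>S - \<Union>C\<close>: at least half of S, and disjoint
  from all the portions below C.\<close>

lemma sparse_insert:
  assumes "sparse \<S>" "S \<in> lmeasurable" "disjoint C" "finite C" "C \<subseteq> sets lebesgue"
    "\<Union>C \<subseteq> S" "2 * (\<Sum>R\<in>C. vol R) \<le> vol S" "\<And>Q. Q \<in> \<S> \<Longrightarrow> \<exists>R\<in>C. Q \<subseteq> R"
  shows "sparse (insert S \<S>)"
proof (cases "S \<in> \<S>")
  case True
  then show ?thesis using assms by (simp add: insert_absorb)
next
  case False
  obtain E where E: "\<And>Q. Q \<in> \<S> \<Longrightarrow> E Q \<subseteq> Q \<and> E Q \<in> sets lebesgue \<and> vol Q \<le> 2 * vol (E Q)"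
    "disjoint_family_on E \<S>"
    using assms(1) unfolding sparse_def by blast
  have CU: "\<Union>C \<in> sets lebesgue" using assms by auto
  have "vol (\<Union>C) \<le> (\<Sum>R\<in>C. vol R)"
    using measure_UNION_le[of C "\<lambda>R. R" lebesgue] assms by auto
  moreover have "vol (S - \<Union>C) = vol S - vol (\<Union>C)"
    using assms CU by (intro measure_Diff) (auto simp: fmeasurable_def)
  ultimately have "vol S \<le> 2 * vol (S - \<Union>C)" using assms by linarith
  moreover have "E Q \<inter> (S - \<Union>C) = {}" if Q: "Q \<in> \<S>" for Q
  proof -
    obtain R where "R \<in> C" "Q \<subseteq> R" using assms(8)[OF Q] by auto
    then show ?thesis using E(1)[OF Q] by auto
  qed
  moreover have "S - \<Union>C \<in> sets lebesgue" using CU assms(2) by auto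
  ultimately show ?thesis
    unfolding sparse_def using E False
    by (intro exI[of _ "E(S := S - \<Union>C)"]) (auto simp: disjoint_family_on_def)
qed

text \<open>The terms in the stopping tree of S are paid by \<open>G S\<close> through
  \<open>local\<close>; the others lie below a stopping cube, where the induction hypothesis
  supplies a sparse family. Here e stands for the terms of the form and G for its local
  bound.\<close>

lemma sparse_domination:
  fixes M :: "nat \<Rightarrow> (real ^ 'n) measure" and e G :: "(real ^ 'n) set \<Rightarrow> real"
  assumes S: "S \<in> cubes" and M: "\<And>i. i < 3 \<Longrightarrow> sets (M i) = sets lebesgue"
    and fin: "\<And>i Q. i < 3 \<Longrightarrow> Q \<in> cubes \<Longrightarrow> emeasure (M i) Q < top"
    and e: "\<And>Q. 0 \<le> e Q" and G: "\<And>Q. 0 \<le> G Q"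
    and local: "\<And>Q T. Q \<in> cubes \<Longrightarrow> up_closed Q T \<Longrightarrow>
      (\<And>P i. P \<in> T \<Longrightarrow> P \<in> cubes \<Longrightarrow> P \<subseteq> Q \<Longrightarrow> i < 3 \<Longrightarrow>
         measure (M i) P / vol P \<le> 6 * (measure (M i) Q / vol Q)) \<Longrightarrow>
      (\<Sum>P\<in>sub K Q \<inter> T. e P) \<le> G Q"
  shows "\<exists>\<S>\<subseteq>sub K S. sparse \<S> \<and> (\<Sum>Q\<in>sub K S. e Q) \<le> (\<Sum>Q\<in>\<S>. G Q)"
  using S
proof (induction S rule: cube_less_induct[where K = K])
  case (leaf S)
  then show ?case by (intro exI[of _ "{}"]) (auto simp: sub_empty sparse_def disjoint_family_on_def)
next
  case (node S)
  define T where "T = {Q. \<forall>P\<in>cubes. Q \<subseteq> P \<longrightarrow> P \<subseteq> S \<longrightarrow>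
    (\<forall>i<3. measure (M i) P / vol P \<le> 6 * (measure (M i) S / vol S))}"
  obtain C where C: "C \<subseteq> sub K S" "S \<notin> C" "disjoint C" "2 * (\<Sum>R\<in>C. vol R) \<le> vol S"
    "up_closed S T" "\<And>Q. Q \<in> sub K S \<Longrightarrow> (\<exists>R\<in>C. Q \<subseteq> R) \<or> Q \<in> T"
    using stopping_cubes[of S M K, folded T_def, OF node.hyps(1) M fin[OF _ node.hyps(1)]] by metis
  have finC: "finite C" using C(1) finite_sub[OF node.hyps(1)] finite_subset by blast
  have Ccub: "R \<in> cubes \<and> R \<subset> S" if "R \<in> C" for R using C that by (auto simp: sub_def)
  have "\<forall>R\<in>C. \<exists>\<S>\<subseteq>sub K R. sparse \<S> \<and> (\<Sum>Q\<in>sub K R. e Q) \<le> (\<Sum>Q\<in>\<S>. G Q)"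
    by (intro ballI node.IH) (use Ccub in auto)
  then obtain s where s: "\<And>R. R \<in> C \<Longrightarrow> s R \<subseteq> sub K R \<and> sparse (s R) \<and> (\<Sum>Q\<in>sub K R. e Q) \<le> (\<Sum>Q\<in>s R. G Q)"
    by metis
  define \<S> where "\<S> = insert S (\<Union>R\<in>C. s R)"
  have sR: "s R \<subseteq> Pow R \<inter> cubes" if "R \<in> C" for R using s[OF that] by (auto simp: sub_def)
  have fins: "finite (s R)" if "R \<in> C" for R
    using s[OF that] finite_sub[of R K] Ccub[OF that] finite_subset by blast
  have "sparse \<S>"
    unfolding \<S>_def
  proof (rule sparse_insert[where C = C])
    show "sparse (\<Union>R\<in>C. s R)" using C(3) s sR by (intro sparse_UN_disjoint) auto
    show "C \<subseteq> sets lebesgue" using Ccub cube_sets by blast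
    show "\<exists>R\<in>C. Q \<subseteq> R" if Q: "Q \<in> (\<Union>R\<in>C. s R)" for Q
    proof -
      obtain R where R: "R \<in> C" "Q \<in> s R" using Q by auto
      then show ?thesis using sR[OF R(1)] by auto
    qed
    show "\<Union>C \<subseteq> S" using Ccub by auto
  qed (use C(3,4) finC node.hyps cube_lmeasurable in auto)
  moreover have "\<S> \<subseteq> sub K S"
  proof
    fix Q assume "Q \<in> \<S>"
    then consider "Q = S" | R where "R \<in> C" "Q \<in> s R" unfolding \<S>_def by auto
    then show "Q \<in> sub K S"
    proof cases
      case 2
      then have "Q \<in> sub K R" using s[OF 2(1)] by auto
      then show ?thesis using Ccub[OF 2(1)] by (auto simp: sub_def)
    qed (use sub_self node.hyps in simp)
  qed
  moreover have "(\<Sum>Q\<in>sub K S. e Q) \<le> (\<Sum>Q\<in>\<S>. G Q)"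
  proof -
    have disj: "s R \<inter> s R' = {}" if "R \<in> C" "R' \<in> C" "R \<noteq> R'" for R R'
    proof -
      have "R \<inter> R' = {}" using C(3) that unfolding disjoint_def by blast
      then have "P = {} \<and> P \<in> cubes" if P: "P \<in> s R \<inter> s R'" for P
      proof -
        have "P \<subseteq> R" "P \<subseteq> R'" "P \<in> cubes"
          using sR[OF \<open>R \<in> C\<close>] sR[OF \<open>R' \<in> C\<close>] P by auto
        then show ?thesis using \<open>R \<inter> R' = {}\<close> by blast
      qed
      then show ?thesis using cube_nonempty by auto
    qed
    have "sub K S \<subseteq> (sub K S \<inter> T) \<union> (\<Union>R\<in>C. sub K R)"
      using C(6) by (auto simp: sub_def)
    then have "(\<Sum>Q\<in>sub K S. e Q) \<le> (\<Sum>Q\<in>(sub K S \<inter> T) \<union> (\<Union>R\<in>C. sub K R). e Q)"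
      using finite_sub[OF node.hyps(1)] finC Ccub finite_sub e by (intro sum_mono2 finite_UnI finite_UN_I) auto
    also have "\<dots> \<le> (\<Sum>Q\<in>sub K S \<inter> T. e Q) + (\<Sum>Q\<in>(\<Union>R\<in>C. sub K R). e Q)"
      using finite_sub[OF node.hyps(1)] finC Ccub finite_sub e by (subst sum_Un) (auto intro!: sum_nonneg)
    also have "\<dots> \<le> G S + (\<Sum>R\<in>C. \<Sum>Q\<in>sub K R. e Q)"
    proof (intro add_mono local sum_UN_le)
      fix P i assume P: "P \<in> T" "P \<in> cubes" "P \<subseteq> S" "i < (3::nat)"
      then show "measure (M i) P / vol P \<le> 6 * (measure (M i) S / vol S)" unfolding T_def by blast
    qed (use node.hyps C(5) finC Ccub finite_sub e in auto)
    also have "\<dots> \<le> G S + (\<Sum>R\<in>C. \<Sum>Q\<in>s R. G Q)"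
      using s by (intro add_left_mono sum_mono) auto
    also have "\<dots> = G S + (\<Sum>Q\<in>(\<Union>R\<in>C. s R). G Q)"
      using finC fins disj by (subst sum.UNION_disjoint) auto
    also have "\<dots> = (\<Sum>Q\<in>\<S>. G Q)"
    proof -
      have "S \<notin> (\<Union>R\<in>C. s R)"
      proof
        assume "S \<in> (\<Union>R\<in>C. s R)"
        then obtain R where R: "R \<in> C" "S \<in> s R" by auto
        then show False using sR[OF R(1)] Ccub[OF R(1)] by auto
      qed
      then show ?thesis unfolding \<S>_def using finC fins by (subst sum.insert) auto
    qed
    finally show ?thesis .
  qed
  ultimately show ?case by blast
qed

end

lemma powr_divide_eq:
  fixes x y a :: real
  assumes "0 < x" "0 < y"
  shows "(x / y) powr a = x powr a * y powr (- a)"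
  using assms by (simp add: powr_divide powr_minus field_simps)

context dyadic begin

text \<open>Two cubes need not lie in a common larger cube of the lattice (quadrants). A finite
  family is therefore placed under several disjoint tops, its ancestors in the smallest generation
  that occurs.\<close>

lemma finite_tops:
  assumes "finite F" "F \<subseteq> cubes"
  obtains C K where "finite C" "C \<subseteq> cubes" "disjoint C" "F \<subseteq> (\<Union>R\<in>C. sub K R)"
proof (cases "F = {}")
  case True
  then show thesis using that[of "{}" 0] by auto
next
  case False
  define k where "k = Min (lev ` F)"
  define K where "K = Max (lev ` F) + 1"
  have k: "k \<le> lev Q" "lev Q < K" if "Q \<in> F" for Q
    using that assms(1) Max_ge[of "lev ` F" "lev Q"] by (auto simp: k_def K_def)
  have "\<exists>P\<in>D k. Q \<subseteq> P" if Q: "Q \<in> F" for Q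
    using level_below[of Q k "nat (lev Q - k)"] k[OF Q] cube_lev[of Q] assms Q by auto
  then obtain t where t: "\<And>Q. Q \<in> F \<Longrightarrow> t Q \<in> D k \<and> Q \<subseteq> t Q" by metis
  show thesis
  proof (rule that[of "t ` F" K])
    show "disjoint (t ` F)"
      unfolding disjoint_def
    proof (intro ballI impI)
      fix P R assume "P \<in> t ` F" "R \<in> t ` F" "P \<noteq> R"
      moreover from this have "P \<in> D k" "R \<in> D k" using t by auto
      ultimately show "P \<inter> R = {}" using level_disjoint[of P k R] by auto
    qed
    show "t ` F \<subseteq> cubes" using t level_cubes by blast
    show "F \<subseteq> (\<Union>R\<in>t ` F. sub K R)"
    proof
      fix Q assume Q: "Q \<in> F"
      then have "Q \<in> sub K (t Q)" using t[OF Q] k[OF Q] assms(2) by (auto simp: sub_def)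
      then show "Q \<in> (\<Union>R\<in>t ` F. sub K R)" using Q by auto
    qed
  qed (use assms in auto)
qed

lemma sub_disjoint: "R \<inter> R' = {} \<Longrightarrow> sub K R \<inter> sub K R' = {}"
proof -
  assume *: "R \<inter> R' = {}"
  have "P = {}" if "P \<subseteq> R" "P \<subseteq> R'" for P using * that by blast
  then show ?thesis using cube_nonempty unfolding sub_def by auto
qed

lemma sparse_domination_finite:
  fixes M :: "nat \<Rightarrow> (real ^ 'n) measure" and e G :: "(real ^ 'n) set \<Rightarrow> real"
  assumes F: "finite F" "F \<subseteq> cubes" and M: "\<And>i. i < 3 \<Longrightarrow> sets (M i) = sets lebesgue"
    and fin: "\<And>i Q. i < 3 \<Longrightarrow> Q \<in> cubes \<Longrightarrow> emeasure (M i) Q < top"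
    and e: "\<And>Q. 0 \<le> e Q" and G: "\<And>Q. 0 \<le> G Q"
    and local: "\<And>Q T K. Q \<in> cubes \<Longrightarrow> up_closed Q T \<Longrightarrow>
      (\<And>P i. P \<in> T \<Longrightarrow> P \<in> cubes \<Longrightarrow> P \<subseteq> Q \<Longrightarrow> i < 3 \<Longrightarrow>
         measure (M i) P / vol P \<le> 6 * (measure (M i) Q / vol Q)) \<Longrightarrow>
      (\<Sum>P\<in>sub K Q \<inter> T. e P) \<le> G Q"
  shows "\<exists>\<S>. finite \<S> \<and> \<S> \<subseteq> cubes \<and> sparse \<S> \<and> (\<Sum>Q\<in>F. e Q) \<le> (\<Sum>Q\<in>\<S>. G Q)"
proof -
  obtain C K where C: "finite C" "C \<subseteq> cubes" "disjoint C" "F \<subseteq> (\<Union>R\<in>C. sub K R)"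
    using finite_tops[OF F] by metis
  have "\<forall>R\<in>C. \<exists>\<S>\<subseteq>sub K R. sparse \<S> \<and> (\<Sum>Q\<in>sub K R. e Q) \<le> (\<Sum>Q\<in>\<S>. G Q)"
    by (intro ballI sparse_domination[of _ M] M fin e G local) (use C in auto)
  then obtain s where s: "\<And>R. R \<in> C \<Longrightarrow> s R \<subseteq> sub K R \<and> sparse (s R) \<and> (\<Sum>Q\<in>sub K R. e Q) \<le> (\<Sum>Q\<in>s R. G Q)"
    by metis
  have fins: "finite (s R)" if "R \<in> C" for R
    using s[OF that] finite_sub[of R K] C that finite_subset by blast
  have disj: "s R \<inter> s R' = {}" if "R \<in> C" "R' \<in> C" "R \<noteq> R'" for R R'
  proof -
    have "R \<inter> R' = {}" using C(3) that unfolding disjoint_def by blast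
    then show ?thesis using sub_disjoint[of R R' K] s[OF that(1)] s[OF that(2)] by blast
  qed
  have fs: "finite (sub K R)" if "R \<in> C" for R using finite_sub[of R K] C that by auto
  have "(\<Sum>Q\<in>F. e Q) \<le> (\<Sum>Q\<in>(\<Union>R\<in>C. sub K R). e Q)"
    using C e fs by (intro sum_mono2) auto
  also have "\<dots> \<le> (\<Sum>R\<in>C. \<Sum>Q\<in>sub K R. e Q)"
    using C e fs by (intro sum_UN_le) auto
  also have "\<dots> \<le> (\<Sum>R\<in>C. \<Sum>Q\<in>s R. G Q)"
    using s by (intro sum_mono) auto
  also have "\<dots> = (\<Sum>Q\<in>(\<Union>R\<in>C. s R). G Q)"
    using C fins disj by (subst sum.UNION_disjoint) auto
  finally have "(\<Sum>Q\<in>F. e Q) \<le> (\<Sum>Q\<in>(\<Union>R\<in>C. s R). G Q)" .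
  moreover have "sparse (\<Union>R\<in>C. s R)"
  proof (rule sparse_UN_disjoint[OF C(3)])
    show "sparse (s R) \<and> s R \<subseteq> Pow R \<inter> cubes" if "R \<in> C" for R
      using s[OF that] by (auto simp: sub_def)
  qed
  moreover have "(\<Union>R\<in>C. s R) \<subseteq> cubes" using s by (force simp: sub_def)
  ultimately show ?thesis using C fins by (intro exI[of _ "\<Union>R\<in>C. s R"]) auto
qed

section \<open>Carleson embedding and weights\<close>

text \<open>
  A Bellman-function proof: with \<open>V\<close> the mass, \<open>X\<close> the integral and \<open>F\<close> the \<open>r\<close>-th power integral,
  and \<open>A\<close> the Carleson mass below \<open>Q\<close>, the sum below \<open>Q\<close> is at most a multiple of
  \<open>F - X\<^sup>r / (V + A / (r - 1))\<^sup>r\<^sup>-\<^sup>1\<close>.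
\<close>

lemma carleson_tree:
  fixes V X F :: "(real ^ 'n) set \<Rightarrow> real"
  assumes Q: "Q \<in> cubes" and r: "1 < r" and \<kappa>: "\<kappa> > 0"
    and V: "\<And>Q. Q \<in> cubes \<Longrightarrow> V Q > 0" "\<And>Q. Q \<in> cubes \<Longrightarrow> V Q = (\<Sum>R\<in>ch Q. V R)"
    and X: "\<And>Q. Q \<in> cubes \<Longrightarrow> X Q \<ge> 0" "\<And>Q. Q \<in> cubes \<Longrightarrow> X Q = (\<Sum>R\<in>ch Q. X R)"
    and F: "\<And>Q. Q \<in> cubes \<Longrightarrow> F Q = (\<Sum>R\<in>ch Q. F R)"
    and hold: "\<And>Q. Q \<in> cubes \<Longrightarrow> X Q powr r \<le> F Q * V Q powr (r - 1)"
    and carl: "\<And>Q. Q \<in> cubes \<Longrightarrow> (\<Sum>P\<in>sub K Q \<inter> \<S>. V P) \<le> \<kappa> * V Q"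
  shows "(\<Sum>P\<in>sub K Q \<inter> \<S>. (X P / V P) powr r * V P) \<le> \<kappa> * (r / (r - 1)) powr r * F Q"
proof -
  define C where "C = (r / (r - 1)) powr r"
  have C: "C > 0" using r by (simp add: C_def)
  \<comment> \<open>Dividing by \<kappa> normalises the Carleson condition: the sum of \<alpha>
    below Q is at most \<open>V Q\<close>.\<close>
  define \<alpha> where "\<alpha> P = (if P \<in> \<S> then V P / \<kappa> else 0)" for P
  have \<alpha>0: "P \<in> cubes \<Longrightarrow> \<alpha> P \<ge> 0" for P using V(1)[of P] \<kappa> by (simp add: \<alpha>_def)
  define Y where "Y Q = V Q + (\<Sum>P\<in>sub K Q. \<alpha> P) / (r - 1)" for Q
  define g where "g P = (X P / V P) powr r * (\<kappa> * \<alpha> P)" for P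
  have sumA: "(\<Sum>P\<in>sub K Q. \<alpha> P) \<le> V Q" if "Q \<in> cubes" for Q
  proof -
    have "(\<Sum>P\<in>sub K Q. \<alpha> P) = (\<Sum>P\<in>sub K Q \<inter> \<S>. V P) / \<kappa>"
      unfolding \<alpha>_def using finite_sub[OF that] by (auto simp: sum.inter_restrict sum_divide_distrib intro!: sum.cong)
    then show ?thesis using carl[OF that] \<kappa> by (simp add: pos_divide_le_eq mult.commute)
  qed
  have subc: "P \<in> cubes" if "P \<in> sub K Q" for P Q using that by (simp add: sub_def)
  have Ypos: "Y Q > 0" if "Q \<in> cubes" for Q
    using V(1)[OF that] r subc by (auto simp: Y_def intro!: add_pos_nonneg divide_nonneg_pos sum_nonneg \<alpha>0)
  \<comment> \<open>Y stays between V and \<open>r / (r - 1)\<close> times V. Replacing Y by V at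
    the end costs the r-th power of this ratio, which is the constant C.\<close>
  have Yle: "Y Q \<le> V Q * (r / (r - 1))" if "Q \<in> cubes" for Q
  proof -
    have "Y Q \<le> V Q + V Q / (r - 1)" using sumA[OF that] r by (simp add: Y_def divide_right_mono)
    also have "\<dots> = V Q * (r / (r - 1))" using r by (simp add: field_simps)
    finally show ?thesis .
  qed
  have "(\<Sum>P\<in>sub K Q. g P) \<le> \<kappa> * C * (F Q - X Q powr r * Y Q powr - (r - 1))"
    using Q
  proof (induction Q rule: cube_induct[where K = K])
    case (leaf Q)
    have "X Q powr r * V Q powr - (r - 1) \<le> F Q * V Q powr (r - 1) * V Q powr - (r - 1)"
      using hold[OF leaf(1)] by (intro mult_right_mono) auto
    also have "\<dots> = F Q" using V(1)[OF leaf(1)] by (simp add: mult.assoc flip: powr_add)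
    finally show ?case using leaf \<kappa> C by (simp add: sub_empty Y_def)
  next
    case (node Q)
    note Qc = node.hyps(1)
    define Z where "Z = (\<Sum>R\<in>ch Q. Y R)"
    have chc: "R \<in> cubes" if "R \<in> ch Q" for R using ch_cubes[OF that] .
    have "ch Q \<noteq> {}" using V(1)[OF Qc] V(2)[OF Qc] by auto
    then have Z: "Z > 0" unfolding Z_def using finite_ch[OF Qc] Ypos chc by (intro sum_pos) auto
    have YZ: "Y Q = Z + \<alpha> Q / (r - 1)"
      unfolding Y_def Z_def using node.hyps V(2)[OF Qc]
      by (simp add: sum_sub_rec sum.distrib add_divide_distrib sum_divide_distrib)
    \<comment> \<open>\<open>X powr r * Y powr - (r - 1)\<close> is convex and homogeneous of degree
      1 in (X, Y), hence subadditive over the children.\<close>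
    have cvx: "X Q powr r * Z powr - (r - 1) \<le> (\<Sum>R\<in>ch Q. X R powr r * Y R powr - (r - 1))"
    proof -
      have "X R = (X R powr r * Y R powr - (r - 1)) powr (1 / r) * Y R powr ((r - 1) / r)" if "R \<in> ch Q" for R
      proof -
        have "(X R powr r * Y R powr - (r - 1)) powr (1 / r) * Y R powr ((r - 1) / r)
            = X R * (Y R powr (- (r - 1) / r) * Y R powr ((r - 1) / r))"
          using r X(1)[OF chc[OF that]] Ypos[OF chc[OF that]] by (simp add: powr_mult powr_powr)
        also have "Y R powr (- (r - 1) / r) * Y R powr ((r - 1) / r) = 1"
          using Ypos[OF chc[OF that]] r by (simp flip: powr_add add_divide_distrib)
        finally show ?thesis by simp
      qed
      then have "X Q = (\<Sum>R\<in>ch Q. (X R powr r * Y R powr - (r - 1)) powr (1 / r) * Y R powr ((r - 1) / r))"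
        using X(2)[OF Qc] by simp
      also have "\<dots> \<le> (\<Sum>R\<in>ch Q. X R powr r * Y R powr - (r - 1)) powr (1 / r) * Z powr ((r - 1) / r)"
        unfolding Z_def using r Ypos chc finite_ch[OF Qc]
        by (intro holder_sum) (auto simp: less_imp_le diff_divide_distrib)
      finally have "X Q powr r \<le> ((\<Sum>R\<in>ch Q. X R powr r * Y R powr - (r - 1)) powr (1 / r) * Z powr ((r - 1) / r)) powr r"
        using X(1)[OF Qc] r by (intro powr_mono2) auto
      also have "\<dots> = (\<Sum>R\<in>ch Q. X R powr r * Y R powr - (r - 1)) * Z powr (r - 1)"
        using r Z by (simp add: powr_mult powr_powr sum_nonneg)
      finally have "X Q powr r * Z powr - (r - 1) \<le>
         (\<Sum>R\<in>ch Q. X R powr r * Y R powr - (r - 1)) * Z powr (r - 1) * Z powr - (r - 1)"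
        by (intro mult_right_mono) auto
      then show ?thesis using Z by (simp add: mult.assoc flip: powr_add)
    qed
    \<comment> \<open>Passing from Z to Y raises the second variable by
      \<open>\<alpha> Q / (r - 1)\<close>. The derivative of \<open>Y powr - (r - 1)\<close> has the
      factor r - 1, so the decrease is at least \<open>\<alpha> Q * Y Q powr - r\<close>, which pays
      for the term at Q.\<close>
    have gain: "g Q \<le> \<kappa> * C * (X Q powr r * Z powr - (r - 1) - X Q powr r * Y Q powr - (r - 1))"
    proof -
      have YQ: "Y Q > 0" using Ypos[OF Qc] .
      have "1 + (r - 1) * (1 - Z / Y Q) \<le> (Z / Y Q) powr - (r - 1)"
        using powr_tangent[of "Z / Y Q" "r - 1"] Z YQ r by simp
      also have "\<dots> = Z powr - (r - 1) * Y Q powr (r - 1)"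
        using Z YQ powr_divide_eq[of Z "Y Q" "- (r - 1)"] by simp
      also have "1 - Z / Y Q = \<alpha> Q / (r - 1) / Y Q" using YQ YZ by (simp add: field_simps)
      finally have "1 + \<alpha> Q / Y Q \<le> Z powr - (r - 1) * Y Q powr (r - 1)" using r by simp
      then have "(1 + \<alpha> Q / Y Q) * Y Q powr - (r - 1) \<le> Z powr - (r - 1) * Y Q powr (r - 1) * Y Q powr - (r - 1)"
        by (intro mult_right_mono) auto
      also have "\<dots> = Z powr - (r - 1)" using YQ by (simp add: mult.assoc flip: powr_add)
      finally have 1: "\<alpha> Q / Y Q * Y Q powr - (r - 1) \<le> Z powr - (r - 1) - Y Q powr - (r - 1)"
        by (simp add: algebra_simps)
      have "Y Q powr - (r - 1) / Y Q = Y Q powr (- r)"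
        using YQ powr_diff[of "Y Q" "- (r - 1)" 1] by simp
      then have 2: "\<alpha> Q * Y Q powr - r \<le> Z powr - (r - 1) - Y Q powr - (r - 1)"
        using 1 by (metis times_divide_eq_right times_divide_eq_left)
      have "(V Q * (r / (r - 1))) powr - r \<le> Y Q powr - r"
        using Yle[OF Qc] YQ r by (intro powr_mono2') auto
      also have "(V Q * (r / (r - 1))) powr - r = V Q powr - r / C"
        using V(1)[OF Qc] r by (simp add: C_def powr_mult powr_minus_divide del: times_divide_eq_right)
      finally have 3: "V Q powr - r \<le> C * Y Q powr - r" using C by (simp add: field_simps)
      have "g Q = X Q powr r * (\<kappa> * \<alpha> Q) * V Q powr - r"
        using X(1)[OF Qc] V(1)[OF Qc] by (simp add: g_def powr_divide powr_minus field_simps)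
      also have "\<dots> \<le> X Q powr r * (\<kappa> * \<alpha> Q) * (C * Y Q powr - r)"
        using 3 \<alpha>0[OF Qc] \<kappa> by (intro mult_left_mono) auto
      also have "\<dots> = \<kappa> * C * X Q powr r * (\<alpha> Q * Y Q powr - r)" by simp
      also have "\<dots> \<le> \<kappa> * C * X Q powr r * (Z powr - (r - 1) - Y Q powr - (r - 1))"
        using 2 \<kappa> C by (intro mult_left_mono) auto
      finally show ?thesis by (simp add: algebra_simps)
    qed
    have "(\<Sum>P\<in>sub K Q. g P) = g Q + (\<Sum>R\<in>ch Q. \<Sum>P\<in>sub K R. g P)"
      using node.hyps by (simp add: sum_sub_rec)
    also have "\<dots> \<le> g Q + (\<Sum>R\<in>ch Q. \<kappa> * C * (F R - X R powr r * Y R powr - (r - 1)))"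
      by (intro add_left_mono sum_mono node.IH)
    also have "\<dots> = g Q + \<kappa> * C * (F Q - (\<Sum>R\<in>ch Q. X R powr r * Y R powr - (r - 1)))"
      using F[OF Qc] by (simp add: sum_subtractf flip: sum_distrib_left)
    also have "\<dots> \<le> g Q + \<kappa> * C * (F Q - X Q powr r * Z powr - (r - 1))"
      using cvx \<kappa> C by (intro add_left_mono mult_left_mono) auto
    also have "\<dots> \<le> \<kappa> * C * (F Q - X Q powr r * Y Q powr - (r - 1))"
      using gain by (simp add: algebra_simps)
    finally show ?case .
  qed
  also have "\<dots> \<le> \<kappa> * C * F Q" using \<kappa> C by (intro mult_left_mono) auto
  also have "(\<Sum>P\<in>sub K Q. g P) = (\<Sum>P\<in>sub K Q \<inter> \<S>. (X P / V P) powr r * V P)"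
    unfolding g_def \<alpha>_def using finite_sub[OF Q] \<kappa> by (simp add: sum.inter_restrict if_distrib cong: if_cong)
  finally show ?thesis by (simp add: C_def)
qed

end

section \<open>Weights as measures, and the embedding for sparse families under a Muckenhoupt
  condition\<close>

definition wmeasure :: "(real ^ 'n \<Rightarrow> real) \<Rightarrow> (real ^ 'n) measure" where
  "wmeasure \<phi> = density lebesgue (\<lambda>x. ennreal (\<phi> x))"

abbreviation wmass :: "(real ^ 'n \<Rightarrow> real) \<Rightarrow> (real ^ 'n) set \<Rightarrow> real" where
  "wmass \<phi> \<equiv> measure (wmeasure \<phi>)"

lemma sets_wmeasure [simp, measurable_cong]: "sets (wmeasure \<phi>) = sets lebesgue"
  by (simp add: wmeasure_def)

lemma emeasure_wmeasure:
  "\<phi> \<in> borel_measurable lebesgue \<Longrightarrow> Q \<in> sets lebesgue \<Longrightarrow> emeasure (wmeasure \<phi>) Q = mass \<phi> Q"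
  unfolding wmeasure_def mass_def by (subst emeasure_density) auto

lemma emeasure_wmeasure_eq_measure:
  "emeasure (wmeasure \<phi>) Q < top \<Longrightarrow> emeasure (wmeasure \<phi>) Q = ennreal (wmass \<phi> Q)"
  by (simp add: emeasure_eq_ennreal_measure less_top)

lemma wmeasure_one: "wmass (\<lambda>_. 1) = measure lebesgue" "emeasure (wmeasure (\<lambda>_. 1)) = emeasure lebesgue"
  by (simp_all add: wmeasure_def density_1)

text \<open>With the pointwise factorisation as a hypothesis, interpolation of weights, the
  Muckenhoupt bound on portions and the L^p bounds for averages all become instances.\<close>

lemma wmeasure_holder:
  fixes a c g :: "real ^ 'n \<Rightarrow> real"
  assumes m [measurable]: "a \<in> borel_measurable lebesgue" "c \<in> borel_measurable lebesgue" "g \<in> borel_measurable lebesgue"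
      "Q \<in> sets lebesgue"
    and a0: "\<And>x. 0 \<le> a x" and c0: "\<And>x. 0 \<le> c x"
    and le: "\<And>x. g x \<le> a x powr s * c x powr t"
    and fin: "emeasure (wmeasure a) Q < top" "emeasure (wmeasure c) Q < top"
    and s: "0 < s" "0 < t" "s + t = 1"
  shows "emeasure (wmeasure g) Q \<le> ennreal (wmass a Q powr s * wmass c Q powr t)"
    and "emeasure (wmeasure g) Q < top"
    and "wmass g Q \<le> wmass a Q powr s * wmass c Q powr t"
proof -
  have i: "(\<integral>\<^sup>+x. ennreal (\<phi> x * indicator Q x) \<partial>lebesgue) = emeasure (wmeasure \<phi>) Q"
    if [measurable]: "\<phi> \<in> borel_measurable lebesgue" "\<And>x. 0 \<le> \<phi> x" for \<phi>
    by (subst emeasure_wmeasure) (auto simp: mass_def indicator_def intro!: nn_integral_cong)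
  have "emeasure (wmeasure g) Q \<le> (\<integral>\<^sup>+x. ennreal ((a x * indicator Q x) powr s * (c x * indicator Q x) powr t) \<partial>lebesgue)"
    by (subst emeasure_wmeasure) (auto simp: mass_def indicator_def intro!: nn_integral_mono ennreal_leI le)
  also have "\<dots> \<le> ennreal (wmass a Q powr s * wmass c Q powr t)"
    using a0 c0 s emeasure_wmeasure_eq_measure[OF fin(1)] emeasure_wmeasure_eq_measure[OF fin(2)]
    by (intro holder_nn) (auto simp: i)
  finally show 1: "emeasure (wmeasure g) Q \<le> ennreal (wmass a Q powr s * wmass c Q powr t)" .
  show 2: "emeasure (wmeasure g) Q < top" using 1 by (auto intro: le_less_trans)
  show "wmass g Q \<le> wmass a Q powr s * wmass c Q powr t"
    using 1 emeasure_wmeasure_eq_measure[OF 2] by simp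
qed

context dyadic begin

text \<open>Finiteness is asked on cubes only, since the trees see nothing else; compact sets follow
  by finite covers in \<open>cube_finite_compact\<close>.\<close>

definition cube_finite :: "(real ^ 'n \<Rightarrow> real) \<Rightarrow> bool" where
  "cube_finite \<phi> \<longleftrightarrow> \<phi> \<in> borel_measurable lebesgue \<and> (\<forall>Q\<in>cubes. emeasure (wmeasure \<phi>) Q < top)"

lemma cube_finiteD:
  assumes "cube_finite \<phi>"
  shows "\<phi> \<in> borel_measurable lebesgue" "Q \<in> cubes \<Longrightarrow> emeasure (wmeasure \<phi>) Q < top"
    "Q \<in> cubes \<Longrightarrow> Q \<in> fmeasurable (wmeasure \<phi>)"
    "Q \<in> cubes \<Longrightarrow> wmass \<phi> Q = (\<Sum>R\<in>ch Q. wmass \<phi> R)"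
    "Q \<in> cubes \<Longrightarrow> emeasure (wmeasure \<phi>) Q = ennreal (wmass \<phi> Q)"
    "Q \<in> cubes \<Longrightarrow> mass \<phi> Q = ennreal (wmass \<phi> Q)"
proof -
  show 1: "\<phi> \<in> borel_measurable lebesgue" and 2: "Q \<in> cubes \<Longrightarrow> emeasure (wmeasure \<phi>) Q < top" 
    using assms unfolding cube_finite_def by auto
  show "Q \<in> cubes \<Longrightarrow> Q \<in> fmeasurable (wmeasure \<phi>)" using 2 cube_sets by (auto intro!: fmeasurableI)
  show "Q \<in> cubes \<Longrightarrow> wmass \<phi> Q = (\<Sum>R\<in>ch Q. wmass \<phi> R)"
    using 2 by (intro measure_ch) auto
  show 3: "Q \<in> cubes \<Longrightarrow> emeasure (wmeasure \<phi>) Q = ennreal (wmass \<phi> Q)"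
    using 2 by (intro emeasure_wmeasure_eq_measure) auto
  show "Q \<in> cubes \<Longrightarrow> mass \<phi> Q = ennreal (wmass \<phi> Q)"
    using emeasure_wmeasure[OF 1 cube_sets] 3 by simp
qed

lemma cube_finite_pos:
  assumes "cube_finite w" "\<And>x. 0 < w x" "Q \<in> cubes"
  shows "0 < wmass w Q"
proof (rule ccontr)
  assume "\<not> ?thesis"
  then have "wmass w Q = 0" by (simp add: measure_nonneg order.antisym not_less)
  then have "mass w Q = 0" using cube_finiteD(6)[OF assms(1,3)] by simp
  then have "AE x in lebesgue. ennreal (w x) * indicator Q x = 0"
    unfolding mass_def using cube_finiteD(1)[OF assms(1)] cube_sets[OF assms(3)]
    by (subst (asm) nn_integral_0_iff_AE) auto
  then have "AE x in lebesgue. x \<notin> Q"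
  proof eventually_elim
    case (elim x)
    then show ?case using assms(2)[of x] by (auto simp: indicator_def ennreal_eq_0_iff split: if_splits)
  qed
  then have "Q \<in> null_sets lebesgue" using AE_iff_null_sets[OF cube_sets[OF assms(3)]] by simp
  then have "emeasure lebesgue Q = 0" by auto
  then show False using vol_pos[OF assms(3)] by (simp add: measure_def)
qed

text \<open>Write \<phi> as (\<phi>/w) w. Then \<open>wmass \<phi> P / wmass w P\<close> is the
  average of \<phi>/w with respect to w, and the integral bounded by B is the r-th power of its norm
  in L^r(w). The tree estimate is summed over disjoint tops.\<close>

lemma carleson_embedding:
  fixes w \<phi> :: "real ^ 'n \<Rightarrow> real"
  assumes r: "1 < r" and \<kappa>: "\<kappa> > 0" and w: "cube_finite w" "\<And>x. 0 < w x"
    and \<phi>: "cube_finite \<phi>" "\<And>x. 0 \<le> \<phi> x"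
    and B: "(\<integral>\<^sup>+x. ennreal (\<phi> x powr r * w x powr (1 - r)) \<partial>lebesgue) \<le> ennreal B" "0 \<le> B"
    and \<S>: "finite \<S>" "\<S> \<subseteq> cubes"
    and carl: "\<And>Q. Q \<in> cubes \<Longrightarrow> (\<Sum>P\<in>{P \<in> \<S>. P \<subseteq> Q}. wmass w P) \<le> \<kappa> * wmass w Q"
  shows "(\<Sum>P\<in>\<S>. (wmass \<phi> P / wmass w P) powr r * wmass w P)
    \<le> \<kappa> * (r / (r - 1)) powr r * B"
proof -
  define F where "F x = \<phi> x powr r * w x powr (1 - r)" for x
  have [measurable]: "w \<in> borel_measurable lebesgue" "\<phi> \<in> borel_measurable lebesgue"
    using cube_finiteD(1) w(1) \<phi>(1) by auto
  have Fm [measurable]: "F \<in> borel_measurable lebesgue" unfolding F_def by measurable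
  have FU: "emeasure (wmeasure F) UNIV \<le> ennreal B"
    using B(1) by (subst emeasure_wmeasure) (auto simp: mass_def F_def)
  then have FUt: "emeasure (wmeasure F) UNIV < top" by (auto intro: le_less_trans)
  have Fc: "cube_finite F"
    unfolding cube_finite_def
  proof (intro conjI ballI Fm)
    fix Q assume "Q \<in> cubes"
    have "emeasure (wmeasure F) Q \<le> emeasure (wmeasure F) UNIV" by (intro emeasure_mono) auto
    then show "emeasure (wmeasure F) Q < top" using FUt by (rule le_less_trans)
  qed
  have hold: "wmass \<phi> Q powr r \<le> wmass F Q * wmass w Q powr (r - 1)" if Q: "Q \<in> cubes" for Q
  proof -
    have "wmass \<phi> Q \<le> wmass F Q powr (1 / r) * wmass w Q powr ((r - 1) / r)"
    proof (rule wmeasure_holder(3))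
      fix x
      have "F x powr (1 / r) * w x powr ((r - 1) / r) = \<phi> x * (w x powr ((1 - r) / r) * w x powr ((r - 1) / r))"
        using \<phi>(2)[of x] r by (simp add: F_def powr_mult powr_powr)
      also have "w x powr ((1 - r) / r) * w x powr ((r - 1) / r) = 1"
        using w(2)[of x] by (simp flip: powr_add add_divide_distrib)
      finally show "\<phi> x \<le> F x powr (1 / r) * w x powr ((r - 1) / r)" by simp
    qed (use Q w \<phi> Fc r cube_finiteD(2) cube_sets in \<open>auto simp: F_def less_imp_le diff_divide_distrib\<close>)
    then have "wmass \<phi> Q powr r \<le> (wmass F Q powr (1 / r) * wmass w Q powr ((r - 1) / r)) powr r"
      using r by (intro powr_mono2) auto
    also have "\<dots> = wmass F Q * wmass w Q powr (r - 1)"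
      using r by (simp add: powr_mult powr_powr)
    finally show ?thesis .
  qed
  obtain C K where C: "finite C" "C \<subseteq> cubes" "disjoint C" "\<S> \<subseteq> (\<Union>R\<in>C. sub K R)"
    using finite_tops[OF \<S>] by metis
  let ?g = "\<lambda>P. (wmass \<phi> P / wmass w P) powr r * wmass w P"
  have tree: "(\<Sum>P\<in>sub K R \<inter> \<S>. ?g P) \<le> \<kappa> * (r / (r - 1)) powr r * wmass F R" if R: "R \<in> C" for R
  proof (rule carleson_tree)
    fix Q assume Q: "Q \<in> cubes"
    have "(\<Sum>P\<in>sub K Q \<inter> \<S>. wmass w P) \<le> (\<Sum>P\<in>{P \<in> \<S>. P \<subseteq> Q}. wmass w P)"
      using \<S>(1) by (intro sum_mono2) (auto simp: sub_def)
    then show "(\<Sum>P\<in>sub K Q \<inter> \<S>. wmass w P) \<le> \<kappa> * wmass w Q" using carl[OF Q] by linarith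
    show "wmass w Q > 0" using cube_finite_pos w Q by blast
    show "wmass w Q = (\<Sum>R\<in>ch Q. wmass w R)" "wmass \<phi> Q = (\<Sum>R\<in>ch Q. wmass \<phi> R)"
      "wmass F Q = (\<Sum>R\<in>ch Q. wmass F R)"
      using cube_finiteD(4) w(1) \<phi>(1) Fc Q by blast+
  qed (use R C r \<kappa> hold in auto)
  have "\<S> = (\<Union>R\<in>C. sub K R \<inter> \<S>)" using C by auto
  then have "(\<Sum>P\<in>\<S>. ?g P) = (\<Sum>P\<in>(\<Union>R\<in>C. sub K R \<inter> \<S>). ?g P)" by simp
  also have "\<dots> \<le> (\<Sum>R\<in>C. \<Sum>P\<in>sub K R \<inter> \<S>. ?g P)"
    using C \<S> by (intro sum_UN_le) auto
  also have "\<dots> \<le> (\<Sum>R\<in>C. \<kappa> * (r / (r - 1)) powr r * wmass F R)"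
    by (intro sum_mono tree)
  also have "\<dots> = \<kappa> * (r / (r - 1)) powr r * (\<Sum>R\<in>C. wmass F R)"
    by (simp add: sum_distrib_left)
  also have "(\<Sum>R\<in>C. wmass F R) \<le> wmass F UNIV"
    using C cube_sets FUt by (intro sum_measure_le) (auto intro!: fmeasurableI)
  also have "\<dots> \<le> B"
    using FU FUt emeasure_wmeasure_eq_measure[OF FUt] B(2) by simp
  finally show ?thesis using \<kappa> by (simp add: mult_left_mono)
qed

text \<open>Here u is an A_P weight with dual weight s. The condition is used twice: once to make
  the family Carleson for s with constant of order \<open>A powr (1 / (P - 1))\<close>, and once to
  exchange averages against volume for averages against s at the cost A. The total
  \<open>A powr (P / (P - 1))\<close> has the sharp P-th root
  \<open>A powr (1 / (P - 1))\<close>.\<close>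

lemma sparse_ap_sum:
  fixes u s \<phi> :: "real ^ 'n \<Rightarrow> real"
  assumes P: "1 < P" and u: "cube_finite u" "\<And>x. 0 < u x" and s: "cube_finite s" "\<And>x. 0 < s x"
    and us: "\<And>x. u x * s x powr (P - 1) = 1"
    and A: "0 < A" "\<And>Q. Q \<in> cubes \<Longrightarrow> wmass u Q * wmass s Q powr (P - 1) \<le> A * vol Q powr P"
    and \<phi>: "cube_finite \<phi>" "\<And>x. 0 \<le> \<phi> x"
    and B: "(\<integral>\<^sup>+x. ennreal (\<phi> x powr P * u x) \<partial>lebesgue) \<le> ennreal B" "0 \<le> B"
    and \<S>: "finite \<S>" "\<S> \<subseteq> cubes" "sparse \<S>"
  shows "(\<Sum>Q\<in>\<S>. (wmass \<phi> Q / vol Q) powr P * wmass u Q)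
    \<le> 2 powr (P / (P - 1)) * (P / (P - 1)) powr P * A powr (P / (P - 1)) * B"
proof -
  define \<kappa> where "\<kappa> = 2 powr (P / (P - 1)) * A powr (1 / (P - 1))"
  have \<kappa>: "\<kappa> > 0" using A by (simp add: \<kappa>_def)
  have Spos: "wmass s Q > 0" if "Q \<in> cubes" for Q using cube_finite_pos s that by blast
  have Upos: "wmass u Q > 0" if "Q \<in> cubes" for Q using cube_finite_pos u that by blast
  obtain E where E: "\<And>Q. Q \<in> \<S> \<Longrightarrow> E Q \<subseteq> Q \<and> E Q \<in> sets lebesgue \<and> vol Q \<le> 2 * vol (E Q)"
    "disjoint_family_on E \<S>"
    using \<S>(3) unfolding sparse_def by blast
  have up: "s x powr (1 - P) = u x" for x
    using us[of x] s(2)[of x] by (simp add: powr_diff field_simps)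
  have Efin: "emeasure (wmeasure w) (E Q) < top \<and> wmass w (E Q) \<le> wmass w Q \<and> E Q \<in> fmeasurable (wmeasure w)"
    if w: "cube_finite w" and Q: "Q \<in> \<S>" for w Q
  proof -
    have Qc: "Q \<in> cubes" using Q \<S> by auto
    have "emeasure (wmeasure w) (E Q) \<le> emeasure (wmeasure w) Q"
      using E(1)[OF Q] cube_sets[OF Qc] by (intro emeasure_mono) auto
    then have 1: "emeasure (wmeasure w) (E Q) < top" using cube_finiteD(2)[OF w Qc] by (rule le_less_trans)
    have "wmass w (E Q) \<le> wmass w Q"
      using E(1)[OF Q] cube_finiteD(3)[OF w Qc] by (intro measure_mono_fmeasurable) auto
    then show ?thesis using 1 E(1)[OF Q] by (auto intro!: fmeasurableI)
  qed
  \<comment> \<open>A portion that is large in volume is large for s: Hoelder applied to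
    \<open>1 = (u * s powr (P - 1)) powr (1 / P)\<close> on \<open>E Q\<close> bounds
    \<open>vol (E Q)\<close> by the masses of u and s, and the A_P bound on Q then removes
    u.\<close>
  have key: "wmass s Q \<le> \<kappa> * wmass s (E Q)" if Q: "Q \<in> \<S>" for Q
  proof -
    have Qc: "Q \<in> cubes" using Q \<S> by auto
    define v where "v = vol Q"
    define U where "U = wmass u Q"
    define S where "S = wmass s Q"
    define SE where "SE = wmass s (E Q)"
    have pos: "v > 0" "U > 0" "S > 0" "SE \<ge> 0" using vol_pos Upos Spos Qc by (auto simp: v_def U_def S_def SE_def)
    have "vol (E Q) \<le> wmass u (E Q) powr (1 / P) * SE powr ((P - 1) / P)"
      unfolding wmeasure_one(1)[symmetric] SE_def
    proof (rule wmeasure_holder(3))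
      fix x
      have "u x powr (1 / P) * s x powr ((P - 1) / P) = (u x * s x powr (P - 1)) powr (1 / P)"
        using u(2)[of x] by (simp add: powr_mult powr_powr)
      then show "1 \<le> u x powr (1 / P) * s x powr ((P - 1) / P)" using us by simp
    qed (use E(1)[OF Q] cube_finiteD(1)[OF u(1)] cube_finiteD(1)[OF s(1)] u(2) s(2) Efin[OF _ Q] u(1) s(1) P in
       \<open>auto simp: less_imp_le diff_divide_distrib\<close>)
    also have "\<dots> \<le> U powr (1 / P) * SE powr ((P - 1) / P)"
      using Efin[OF u(1) Q] P by (intro mult_right_mono powr_mono2) (auto simp: U_def)
    finally have "v \<le> 2 * (U powr (1 / P) * SE powr ((P - 1) / P))" using E(1)[OF Q] by (simp add: v_def)
    then have "v powr (P / (P - 1)) \<le> (2 * (U powr (1 / P) * SE powr ((P - 1) / P))) powr (P / (P - 1))"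
      using pos P by (intro powr_mono2) auto
    also have "\<dots> = 2 powr (P / (P - 1)) * (U powr (1 / (P - 1)) * SE)"
      using P pos by (simp add: powr_mult powr_powr)
    finally have 1: "v powr (P / (P - 1)) \<le> 2 powr (P / (P - 1)) * (U powr (1 / (P - 1)) * SE)" .
    have "(U * S powr (P - 1)) powr (1 / (P - 1)) \<le> (A * v powr P) powr (1 / (P - 1))"
      using A(2)[OF Qc] pos P by (intro powr_mono2) (auto simp: U_def S_def v_def)
    then have 2: "U powr (1 / (P - 1)) * S \<le> A powr (1 / (P - 1)) * v powr (P / (P - 1))"
      using pos P A(1) by (simp add: powr_mult powr_powr)
    have "S * v powr (P / (P - 1)) \<le> S * (2 powr (P / (P - 1)) * (U powr (1 / (P - 1)) * SE))"
      using 1 pos by (intro mult_left_mono) auto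
    also have "\<dots> = (U powr (1 / (P - 1)) * S) * (2 powr (P / (P - 1)) * SE)" by simp
    also have "\<dots> \<le> (A powr (1 / (P - 1)) * v powr (P / (P - 1))) * (2 powr (P / (P - 1)) * SE)"
      using 2 pos by (intro mult_right_mono) auto
    also have "\<dots> = (\<kappa> * SE) * v powr (P / (P - 1))" by (simp add: \<kappa>_def)
    finally have "S \<le> \<kappa> * SE" using pos by simp
    then show ?thesis by (simp add: S_def SE_def)
  qed
  have carl: "(\<Sum>P\<in>{P \<in> \<S>. P \<subseteq> Q}. wmass s P) \<le> \<kappa> * wmass s Q" if Q: "Q \<in> cubes" for Q
  proof -
    have "(\<Sum>P\<in>{P \<in> \<S>. P \<subseteq> Q}. wmass s P) \<le> (\<Sum>P\<in>{P \<in> \<S>. P \<subseteq> Q}. \<kappa> * wmass s (E P))"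
      by (intro sum_mono key) auto
    also have "\<dots> = \<kappa> * (\<Sum>P\<in>{P \<in> \<S>. P \<subseteq> Q}. wmass s (E P))" by (simp add: sum_distrib_left)
    also have "(\<Sum>P\<in>{P \<in> \<S>. P \<subseteq> Q}. wmass s (E P)) = wmass s (\<Union>P\<in>{P \<in> \<S>. P \<subseteq> Q}. E P)"
      using \<S>(1) Efin[OF s(1)] E(2)
      by (intro measure_UNION'[symmetric]) (auto simp: pairwise_def disjnt_def disjoint_family_on_def)
    also have "\<dots> \<le> wmass s Q"
      using E(1) \<S>(1) cube_finiteD(3)[OF s(1) Q] by (intro measure_mono_fmeasurable) auto
    finally show ?thesis using \<kappa> by (simp add: mult_left_mono)
  qed
  \<comment> \<open>Termwise, the left side is the Carleson term for s times
    \<open>U * S powr (P - 1) / v powr P\<close>, and this quotient is at most A.\<close>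
  have "(\<Sum>Q\<in>\<S>. (wmass \<phi> Q / vol Q) powr P * wmass u Q)
      \<le> (\<Sum>Q\<in>\<S>. A * ((wmass \<phi> Q / wmass s Q) powr P * wmass s Q))"
  proof (rule sum_mono)
    fix Q assume "Q \<in> \<S>"
    then have Q: "Q \<in> cubes" using \<S> by auto
    define X where "X = wmass \<phi> Q"
    define v where "v = vol Q"
    define U where "U = wmass u Q"
    define S where "S = wmass s Q"
    have pos: "v > 0" "U > 0" "S > 0" "X \<ge> 0" using vol_pos Upos Spos Q by (auto simp: v_def U_def S_def X_def)
    have "U * S powr (P - 1) / v powr P \<le> A" using A(2)[OF Q] pos by (simp add: U_def S_def v_def field_simps)
    then have "((X / S) powr P * S) * (U * S powr (P - 1) / v powr P) \<le> ((X / S) powr P * S) * A"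
      using pos by (intro mult_left_mono) auto
    moreover have "((X / S) powr P * S) * (U * S powr (P - 1) / v powr P) = (X / v) powr P * U"
      using pos by (simp add: powr_divide powr_diff)
    ultimately show "(X / v) powr P * U \<le> A * ((X / S) powr P * S)" by (simp add: mult.commute)
  qed
  also have "\<dots> = A * (\<Sum>Q\<in>\<S>. (wmass \<phi> Q / wmass s Q) powr P * wmass s Q)"
    by (simp add: sum_distrib_left)
  also have "\<dots> \<le> A * (\<kappa> * (P / (P - 1)) powr P * B)"
    using A(1) P \<kappa> s \<phi> B \<S> carl
    by (intro mult_left_mono carleson_embedding) (auto simp: up)
  also have "\<dots> = 2 powr (P / (P - 1)) * (P / (P - 1)) powr P * (A * A powr (1 / (P - 1))) * B"
    by (simp add: \<kappa>_def)
  also have "A * A powr (1 / (P - 1)) = A powr (P / (P - 1))"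
  proof -
    have "A * A powr (1 / (P - 1)) = A powr (1 + 1 / (P - 1))" using A(1) by (simp add: powr_add)
    also have "1 + 1 / (P - 1) = P / (P - 1)" using P by (simp add: field_simps)
    finally show ?thesis .
  qed
  finally show ?thesis .
qed

end

lemma ennreal_divide_le_imp:
  assumes "a / ennreal b \<le> ennreal c" "b > 0" "c \<ge> 0"
  shows "a \<le> ennreal (c * b)"
proof (cases a)
  case (real x)
  then have "x / b \<le> c" using assms by (simp add: divide_ennreal)
  then show ?thesis using assms real by (simp add: field_simps ennreal_leI)
next
  case top
  then show ?thesis using assms by (simp add: ennreal_top_divide top_unique)
qed

section \<open>Sparse bound of the bilinear form and its weighted estimate\<close>

context dyadic begin

definition cube_integrable :: "(real ^ 'n \<Rightarrow> 'k :: euclidean_space) \<Rightarrow> bool" where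
  "cube_integrable b \<longleftrightarrow> b \<in> borel_measurable lebesgue \<and> cube_finite (\<lambda>x. norm (b x))"

lemma cube_integrable_set_integrable:
  assumes "cube_integrable b" "Q \<in> cubes"
  shows "set_integrable lebesgue Q b"
proof -
  have [measurable]: "b \<in> borel_measurable lebesgue" "Q \<in> sets lebesgue"
    using assms cube_sets by (auto simp: cube_integrable_def)
  have "mass (\<lambda>x. norm (b x)) Q < top"
    using cube_finiteD(6)[of "\<lambda>x. norm (b x)" Q] assms by (simp add: cube_integrable_def)
  moreover have "mass (\<lambda>x. norm (b x)) Q = (\<integral>\<^sup>+x. ennreal (norm (indicat_real Q x *\<^sub>R b x)) \<partial>lebesgue)"
    unfolding mass_def by (intro nn_integral_cong) (auto simp: indicator_def)
  ultimately show ?thesis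
    unfolding set_integrable_def by (intro integrableI_bounded) auto
qed

lemma norm_average_le:
  assumes "cube_integrable b" "Q \<in> cubes"
  shows "norm (average Q b) \<le> wmass (\<lambda>x. norm (b x)) Q / vol Q"
proof -
  have bm [measurable]: "b \<in> borel_measurable lebesgue" "Q \<in> sets lebesgue"
    using assms cube_sets by (auto simp: cube_integrable_def)
  note i = cube_integrable_set_integrable[OF assms]
  have "ennreal (norm (LINT x:Q|lebesgue. b x)) \<le> (\<integral>\<^sup>+x. ennreal (norm (indicat_real Q x *\<^sub>R b x)) \<partial>lebesgue)"
    unfolding set_lebesgue_integral_def by (intro integral_norm_bound_ennreal i[unfolded set_integrable_def])
  also have "\<dots> = mass (\<lambda>x. norm (b x)) Q"
    unfolding mass_def by (intro nn_integral_cong) (auto simp: indicator_def)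
  also have "\<dots> = ennreal (wmass (\<lambda>x. norm (b x)) Q)"
    using cube_finiteD(6)[of "\<lambda>x. norm (b x)" Q] assms by (simp add: cube_integrable_def)
  finally show ?thesis
    using vol_pos[OF assms(2)] by (simp add: average_def divide_right_mono)
qed

text \<open>A child of a good cube may itself be a stopping cube with no bound of its own. It
  inherits one from its parent, at the cost of the volume ratio \<open>2 ^ CARD('n)\<close>.\<close>

lemma norm_average_ch_le:
  assumes b: "cube_integrable b" and Q: "Q \<in> cubes" and R: "R \<in> ch Q"
  shows "norm (average R b) \<le> 2 ^ CARD('n) * (wmass (\<lambda>x. norm (b x)) Q / vol Q)"
proof -
  have Rc: "R \<in> cubes" using ch_cubes[OF R] .
  have "wmass (\<lambda>x. norm (b x)) R \<le> wmass (\<lambda>x. norm (b x)) Q"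
    using b cube_finiteD(3)[of "\<lambda>x. norm (b x)" Q] Q ch_sub[OF Q R] cube_sets[OF Rc]
    by (intro measure_mono_fmeasurable) (auto simp: cube_integrable_def)
  then have "wmass (\<lambda>x. norm (b x)) R / vol R \<le> wmass (\<lambda>x. norm (b x)) Q / vol R"
    using vol_pos[OF Rc] by (simp add: divide_right_mono)
  then show ?thesis
    using norm_average_le[OF b Rc] vol_ch[OF Q R] vol_pos[OF Rc] by (simp add: field_simps)
qed

text \<open>The telescoping bound is applied with a constant multiple of volume as majorant: cubes
  of T have averages at most 6a, and their children at most \<open>2 ^ CARD('n)\<close> times
  that.\<close>

lemma osc_tree_le:
  assumes b: "cube_integrable b" and Q: "Q \<in> cubes" and T: "up_closed Q T"
    and le: "\<And>P. P \<in> T \<Longrightarrow> P \<in> cubes \<Longrightarrow> P \<subseteq> Q \<Longrightarrow>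
       wmass (\<lambda>x. norm (b x)) P / vol P \<le> 6 * a"
    and a: "a = wmass (\<lambda>x. norm (b x)) Q / vol Q"
  shows "(\<Sum>P\<in>sub K Q \<inter> T. osc b P) \<le> (6 * 2 ^ CARD('n) * a)\<^sup>2 * vol Q"
proof (rule osc_sum_le[where \<Phi> = "\<lambda>R. (6 * 2 ^ CARD('n) * a)\<^sup>2 * vol R"])
  have a0: "a \<ge> 0" by (simp add: a)
  have "norm (average Q b) \<le> 1 * a" using norm_average_le[OF b Q] by (simp add: a)
  also have "\<dots> \<le> (6 * 2 ^ CARD('n)) * a"
  proof (intro mult_right_mono a0)
    have "(1::real) \<le> 2 ^ CARD('n)" by simp
    then show "(1::real) \<le> 6 * 2 ^ CARD('n)" by linarith
  qed
  finally have "(norm (average Q b))\<^sup>2 \<le> (6 * 2 ^ CARD('n) * a)\<^sup>2"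
    by (intro power_mono) auto
  then show "vol Q * (norm (average Q b))\<^sup>2 \<le> (6 * 2 ^ CARD('n) * a)\<^sup>2 * vol Q"
    by (simp add: mult.commute mult_left_mono)
  show "(6 * 2 ^ CARD('n) * a)\<^sup>2 * vol P = (\<Sum>R\<in>ch P. (6 * 2 ^ CARD('n) * a)\<^sup>2 * vol R)"
    if "P \<in> cubes" for P using vol_sum_ch[OF that] by (simp add: sum_distrib_left)
  show "vol R * (norm (average R b))\<^sup>2 \<le> (6 * 2 ^ CARD('n) * a)\<^sup>2 * vol R"
    if "P \<in> T" "P \<in> cubes" "P \<subseteq> Q" "R \<in> ch P" for P R
  proof -
    have "norm (average R b) \<le> 2 ^ CARD('n) * (6 * a)"
      by (rule order_trans[OF norm_average_ch_le[OF b that(2,4)]], rule mult_left_mono[OF le[OF that(1-3)]]) simp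
    then have "(norm (average R b))\<^sup>2 \<le> (6 * 2 ^ CARD('n) * a)\<^sup>2"
      by (intro power_mono) auto
    then show ?thesis by (simp add: mult.commute mult_left_mono)
  qed
qed (use Q T cube_integrable_set_integrable[OF b] in auto)

text \<open>In one stopping tree the average of f comes out with a factor 6, and Cauchy-Schwarz
  leaves the two square sums, whose roots cost \<open>6 * 2 ^ CARD('n)\<close> each. The product is
  216 times \<open>4 ^ CARD('n)\<close>.\<close>

lemma form_sparse:
  fixes b g :: "real ^ 'n \<Rightarrow> 'k :: euclidean_space" and f :: "real ^ 'n \<Rightarrow> 'l :: euclidean_space"
  assumes b: "cube_integrable b" and f: "cube_integrable f" and g: "cube_integrable g"
    and F: "finite F" "F \<subseteq> cubes"
  shows "\<exists>\<S>. finite \<S> \<and> \<S> \<subseteq> cubes \<and> sparse \<S> \<and>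
    (\<Sum>Q\<in>F. norm (average Q f) * osc2 b g Q) \<le>
    216 * 4 ^ CARD('n) * (\<Sum>Q\<in>\<S>. (wmass (\<lambda>x. norm (b x)) Q / vol Q) *
      (wmass (\<lambda>x. norm (f x)) Q / vol Q) * (wmass (\<lambda>x. norm (g x)) Q / vol Q) * vol Q)"
proof -
  \<comment> \<open>The three measures of the stopping rule; the indices 0, 1, 2 stand for b, f,
    g.\<close>
  define M where "M i = (if i = 0 then wmeasure (\<lambda>x. norm (b x)) else if i = 1 then wmeasure (\<lambda>x. norm (f x))
    else wmeasure (\<lambda>x. norm (g x)))" for i :: nat
  let ?a = "\<lambda>b Q. wmass (\<lambda>x. norm (b x)) Q / vol Q"
  define G where "G Q = 216 * 4 ^ CARD('n) * (?a b Q * (wmass (\<lambda>x. norm (f x)) Q / vol Q) * ?a g Q * vol Q)" for Q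
  have "\<exists>\<S>. finite \<S> \<and> \<S> \<subseteq> cubes \<and> sparse \<S> \<and> (\<Sum>Q\<in>F. norm (average Q f) * osc2 b g Q) \<le> (\<Sum>Q\<in>\<S>. G Q)"
  proof (rule sparse_domination_finite[where M = M])
    show "sets (M i) = sets lebesgue" for i by (simp add: M_def)
    show "emeasure (M i) Q < top" if "Q \<in> cubes" for i Q
      using b f g cube_finiteD(2)[OF _ that] by (auto simp: M_def cube_integrable_def)
    show "0 \<le> norm (average Q f) * osc2 b g Q" for Q using osc2_nonneg[of b g Q] by simp
    show "0 \<le> G Q" for Q by (simp add: G_def)
  next
    fix Q T K assume Q: "Q \<in> cubes" and T: "up_closed Q T"
      and le: "\<And>P i. P \<in> T \<Longrightarrow> P \<in> cubes \<Longrightarrow> P \<subseteq> Q \<Longrightarrow> i < 3 \<Longrightarrow>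
         measure (M i) P / vol P \<le> 6 * (measure (M i) Q / vol Q)"
    define c where "c = (6::real) * 2 ^ CARD('n)"
    define B where "B = ?a b Q"
    define A where "A = wmass (\<lambda>x. norm (f x)) Q / vol Q"
    define H where "H = ?a g Q"
    have pos: "c > 0" "B \<ge> 0" "A \<ge> 0" "H \<ge> 0" by (auto simp: c_def B_def A_def H_def)
    have fin: "finite (sub K Q \<inter> T)" using finite_sub[OF Q] by auto
    have "(\<Sum>P\<in>sub K Q \<inter> T. norm (average P f) * osc2 b g P) \<le> (\<Sum>P\<in>sub K Q \<inter> T. 6 * A * osc2 b g P)"
    proof (intro sum_mono mult_right_mono osc2_nonneg)
      fix P assume P: "P \<in> sub K Q \<inter> T"
      have "norm (average P f) \<le> wmass (\<lambda>x. norm (f x)) P / vol P"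
        using norm_average_le[OF f] P by (auto simp: sub_def)
      also have "\<dots> \<le> 6 * A" using le[of P 1] P by (auto simp: sub_def M_def A_def)
      finally show "norm (average P f) \<le> 6 * A" .
    qed
    also have "\<dots> = 6 * A * (\<Sum>P\<in>sub K Q \<inter> T. osc2 b g P)" by (simp add: sum_distrib_left)
    also have "\<dots> \<le> 6 * A * (sqrt (\<Sum>P\<in>sub K Q \<inter> T. osc b P) * sqrt (\<Sum>P\<in>sub K Q \<inter> T. osc g P))"
      using pos by (intro mult_left_mono osc2_sum_le fin) auto
    also have "\<dots> \<le> 6 * A * (sqrt ((c * B)\<^sup>2 * vol Q) * sqrt ((c * H)\<^sup>2 * vol Q))"
    proof -
      have 1: "(\<Sum>P\<in>sub K Q \<inter> T. osc b P) \<le> (c * B)\<^sup>2 * vol Q"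
        unfolding c_def
      proof (rule osc_tree_le[OF b Q T])
        show "wmass (\<lambda>x. norm (b x)) P / vol P \<le> 6 * B" if "P \<in> T" "P \<in> cubes" "P \<subseteq> Q" for P
          using le[OF that, of 0] by (simp add: M_def B_def)
      qed (simp add: B_def)
      have 2: "(\<Sum>P\<in>sub K Q \<inter> T. osc g P) \<le> (c * H)\<^sup>2 * vol Q"
        unfolding c_def
      proof (rule osc_tree_le[OF g Q T])
        show "wmass (\<lambda>x. norm (g x)) P / vol P \<le> 6 * H" if "P \<in> T" "P \<in> cubes" "P \<subseteq> Q" for P
          using le[OF that, of 2] by (simp add: M_def H_def)
      qed (simp add: H_def)
      show ?thesis using pos 1 2 by (intro mult_left_mono mult_mono) (auto intro!: sum_nonneg osc_nonneg)
    qed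
    also have "sqrt ((c * B)\<^sup>2 * vol Q) * sqrt ((c * H)\<^sup>2 * vol Q) = (c * B) * (c * H) * vol Q"
      using pos vol_pos[OF Q] by (simp add: real_sqrt_mult)
    also have "6 * A * ((c * B) * (c * H) * vol Q) = G Q"
    proof -
      have "(4::real) ^ CARD('n) = 2 ^ CARD('n) * 2 ^ CARD('n)" by (simp flip: power_mult_distrib)
      then show ?thesis unfolding G_def A_def B_def H_def c_def by simp
    qed
    finally show "(\<Sum>P\<in>sub K Q \<inter> T. norm (average P f) * osc2 b g P) \<le> G Q" .
  qed (use F in auto)
  then show ?thesis unfolding G_def by (simp add: sum_distrib_left)
qed

text \<open>The mass of P is at most twice its average density times the volume of the portion
  \<open>E P\<close>. On the disjoint portions these densities stay below the maximal function
  localised to Q, whose integral is what the A_infinity characteristic controls.\<close>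

lemma sparse_Ainf_carleson:
  assumes w: "cube_finite w" "\<And>x. 0 < w x" and N: "Ainf_char cubes w \<le> ennreal N" "0 \<le> N"
    and \<S>: "finite \<S>" "\<S> \<subseteq> cubes" "sparse \<S>" and Q: "Q \<in> cubes"
  shows "(\<Sum>P\<in>{P \<in> \<S>. P \<subseteq> Q}. wmass w P) \<le> 2 * N * wmass w Q"
proof -
  obtain E where E: "\<And>Q. Q \<in> \<S> \<Longrightarrow> E Q \<subseteq> Q \<and> E Q \<in> sets lebesgue \<and> vol Q \<le> 2 * vol (E Q)"
    "disjoint_family_on E \<S>"
    using \<S>(3) unfolding sparse_def by blast
  define T where "T = {P \<in> \<S>. P \<subseteq> Q}"
  define c where "c P = wmass w P / vol P" for P
  define m where "m x = (SUP R\<in>{R \<in> cubes. x \<in> R \<and> R \<subseteq> Q}. mass w R / emeasure lebesgue R)" for x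
  have T: "finite T" "T \<subseteq> \<S>" using \<S> by (auto simp: T_def)
  have Tc: "P \<in> cubes" if "P \<in> T" for P using that T \<S> by auto
  have c: "mass w P / emeasure lebesgue P = ennreal (c P)" if "P \<in> cubes" for P
  proof -
    have "emeasure lebesgue P = ennreal (vol P)" using cube_lmeasurable[OF that] by (simp add: emeasure_eq_measure2)
    then show ?thesis using cube_finiteD(6)[OF w(1) that] vol_pos[OF that] by (simp add: divide_ennreal c_def)
  qed
  have Em: "E P \<in> lmeasurable" if "P \<in> T" for P
    using E(1)[of P] that T(2) cube_lmeasurable[OF Tc[OF that]] fmeasurableI2[of P lebesgue "E P"] by auto
  \<comment> \<open>At each x at most one term survives, and P itself competes in the
    supremum.\<close>
  have pw: "(\<Sum>P\<in>T. ennreal (c P) * indicator (E P) x) \<le> m x * indicator Q x" for x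
  proof (cases "\<exists>P\<in>T. x \<in> E P")
    case False
    then have "(\<Sum>P\<in>T. ennreal (c P) * indicator (E P) x) = 0" by (intro sum.neutral) auto
    then show ?thesis by simp
  next
    case True
    then obtain P where P: "P \<in> T" "x \<in> E P" by auto
    have "x \<notin> E R" if "R \<in> T - {P}" for R
      using E(2) P that T unfolding disjoint_family_on_def by blast
    then have "(\<Sum>P\<in>T. ennreal (c P) * indicator (E P) x) = ennreal (c P) * indicator (E P) x"
      using T P by (subst sum.remove[of T P]) auto
    also have "\<dots> = mass w P / emeasure lebesgue P" using P c[OF Tc] by simp
    also have "\<dots> \<le> m x" unfolding m_def
      using P E(1)[of P] T Tc by (intro SUP_upper) (auto simp: T_def)
    also have "\<dots> = m x * indicator Q x" using P E(1)[of P] T by (auto simp: T_def indicator_def)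
    finally show ?thesis .
  qed
  have "ennreal (\<Sum>P\<in>T. c P * vol (E P)) = (\<Sum>P\<in>T. ennreal (c P) * emeasure lebesgue (E P))"
  proof -
    have "c P \<ge> 0" for P by (simp add: c_def)
    then have "ennreal (\<Sum>P\<in>T. c P * vol (E P)) = (\<Sum>P\<in>T. ennreal (c P * vol (E P)))"
      by (intro sum_ennreal[symmetric]) auto
    also have "\<dots> = (\<Sum>P\<in>T. ennreal (c P) * emeasure lebesgue (E P))"
      using Em \<open>\<And>P. c P \<ge> 0\<close> by (intro sum.cong) (auto simp: ennreal_mult emeasure_eq_measure2)
    finally show ?thesis .
  qed
  also have "\<dots> = (\<integral>\<^sup>+x. (\<Sum>P\<in>T. ennreal (c P) * indicator (E P) x) \<partial>lebesgue)"
    using Em by (subst nn_integral_sum) (auto simp: nn_integral_cmult_indicator fmeasurableD intro!: sum.cong)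
  also have "\<dots> \<le> (\<integral>\<^sup>+x. m x * indicator Q x \<partial>lebesgue)"
    by (intro nn_integral_mono pw)
  also have "\<dots> \<le> ennreal (N * wmass w Q)"
  proof (rule ennreal_divide_le_imp)
    have "(\<integral>\<^sup>+x. m x * indicator Q x \<partial>lebesgue) / mass w Q \<le> Ainf_char cubes w"
      unfolding Ainf_char_def m_def using Q by (intro SUP_upper) auto
    then show "(\<integral>\<^sup>+x. m x * indicator Q x \<partial>lebesgue) / ennreal (wmass w Q) \<le> ennreal N"
      using N cube_finiteD(6)[OF w(1) Q] by simp
    show "wmass w Q > 0" using cube_finite_pos w Q by blast
  qed (rule N)
  finally have 1: "(\<Sum>P\<in>T. c P * vol (E P)) \<le> N * wmass w Q"
    using N by (simp add: ennreal_le_iff)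
  have "(\<Sum>P\<in>T. wmass w P) \<le> (\<Sum>P\<in>T. 2 * (c P * vol (E P)))"
  proof (rule sum_mono)
    fix P assume P: "P \<in> T"
    have "wmass w P = c P * vol P" using vol_pos[OF Tc[OF P]] by (simp add: c_def)
    also have "\<dots> \<le> c P * (2 * vol (E P))" using E(1)[of P] P T by (intro mult_left_mono) (auto simp: c_def)
    finally show "wmass w P \<le> 2 * (c P * vol (E P))" by simp
  qed
  also have "\<dots> = 2 * (\<Sum>P\<in>T. c P * vol (E P))" by (simp add: sum_distrib_left)
  also have "\<dots> \<le> 2 * N * wmass w Q" using 1 by simp
  finally show ?thesis by (simp add: T_def)
qed

end

text \<open>The constant of \<open>form_sparse\<close> times the three Carleson constants, each
  raised to its Hoelder exponent, with the weight characteristics taken out.\<close>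

definition form_const :: "real \<Rightarrow> real \<Rightarrow> real \<Rightarrow> nat \<Rightarrow> real" where
  "form_const r p s n = 216 * 4 ^ n * (2 * (r / (r - 1)) powr r) powr (1 / r) *
     (2 powr (p / (p - 1)) * (p / (p - 1)) powr p) powr (1 / p) *
     (2 powr (s / (s - 1)) * (s / (s - 1)) powr s) powr (1 / s)"

lemma form_const_pos: "1 < r \<Longrightarrow> 1 < p \<Longrightarrow> 1 < s \<Longrightarrow> form_const r p s n > 0"
  by (simp add: form_const_def)

context dyadic begin

text \<open>Since \<open>1 / p + 1 / s = 1 - 1 / r\<close>, the weight \<nu> is a geometric mean of
  \<mu> and \<omega> with exponents summing to 1, and both claims are Hoelder's inequality on a
  cube.\<close>

lemma weight_interpolation:
  fixes \<mu> \<omega> \<nu> :: "real ^ 'n \<Rightarrow> real"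
  assumes e: "1 < r" "1 < p" "1 < s" "1 / r + 1 / p + 1 / s = 1"
    and \<mu>: "cube_finite \<mu>" "\<And>x. 0 < \<mu> x" and \<omega>: "cube_finite \<omega>" "\<And>x. 0 < \<omega> x"
    and \<nu>: "\<And>x. 0 < \<nu> x" "\<And>x. \<nu> x powr (1 - 1 / r) = \<mu> x powr (1 / p) * \<omega> x powr (1 / s)"
  shows "cube_finite \<nu>"
    and "Q \<in> cubes \<Longrightarrow> wmass \<nu> Q powr (1 - 1 / r) \<le> wmass \<mu> Q powr (1 / p) * wmass \<omega> Q powr (1 / s)"
proof -
  define d where "d = 1 - 1 / r"
  have d: "0 < d" using e by (simp add: d_def)
  define \<theta> where "\<theta> = 1 / p / d"
  define t where "t = 1 / s / d"
  have "\<theta> + t = (1 / p + 1 / s) / d" by (simp add: \<theta>_def t_def add_divide_distrib)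
  also have "1 / p + 1 / s = d" using e by (simp add: d_def)
  finally have \<theta>: "0 < \<theta>" "0 < t" "\<theta> + t = 1"
    using d e by (auto simp: \<theta>_def t_def)
  have \<nu>eq: "\<nu> = (\<lambda>x. \<mu> x powr \<theta> * \<omega> x powr t)"
  proof
    fix x
    have "\<nu> x = (\<nu> x powr d) powr (1 / d)" using \<nu>(1)[of x] d by (simp add: powr_powr)
    also have "\<dots> = \<mu> x powr \<theta> * \<omega> x powr t"
      unfolding d_def \<nu>(2) by (simp add: powr_mult powr_powr \<theta>_def t_def d_def)
    finally show "\<nu> x = \<mu> x powr \<theta> * \<omega> x powr t" .
  qed
  have [measurable]: "\<mu> \<in> borel_measurable lebesgue" "\<omega> \<in> borel_measurable lebesgue"
    using cube_finiteD(1) \<mu>(1) \<omega>(1) by auto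
  have \<nu>m: "\<nu> \<in> borel_measurable lebesgue" unfolding \<nu>eq by measurable
  have h: "emeasure (wmeasure \<nu>) Q < top \<and> wmass \<nu> Q \<le> wmass \<mu> Q powr \<theta> * wmass \<omega> Q powr t"
    if Q: "Q \<in> cubes" for Q
  proof
    note prems = cube_finiteD(1)[OF \<mu>(1)] cube_finiteD(1)[OF \<omega>(1)] \<nu>m cube_sets[OF Q] less_imp_le[OF \<mu>(2)]
      less_imp_le[OF \<omega>(2)] _ cube_finiteD(2)[OF \<mu>(1) Q] cube_finiteD(2)[OF \<omega>(1) Q] \<theta>
    have le: "\<nu> x \<le> \<mu> x powr \<theta> * \<omega> x powr t" for x unfolding \<nu>eq by simp
    show "emeasure (wmeasure \<nu>) Q < top" by (rule wmeasure_holder(2)[OF prems]) (rule le)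
    show "wmass \<nu> Q \<le> wmass \<mu> Q powr \<theta> * wmass \<omega> Q powr t"
      by (rule wmeasure_holder(3)[OF prems]) (rule le)
  qed
  show "cube_finite \<nu>" using h \<nu>m by (simp add: cube_finite_def)
  assume Q: "Q \<in> cubes"
  have "wmass \<nu> Q powr d \<le> (wmass \<mu> Q powr \<theta> * wmass \<omega> Q powr t) powr d"
    using h[OF Q] d by (intro powr_mono2) auto
  also have "\<dots> = wmass \<mu> Q powr (1 / p) * wmass \<omega> Q powr (1 / s)"
    using d by (simp add: powr_mult powr_powr \<theta>_def t_def)
  finally show "wmass \<nu> Q powr (1 - 1 / r) \<le> wmass \<mu> Q powr (1 / p) * wmass \<omega> Q powr (1 / s)"
    by (simp add: d_def)
qed

text \<open>Triple Hoelder over the sparse family. The three sums are Carleson sums for \<nu>,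
  \<sigma> and \<tau>. In the application \<tau> is \<open>lam\<close> and \<omega> its dual weight,
  so the second Muckenhoupt pair enters from the dual side.\<close>

lemma form_bound:
  fixes b g :: "real ^ 'n \<Rightarrow> 'k :: euclidean_space" and f :: "real ^ 'n \<Rightarrow> 'l :: euclidean_space"
    and \<mu> \<sigma> \<omega> \<tau> \<nu> :: "real ^ 'n \<Rightarrow> real"
  assumes e: "1 < r" "1 < p" "1 < s" "1 / r + 1 / p + 1 / s = 1"
    and \<mu>: "cube_finite \<mu>" "\<And>x. 0 < \<mu> x" and \<sigma>: "cube_finite \<sigma>" "\<And>x. 0 < \<sigma> x"
    and \<omega>: "cube_finite \<omega>" "\<And>x. 0 < \<omega> x" and \<tau>: "cube_finite \<tau>" "\<And>x. 0 < \<tau> x"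
    and \<mu>\<sigma>: "\<And>x. \<mu> x * \<sigma> x powr (p - 1) = 1" and \<omega>\<tau>: "\<And>x. \<omega> x * \<tau> x powr (s - 1) = 1"
    and A: "0 < A" "\<And>Q. Q \<in> cubes \<Longrightarrow> wmass \<mu> Q * wmass \<sigma> Q powr (p - 1) \<le> A * vol Q powr p"
    and H: "0 < H" "\<And>Q. Q \<in> cubes \<Longrightarrow> wmass \<omega> Q * wmass \<tau> Q powr (s - 1) \<le> H * vol Q powr s"
    and \<nu>: "\<And>x. 0 < \<nu> x" "\<And>x. \<nu> x powr (1 - 1 / r) = \<mu> x powr (1 / p) * \<omega> x powr (1 / s)"
    and N: "Ainf_char cubes \<nu> \<le> ennreal N" "0 < N"
    and b: "cube_integrable b" "(\<integral>\<^sup>+x. ennreal (norm (b x) powr r * \<nu> x powr (1 - r)) \<partial>lebesgue) \<le> ennreal Bb" "0 \<le> Bb"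
    and f: "cube_integrable f" "(\<integral>\<^sup>+x. ennreal (norm (f x) powr p * \<mu> x) \<partial>lebesgue) \<le> ennreal Bf" "0 \<le> Bf"
    and g: "cube_integrable g" "(\<integral>\<^sup>+x. ennreal (norm (g x) powr s * \<omega> x) \<partial>lebesgue) \<le> ennreal Bg" "0 \<le> Bg"
    and F: "finite F" "F \<subseteq> cubes"
  shows "(\<Sum>Q\<in>F. norm (average Q f) * osc2 b g Q) \<le>
    form_const r p s CARD('n) * A powr (1 / (p - 1)) * H powr (1 / (s - 1)) * N powr (1 / r) *
      Bb powr (1 / r) * Bf powr (1 / p) * Bg powr (1 / s)"
proof -
  note \<nu>c = weight_interpolation(1)[OF e \<mu> \<omega> \<nu>]
  let ?b = "\<lambda>Q. wmass (\<lambda>x. norm (b x)) Q" and ?f = "\<lambda>Q. wmass (\<lambda>x. norm (f x)) Q"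
    and ?g = "\<lambda>Q. wmass (\<lambda>x. norm (g x)) Q"
  let ?V = "wmass \<nu>" and ?U = "wmass \<mu>" and ?W = "wmass \<omega>"
  obtain \<S> where \<S>: "finite \<S>" "\<S> \<subseteq> cubes" "sparse \<S>"
    "(\<Sum>Q\<in>F. norm (average Q f) * osc2 b g Q) \<le>
      216 * 4 ^ CARD('n) * (\<Sum>Q\<in>\<S>. (?b Q / vol Q) * (?f Q / vol Q) * (?g Q / vol Q) * vol Q)"
    using form_sparse[OF b(1) f(1) g(1) F] by blast
  define a1 where "a1 Q = (?b Q / ?V Q) powr r * ?V Q" for Q
  define a2 where "a2 Q = (?f Q / vol Q) powr p * ?U Q" for Q
  define a3 where "a3 Q = (?g Q / vol Q) powr s * ?W Q" for Q
  \<comment> \<open>One volume is traded for a \<nu>-mass: b is averaged against \<nu> instead, and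
    the factor \<open>?V Q\<close> that appears is distributed over the three Hoelder factors by
    interpolation.\<close>
  have cube_term: "(?b Q / vol Q) * (?f Q / vol Q) * (?g Q / vol Q) * vol Q
      \<le> a1 Q powr (1 / r) * a2 Q powr (1 / p) * a3 Q powr (1 / s)" if "Q \<in> \<S>" for Q
  proof -
    have Q: "Q \<in> cubes" using \<S> that by auto
    have pos: "vol Q > 0" "?V Q > 0" using vol_pos[OF Q] cube_finite_pos[OF \<nu>c \<nu>(1) Q] by auto
    have "(?b Q / vol Q) * (?f Q / vol Q) * (?g Q / vol Q) * vol Q = (?b Q / ?V Q) * (?f Q / vol Q) * (?g Q / vol Q) * ?V Q"
      using pos by simp
    also have "\<dots> \<le> (?b Q / ?V Q) * (?f Q / vol Q) * (?g Q / vol Q) * (?V Q powr (1 / r) * (?U Q powr (1 / p) * ?W Q powr (1 / s)))"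
    proof (intro mult_left_mono)
      have "?V Q = ?V Q powr (1 / r) * ?V Q powr (1 - 1 / r)"
        using pos by (simp flip: powr_add)
      also have "\<dots> \<le> ?V Q powr (1 / r) * (?U Q powr (1 / p) * ?W Q powr (1 / s))"
        using weight_interpolation(2)[OF e \<mu> \<omega> \<nu> Q] by (intro mult_left_mono) auto
      finally show "?V Q \<le> ?V Q powr (1 / r) * (?U Q powr (1 / p) * ?W Q powr (1 / s))" .
    qed auto
    also have "\<dots> = a1 Q powr (1 / r) * a2 Q powr (1 / p) * a3 Q powr (1 / s)"
      using e by (simp add: a1_def a2_def a3_def powr_mult powr_powr)
    finally show ?thesis .
  qed
  have S1: "(\<Sum>Q\<in>\<S>. a1 Q) \<le> 2 * N * (r / (r - 1)) powr r * Bb"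
    unfolding a1_def
    by (rule carleson_embedding[OF e(1) _ \<nu>c \<nu>(1) b(1)[unfolded cube_integrable_def, THEN conjunct2] _ b(2,3) \<S>(1,2)])
      (use N sparse_Ainf_carleson[OF \<nu>c \<nu>(1) N(1) _ \<S>(1-3)] in auto)
  have S2: "(\<Sum>Q\<in>\<S>. a2 Q) \<le> 2 powr (p / (p - 1)) * (p / (p - 1)) powr p * A powr (p / (p - 1)) * Bf"
    unfolding a2_def
    by (rule sparse_ap_sum[OF e(2) \<mu> \<sigma> \<mu>\<sigma> A f(1)[unfolded cube_integrable_def, THEN conjunct2] _ f(2,3) \<S>(1-3)]) auto
  have S3: "(\<Sum>Q\<in>\<S>. a3 Q) \<le> 2 powr (s / (s - 1)) * (s / (s - 1)) powr s * H powr (s / (s - 1)) * Bg"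
    unfolding a3_def
    by (rule sparse_ap_sum[OF e(3) \<omega> \<tau> \<omega>\<tau> H g(1)[unfolded cube_integrable_def, THEN conjunct2] _ g(2,3) \<S>(1-3)]) auto
  have nn: "0 \<le> a1 Q" "0 \<le> a2 Q" "0 \<le> a3 Q" for Q by (auto simp: a1_def a2_def a3_def)
  have "(\<Sum>Q\<in>\<S>. (?b Q / vol Q) * (?f Q / vol Q) * (?g Q / vol Q) * vol Q)
      \<le> (\<Sum>Q\<in>\<S>. a1 Q powr (1 / r) * a2 Q powr (1 / p) * a3 Q powr (1 / s))"
    by (intro sum_mono cube_term)
  also have "\<dots> \<le> (\<Sum>Q\<in>\<S>. a1 Q) powr (1 / r) * (\<Sum>Q\<in>\<S>. a2 Q) powr (1 / p) * (\<Sum>Q\<in>\<S>. a3 Q) powr (1 / s)"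
    using e nn \<S> by (intro holder_sum3) auto
  also have "\<dots> \<le> (2 * N * (r / (r - 1)) powr r * Bb) powr (1 / r) *
      (2 powr (p / (p - 1)) * (p / (p - 1)) powr p * A powr (p / (p - 1)) * Bf) powr (1 / p) *
      (2 powr (s / (s - 1)) * (s / (s - 1)) powr s * H powr (s / (s - 1)) * Bg) powr (1 / s)"
    using e S1 S2 S3 nn by (intro mult_mono powr_mono2) (auto intro!: sum_nonneg)
  finally have "(\<Sum>Q\<in>F. norm (average Q f) * osc2 b g Q) \<le> 216 * 4 ^ CARD('n) *
     ((2 * N * (r / (r - 1)) powr r * Bb) powr (1 / r) *
      (2 powr (p / (p - 1)) * (p / (p - 1)) powr p * A powr (p / (p - 1)) * Bf) powr (1 / p) *
      (2 powr (s / (s - 1)) * (s / (s - 1)) powr s * H powr (s / (s - 1)) * Bg) powr (1 / s))"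
    using \<S>(4) by (meson mult_left_mono order_trans zero_le_numeral zero_le_power mult_nonneg_nonneg)
  also have "(2 * N * (r / (r - 1)) powr r * Bb) powr (1 / r)
      = (2 * (r / (r - 1)) powr r) powr (1 / r) * N powr (1 / r) * Bb powr (1 / r)"
    by (simp only: powr_mult mult_ac)
  also have "(2 powr (p / (p - 1)) * (p / (p - 1)) powr p * A powr (p / (p - 1)) * Bf) powr (1 / p)
      = (2 powr (p / (p - 1)) * (p / (p - 1)) powr p) powr (1 / p) * A powr (1 / (p - 1)) * Bf powr (1 / p)"
    using e(2) by (simp only: powr_mult[of _ Bf] powr_mult[of _ "A powr _"] powr_powr) simp
  also have "(2 powr (s / (s - 1)) * (s / (s - 1)) powr s * H powr (s / (s - 1)) * Bg) powr (1 / s)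
      = (2 powr (s / (s - 1)) * (s / (s - 1)) powr s) powr (1 / s) * H powr (1 / (s - 1)) * Bg powr (1 / s)"
    using e(3) by (simp only: powr_mult[of _ Bg] powr_mult[of _ "H powr _"] powr_powr) simp
  finally show ?thesis by (simp add: form_const_def mult_ac)
qed

section \<open>Partial sums of the paraproduct and duality\<close>

definition partial_para :: "(real ^ 'n \<Rightarrow> 'k :: {real_normed_field, euclidean_space}) \<Rightarrow> (real ^ 'n \<Rightarrow> 'k) \<Rightarrow>
    (real ^ 'n) set set \<Rightarrow> real ^ 'n \<Rightarrow> 'k" where
  "partial_para b f F x = (\<Sum>Q\<in>F. mart_diff cubes Q b x * average Q f)"

lemma indicator_ch:
  assumes "Q \<in> cubes" shows "indicat_real Q x = (\<Sum>R\<in>ch Q. indicat_real R x)"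
proof (cases "x \<in> Q")
  case True
  then obtain R where R: "R \<in> ch Q" "x \<in> R" using ch_Union[OF assms] by auto
  have "x \<notin> P" if "P \<in> ch Q - {R}" for P
    using ch_disjoint[OF assms] R that unfolding disjoint_def by blast
  then have "(\<Sum>R\<in>ch Q. indicat_real R x) = indicat_real R x"
    using R finite_ch[OF assms] by (subst sum.remove[of _ R]) auto
  then show ?thesis using True R by simp
next
  case False
  then have "x \<notin> R" if "R \<in> ch Q" for R using ch_sub[OF assms that] by auto
  then have "(\<Sum>R\<in>ch Q. indicat_real R x) = 0" by (intro sum.neutral) auto
  then show ?thesis using False by simp
qed

lemma mart_diff_eq:
  assumes "Q \<in> cubes"
  shows "mart_diff cubes Q b x = (\<Sum>R\<in>ch Q. indicat_real R x *\<^sub>R (average R b - average Q b))"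
  unfolding mart_diff_def ch_def[symmetric] indicator_ch[OF assms]
  by (simp add: scaleR_diff_right sum_subtractf scaleR_sum_left)

lemma mart_diff_measurable:
  fixes b :: "real ^ 'n \<Rightarrow> 'k :: euclidean_space"
  assumes "Q \<in> cubes" shows "mart_diff cubes Q b \<in> borel_measurable lebesgue"
proof -
  have [measurable]: "R \<in> sets lebesgue" if "R \<in> ch Q" for R using ch_cubes[OF that] cube_sets by auto
  have "(\<lambda>x. \<Sum>R\<in>ch Q. indicat_real R x *\<^sub>R (average R b - average Q b)) \<in> borel_measurable lebesgue"
    by (intro borel_measurable_sum borel_measurable_scaleR borel_measurable_indicator borel_measurable_const) auto
  moreover have "mart_diff cubes Q b = (\<lambda>x. \<Sum>R\<in>ch Q. indicat_real R x *\<^sub>R (average R b - average Q b))"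
    by (intro ext mart_diff_eq assms)
  ultimately show ?thesis by simp
qed

lemma mart_diff_zero:
  assumes "Q \<in> cubes" "x \<notin> Q" shows "mart_diff cubes Q b x = 0"
proof -
  have "x \<notin> R" if "R \<in> ch Q" for R using ch_sub[OF assms(1) that] assms(2) by auto
  then show ?thesis unfolding mart_diff_eq[OF assms(1)] by (intro sum.neutral) auto
qed

lemma mart_diff_bounded:
  assumes "Q \<in> cubes"
  shows "norm (mart_diff cubes Q b x) \<le> (\<Sum>R\<in>ch Q. norm (average R b - average Q b))"
  unfolding mart_diff_eq[OF assms]
  by (intro sum_norm_le) (auto simp: indicator_def)

text \<open>The martingale difference has mean zero on Q, so \<open>average Q g\<close> may be
  subtracted from the averages of g. The pairing uses the real inner product of the scalar field;
  over \<open>complex\<close> it is the real part of the usual one, and this is enough because the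
  duality arguments choose g aligned with the function tested.\<close>

lemma mart_diff_pairing:
  fixes b g :: "real ^ 'n \<Rightarrow> 'k :: {real_normed_field, euclidean_space}"
  assumes Q: "Q \<in> cubes" and b: "cube_integrable b" and g: "cube_integrable g"
  shows "integrable lebesgue (\<lambda>x. inner (mart_diff cubes Q b x * c) (g x))"
    and "(LINT x|lebesgue. inner (mart_diff cubes Q b x * c) (g x)) \<le> norm c * osc2 b g Q"
proof -
  define d where "d R = (average R b - average Q b) * c" for R
  have eq: "inner (mart_diff cubes Q b x * c) (g x) = (\<Sum>R\<in>ch Q. inner (d R) (indicat_real R x *\<^sub>R g x))" for x
    unfolding mart_diff_eq[OF Q] by (simp add: sum_distrib_right inner_sum_left d_def)
  have i: "integrable lebesgue (\<lambda>x. indicat_real R x *\<^sub>R g x)" if "R \<in> ch Q" for R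
    using cube_integrable_set_integrable[OF g ch_cubes[OF that]] by (simp add: set_integrable_def)
  show "integrable lebesgue (\<lambda>x. inner (mart_diff cubes Q b x * c) (g x))"
    unfolding eq using i by (intro Bochner_Integration.integrable_sum integrable_inner_right)
  have "(LINT x|lebesgue. inner (mart_diff cubes Q b x * c) (g x))
     = (\<Sum>R\<in>ch Q. inner (d R) (LINT x|lebesgue. indicat_real R x *\<^sub>R g x))"
  proof -
    have "(LINT x|lebesgue. inner (d R) (indicat_real R x *\<^sub>R g x)) = inner (d R) (LINT x|lebesgue. indicat_real R x *\<^sub>R g x)"
      if "R \<in> ch Q" for R using i[OF that] by (rule integral_inner_right)
    then show ?thesis
      unfolding eq using i by (subst Bochner_Integration.integral_sum) (auto intro!: integrable_inner_right sum.cong simp del: inner_scaleR_right)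
  qed
  also have "\<dots> = (\<Sum>R\<in>ch Q. vol R * inner (d R) (average R g))"
    using vol_pos[OF ch_cubes] by (intro sum.cong) (auto simp: average_def set_lebesgue_integral_def less_imp_neq[THEN not_sym])
  also have "\<dots> = (\<Sum>R\<in>ch Q. vol R * inner (d R) (average R g - average Q g))"
  proof -
    have "(\<Sum>R\<in>ch Q. vol R *\<^sub>R d R) = ((\<Sum>R\<in>ch Q. vol R *\<^sub>R average R b) - (\<Sum>R\<in>ch Q. vol R) *\<^sub>R average Q b) * c"
      by (simp add: d_def sum_distrib_right scaleR_diff_right sum_subtractf scaleR_sum_left left_diff_distrib)
    also have "\<dots> = 0"
      using average_ch[OF Q cube_integrable_set_integrable[OF b Q]] vol_sum_ch[OF Q] by simp
    finally have "(\<Sum>R\<in>ch Q. vol R * inner (d R) (average Q g)) = 0"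
      using inner_sum_left[of "\<lambda>R. vol R *\<^sub>R d R" "ch Q" "average Q g"] by simp
    then show ?thesis by (simp add: inner_diff_right right_diff_distrib sum_subtractf)
  qed
  also have "\<dots> \<le> (\<Sum>R\<in>ch Q. norm c * (vol R * (norm (average R b - average Q b) * norm (average R g - average Q g))))"
  proof (rule sum_mono)
    fix R
    have "inner (d R) (average R g - average Q g) \<le> norm (d R) * norm (average R g - average Q g)"
      by (rule norm_cauchy_schwarz)
    then have "vol R * inner (d R) (average R g - average Q g) \<le> vol R * (norm (d R) * norm (average R g - average Q g))"
      by (intro mult_left_mono) auto
    then show "vol R * inner (d R) (average R g - average Q g)
      \<le> norm c * (vol R * (norm (average R b - average Q b) * norm (average R g - average Q g)))"
      by (simp add: d_def norm_mult mult_ac)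
  qed
  also have "\<dots> = norm c * osc2 b g Q" by (simp add: osc2_def sum_distrib_left)
  finally show "(LINT x|lebesgue. inner (mart_diff cubes Q b x * c) (g x)) \<le> norm c * osc2 b g Q" .
qed

lemma partial_para_pairing:
  fixes b g f :: "real ^ 'n \<Rightarrow> 'k :: {real_normed_field, euclidean_space}"
  assumes F: "finite F" "F \<subseteq> cubes" and b: "cube_integrable b" and g: "cube_integrable g"
  shows "integrable lebesgue (\<lambda>x. inner (partial_para b f F x) (g x))"
    and "(LINT x|lebesgue. inner (partial_para b f F x) (g x)) \<le> (\<Sum>Q\<in>F. norm (average Q f) * osc2 b g Q)"
proof -
  have eq: "inner (partial_para b f F x) (g x) = (\<Sum>Q\<in>F. inner (mart_diff cubes Q b x * average Q f) (g x))" for x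
    by (simp add: partial_para_def inner_sum_left)
  have i: "integrable lebesgue (\<lambda>x. inner (mart_diff cubes Q b x * average Q f) (g x))" if "Q \<in> F" for Q
    using mart_diff_pairing(1)[OF _ b g] F that by blast
  show "integrable lebesgue (\<lambda>x. inner (partial_para b f F x) (g x))"
    unfolding eq using i by auto
  show "(LINT x|lebesgue. inner (partial_para b f F x) (g x)) \<le> (\<Sum>Q\<in>F. norm (average Q f) * osc2 b g Q)"
    unfolding eq using i F
    by (subst Bochner_Integration.integral_sum) (auto intro!: sum_mono mart_diff_pairing(2) b g)
qed

lemma partial_para_measurable:
  assumes "finite F" "F \<subseteq> cubes" shows "partial_para b f F \<in> borel_measurable lebesgue"
proof -
  have "(\<lambda>x. \<Sum>Q\<in>F. mart_diff cubes Q b x * average Q f) \<in> borel_measurable lebesgue"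
    using mart_diff_measurable assms by (intro borel_measurable_sum borel_measurable_times borel_measurable_const) blast
  then show ?thesis by (simp add: partial_para_def[abs_def])
qed

lemma partial_para_bounded:
  assumes "finite F" "F \<subseteq> cubes"
  obtains B where "0 \<le> B" "\<And>x. norm (partial_para b f F x) \<le> B"
proof
  show "0 \<le> (\<Sum>Q\<in>F. (\<Sum>R\<in>ch Q. norm (average R b - average Q b)) * norm (average Q f))"
    by (intro sum_nonneg mult_nonneg_nonneg) auto
  show "norm (partial_para b f F x) \<le> (\<Sum>Q\<in>F. (\<Sum>R\<in>ch Q. norm (average R b - average Q b)) * norm (average Q f))" for x
    unfolding partial_para_def
  proof (intro sum_norm_le)
    fix Q assume "Q \<in> F"
    then show "norm (mart_diff cubes Q b x * average Q f) \<le> (\<Sum>R\<in>ch Q. norm (average R b - average Q b)) * norm (average Q f)"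
      unfolding norm_mult using assms by (intro mult_right_mono mart_diff_bounded) auto
  qed
qed

lemma partial_para_zero:
  assumes "finite F" "F \<subseteq> cubes" "x \<notin> \<Union>F" shows "partial_para b f F x = 0"
  unfolding partial_para_def using assms
  by (intro sum.neutral) (auto intro!: mart_diff_zero)

lemma partial_para_Un:
  assumes "finite F" "finite G" "F \<inter> G = {}"
  shows "partial_para b f (F \<union> G) x = partial_para b f F x + partial_para b f G x"
  unfolding partial_para_def using assms by (rule sum.union_disjoint)

lemma partial_para_add:
  assumes "F \<subseteq> cubes" and b: "cube_integrable b" "cube_integrable b'"
  shows "partial_para (\<lambda>x. b x + b' x) f F x = partial_para b f F x + partial_para b' f F x"
proof -
  have av: "average Q (\<lambda>x. b x + b' x) = average Q b + average Q b'" if "Q \<in> cubes" for Q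
    unfolding average_def
    using cube_integrable_set_integrable[OF b(1) that] cube_integrable_set_integrable[OF b(2) that]
    by (simp add: set_integral_add scaleR_add_right)
  have "mart_diff cubes Q (\<lambda>x. b x + b' x) x = mart_diff cubes Q b x + mart_diff cubes Q b' x" if "Q \<in> cubes" for Q
    unfolding mart_diff_eq[OF that] sum.distrib[symmetric]
    using av that ch_cubes by (intro sum.cong) (auto simp: scaleR_add_right[symmetric] simp del: scaleR_add_right)
  then show ?thesis
    unfolding partial_para_def sum.distrib[symmetric] using assms(1)
    by (intro sum.cong) (auto simp: distrib_right)
qed

lemma cube_finite_Un:
  assumes "cube_finite w" "finite F" "F \<subseteq> cubes"
  shows "emeasure (wmeasure w) (\<Union>F) < top"
proof -
  have "\<Union>F \<in> fmeasurable (wmeasure w)"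
    using assms cube_finiteD(3) by (intro fmeasurable.finite_Union) auto
  then show ?thesis by (auto simp: fmeasurable_def)
qed

lemma cube_finite_compact:
  assumes "cube_finite w" "compact K"
  shows "emeasure (wmeasure w) K < top"
proof -
  define F where "F = {R \<in> D 0. R \<inter> K \<noteq> {}}"
  have F: "finite F" "F \<subseteq> cubes"
    unfolding F_def using finite_level_meets[OF compact_imp_bounded[OF assms(2)]] level_cubes by auto
  have "K \<subseteq> \<Union>F"
  proof
    fix x assume "x \<in> K"
    moreover obtain Q where "Q \<in> D 0" "x \<in> Q" using level_cover by blast
    ultimately show "x \<in> \<Union>F" by (auto simp: F_def)
  qed
  moreover have "\<Union>F \<in> sets lebesgue" using F cube_sets by (intro sets.finite_Union) auto
  ultimately have "emeasure (wmeasure w) K \<le> emeasure (wmeasure w) (\<Union>F)"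
    by (intro emeasure_mono) auto
  then show ?thesis using cube_finite_Un[OF assms(1) F] by (rule le_less_trans)
qed

lemma cube_finite_bound:
  assumes w: "cube_finite w" and v: "v \<in> borel_measurable lebesgue" "\<And>x. v x \<le> B * w x" and B: "0 \<le> B"
  shows "cube_finite v"
  unfolding cube_finite_def
proof (intro conjI ballI v)
  fix Q assume Q: "Q \<in> cubes"
  have [measurable]: "w \<in> borel_measurable lebesgue" "Q \<in> sets lebesgue"
    using cube_finiteD(1)[OF w] cube_sets[OF Q] by auto
  have "mass v Q \<le> (\<integral>\<^sup>+x. ennreal B * (ennreal (w x) * indicator Q x) \<partial>lebesgue)"
    unfolding mass_def
  proof (intro nn_integral_mono)
    fix x
    have "ennreal (v x) \<le> ennreal (B * w x)" using v(2) by (rule ennreal_leI)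
    also have "\<dots> = ennreal B * ennreal (w x)" using B by (rule ennreal_mult')
    finally show "ennreal (v x) * indicator Q x \<le> ennreal B * (ennreal (w x) * indicator Q x)"
      by (auto simp: indicator_def)
  qed
  also have "\<dots> = ennreal B * mass w Q"
    unfolding mass_def by (rule nn_integral_cmult) auto
  also have "\<dots> < top" using cube_finiteD(6)[OF w Q] by (simp add: ennreal_mult_less_top)
  finally show "emeasure (wmeasure v) Q < top" using emeasure_wmeasure[OF v(1) cube_sets[OF Q]] by simp
qed

lemma cube_finite_one: "cube_finite (\<lambda>_. 1)"
  unfolding cube_finite_def using cube_lmeasurable by (auto simp: wmeasure_one fmeasurable_def)

text \<open>The dual extremiser \<open>(norm (h x) powr (q - 2) * \<tau> x) *\<^sub>R h x\<close>
  makes both the pairing and the s-th power norm equal to the integral I sought, so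
  \<open>I \<le> M * I powr (1 / s)\<close>. Dividing requires \<open>I\<close> to be finite, whence
  the assumptions that h is bounded and vanishes off finitely many cubes.\<close>

lemma duality_Lq:
  fixes h :: "real ^ 'n \<Rightarrow> 'k :: euclidean_space"
  assumes e: "1 < q" "1 / q + 1 / s = 1"
    and h: "h \<in> borel_measurable lebesgue" "\<And>x. norm (h x) \<le> B" "\<And>x. x \<notin> \<Union>F \<Longrightarrow> h x = 0"
    and F: "finite F" "F \<subseteq> cubes"
    and \<tau>: "cube_finite \<tau>" "\<And>x. 0 < \<tau> x" and \<omega>: "\<omega> \<in> borel_measurable lebesgue" "\<And>x. 0 < \<omega> x"
    and \<omega>\<tau>: "\<And>x. \<omega> x * \<tau> x powr (s - 1) = 1" and M: "0 \<le> M"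
    and pair: "\<And>(g :: real ^ 'n \<Rightarrow> 'k) Bg. cube_integrable g \<Longrightarrow> 0 \<le> Bg \<Longrightarrow>
      (\<integral>\<^sup>+x. ennreal (norm (g x) powr s * \<omega> x) \<partial>lebesgue) \<le> ennreal Bg \<Longrightarrow>
      (LINT x|lebesgue. inner (h x) (g x)) \<le> M * Bg powr (1 / s)"
  shows "(\<integral>\<^sup>+x. ennreal (norm (h x) powr q * \<tau> x) \<partial>lebesgue) \<le> ennreal (M powr q)"
proof -
  note [measurable] = h(1) cube_finiteD(1)[OF \<tau>(1)] \<omega>(1)
  have s: "s > 0"
  proof -
    have "1 / q < 1" using e(1) by simp
    then have "1 / s > 0" using e(2) by linarith
    then show ?thesis by simp
  qed
  have qs: "(q - 1) * s = q" using e s by (simp add: field_simps)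
  define g where "g x = (norm (h x) powr (q - 2) * \<tau> x) *\<^sub>R h x" for x
  have gm [measurable]: "g \<in> borel_measurable lebesgue" unfolding g_def by measurable
  have ng: "norm (g x) = norm (h x) powr (q - 1) * \<tau> x" for x
  proof (cases "h x = 0")
    case False
    then have "norm (h x) powr (q - 2) * norm (h x) = norm (h x) powr (q - 1)"
      using powr_add[of "norm (h x)" "q - 2" 1] by simp
    then show ?thesis using \<tau>(2)[of x] by (simp add: g_def abs_mult mult_ac)
  qed (simp add: g_def)
  have "cube_finite (\<lambda>x. norm (g x))"
  proof (rule cube_finite_bound[OF \<tau>(1)])
    show "norm (g x) \<le> B powr (q - 1) * \<tau> x" for x
      unfolding ng using e \<tau>(2)[of x] h(2)[of x] by (intro mult_right_mono powr_mono2) auto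
  qed auto
  then have gc: "cube_integrable g" unfolding cube_integrable_def by auto
  define I where "I = (\<integral>\<^sup>+x. ennreal (norm (h x) powr q * \<tau> x) \<partial>lebesgue)"
  have gs: "norm (g x) powr s * \<omega> x = norm (h x) powr q * \<tau> x" for x
  proof -
    have "norm (g x) powr s * \<omega> x = norm (h x) powr ((q - 1) * s) * (\<tau> x powr s * \<omega> x)"
      by (simp add: ng powr_mult powr_powr)
    also have "\<tau> x powr s = \<tau> x * \<tau> x powr (s - 1)"
      using \<tau>(2)[of x] powr_add[of "\<tau> x" 1 "s - 1"] by simp
    also have "\<tau> x * \<tau> x powr (s - 1) * \<omega> x = \<tau> x" using \<omega>\<tau>[of x] by (simp add: mult_ac)
    finally show ?thesis by (simp add: qs)
  qed
  have inn: "inner (h x) (g x) = norm (h x) powr q * \<tau> x" for x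
  proof (cases "h x = 0")
    case False
    then have "norm (h x) powr (q - 2) * (norm (h x))\<^sup>2 = norm (h x) powr q"
      using powr_add[of "norm (h x)" "q - 2" 2] by simp
    then show ?thesis by (simp add: g_def power2_norm_eq_inner[symmetric] mult_ac)
  qed (simp add: e)
  have UF: "\<Union>F \<in> sets lebesgue" using F cube_sets by (intro sets.finite_Union) auto
  \<comment> \<open>A priori finiteness, by the crude bound B on finitely many cubes of finite
    \<tau>-mass.\<close>
  have "I \<le> (\<integral>\<^sup>+x. ennreal (B powr q) * (ennreal (\<tau> x) * indicator (\<Union>F) x) \<partial>lebesgue)"
    unfolding I_def
  proof (intro nn_integral_mono)
    fix x
    show "ennreal (norm (h x) powr q * \<tau> x) \<le> ennreal (B powr q) * (ennreal (\<tau> x) * indicator (\<Union>F) x)"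
    proof (cases "x \<in> \<Union>F")
      case True
      have "norm (h x) powr q * \<tau> x \<le> B powr q * \<tau> x"
        using e \<tau>(2)[of x] h(2)[of x] by (intro mult_right_mono powr_mono2) auto
      then show ?thesis using True by (simp add: ennreal_mult'[symmetric] ennreal_leI del: UN_iff Union_iff)
    next
      case False
      then show ?thesis using h(3)[OF False] e by simp
    qed
  qed
  also have "\<dots> = ennreal (B powr q) * mass \<tau> (\<Union>F)"
    unfolding mass_def using UF by (intro nn_integral_cmult) auto
  also have "\<dots> < top"
    using cube_finite_Un[OF \<tau>(1) F] emeasure_wmeasure[OF cube_finiteD(1)[OF \<tau>(1)] UF] by (simp add: ennreal_mult_less_top)
  finally obtain i where i: "0 \<le> i" "I = ennreal i" by (cases I) auto
  have "(LINT x|lebesgue. inner (h x) (g x)) = enn2real I"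
    unfolding inn I_def using \<tau>(2) by (intro integral_eq_nn_integral) (auto intro!: AE_I2 mult_nonneg_nonneg less_imp_le[OF \<tau>(2)])
  then have "i \<le> M * i powr (1 / s)"
    using pair[OF gc, of i] i gs I_def by simp
  then have "i \<le> M powr q"
  proof (cases "i = 0")
    case False
    then have i0: "i > 0" using i by simp
    have "i = i powr (1 / q) * i powr (1 / s)" using i0 e by (simp flip: powr_add)
    then have "i powr (1 / q) * i powr (1 / s) \<le> M * i powr (1 / s)" using \<open>i \<le> M * i powr (1 / s)\<close> by simp
    then have "i powr (1 / q) \<le> M" using i0 by simp
    then have "(i powr (1 / q)) powr q \<le> M powr q" using e by (intro powr_mono2) auto
    then show ?thesis using i0 e by (simp add: powr_powr)
  qed simp
  then show ?thesis using i I_def by (simp add: ennreal_leI)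
qed

text \<open>Turns an L^1 norm on a compact set into a pairing with a function dominated by the
  indicator of the set, to which the pairing estimates apply.\<close>

lemma L1_by_pairing:
  fixes h :: "real ^ 'n \<Rightarrow> 'k :: euclidean_space"
  assumes h: "h \<in> borel_measurable lebesgue" "\<And>x. norm (h x) \<le> B" and K: "compact K"
  defines "g \<equiv> \<lambda>x. indicat_real K x *\<^sub>R sgn (h x)"
  shows "cube_integrable g" "norm (g x) \<le> indicat_real K x"
    "(\<integral>\<^sup>+x\<in>K. ennreal (norm (h x)) \<partial>lebesgue) = ennreal (LINT x|lebesgue. inner (h x) (g x))"
proof -
  have Km [measurable]: "K \<in> sets lebesgue" using K by (simp add: borel_compact sets_completionI_sets)
  note [measurable] = h(1)
  have gm [measurable]: "g \<in> borel_measurable lebesgue" unfolding g_def sgn_div_norm by measurable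
  show ng: "norm (g x) \<le> indicat_real K x" for x
    by (auto simp: g_def norm_sgn indicator_def)
  have "cube_finite (\<lambda>x. norm (g x))"
    by (rule cube_finite_bound[OF cube_finite_one, of _ 1]) (auto intro!: order_trans[OF ng] simp: indicator_def)
  then show "cube_integrable g" by (simp add: cube_integrable_def)
  have inn: "inner (h x) (g x) = indicat_real K x * norm (h x)" for x
    by (cases "h x = 0") (simp_all add: g_def sgn_div_norm power2_norm_eq_inner[symmetric] power2_eq_square)
  have B: "0 \<le> B" using h(2)[of 0] norm_ge_zero order_trans by blast
  have int: "(\<integral>\<^sup>+x\<in>K. ennreal (norm (h x)) \<partial>lebesgue) = (\<integral>\<^sup>+x. ennreal (indicat_real K x * norm (h x)) \<partial>lebesgue)"
    by (intro nn_integral_cong) (auto simp: indicator_def)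
  have "(\<integral>\<^sup>+x. ennreal (indicat_real K x * norm (h x)) \<partial>lebesgue) \<le> (\<integral>\<^sup>+x. ennreal B * indicator K x \<partial>lebesgue)"
    by (intro nn_integral_mono) (auto simp: indicator_def h(2) intro!: ennreal_leI)
  also have "\<dots> = ennreal B * emeasure lebesgue K" by (rule nn_integral_cmult_indicator) auto
  also have "\<dots> < top" using lmeasurable_compact[OF K] by (auto simp: ennreal_mult_less_top fmeasurable_def)
  finally have "(\<integral>\<^sup>+x. ennreal (indicat_real K x * norm (h x)) \<partial>lebesgue) < top" .
  then have "ennreal (LINT x|lebesgue. indicat_real K x * norm (h x)) = (\<integral>\<^sup>+x. ennreal (indicat_real K x * norm (h x)) \<partial>lebesgue)"
    by (subst integral_eq_nn_integral) (auto simp: less_top)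
  then show "(\<integral>\<^sup>+x\<in>K. ennreal (norm (h x)) \<partial>lebesgue) = ennreal (LINT x|lebesgue. inner (h x) (g x))"
    unfolding inn int by simp
qed

text \<open>Bessel's inequality for martingale differences: the telescoping bound without stopping
  (\<open>T = UNIV\<close>), with the L^2 mass of b as majorant.\<close>

lemma osc_finite_sum_le:
  fixes b :: "real ^ 'n \<Rightarrow> 'k :: euclidean_space"
  assumes b: "cube_integrable b" and E: "(\<integral>\<^sup>+x. ennreal ((norm (b x))\<^sup>2) \<partial>lebesgue) \<le> ennreal E" "0 \<le> E"
    and F: "finite F" "F \<subseteq> cubes"
  shows "(\<Sum>Q\<in>F. osc b Q) \<le> E"
proof -
  define w where "w x = (norm (b x))\<^sup>2" for x
  have [measurable]: "b \<in> borel_measurable lebesgue" using b by (simp add: cube_integrable_def)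
  have wm [measurable]: "w \<in> borel_measurable lebesgue" unfolding w_def by measurable
  have wU: "emeasure (wmeasure w) UNIV \<le> ennreal E" using E(1) by (subst emeasure_wmeasure) (auto simp: mass_def w_def)
  then have wt: "emeasure (wmeasure w) UNIV < top" by (auto intro: le_less_trans)
  have wc: "cube_finite w"
    unfolding cube_finite_def
  proof (intro conjI ballI wm)
    fix Q assume "Q \<in> cubes"
    have "emeasure (wmeasure w) Q \<le> emeasure (wmeasure w) UNIV" by (intro emeasure_mono) auto
    then show "emeasure (wmeasure w) Q < top" using wt by (rule le_less_trans)
  qed
  have bnd: "vol Q * (norm (average Q b))\<^sup>2 \<le> wmass w Q" if Q: "Q \<in> cubes" for Q
  proof -
    have bc: "cube_finite (\<lambda>x. norm (b x))" using b by (simp add: cube_integrable_def)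
    have "wmass (\<lambda>x. norm (b x)) Q \<le> wmass w Q powr (1/2) * wmass (\<lambda>_. 1) Q powr (1/2)"
    proof (rule wmeasure_holder(3))
      show "norm (b x) \<le> w x powr (1/2) * 1 powr (1/2)" for x
        by (simp add: w_def powr_half_sqrt)
    qed (use cube_finiteD(2)[OF wc Q] cube_finiteD(2)[OF cube_finite_one Q] cube_sets[OF Q] in \<open>auto simp: w_def\<close>)
    also have "\<dots> = sqrt (wmass w Q) * sqrt (vol Q)" by (simp add: wmeasure_one powr_half_sqrt)
    finally have 1: "wmass (\<lambda>x. norm (b x)) Q \<le> sqrt (wmass w Q) * sqrt (vol Q)" .
    have "norm (average Q b) \<le> sqrt (wmass w Q) * sqrt (vol Q) / vol Q"
      using norm_average_le[OF b Q] 1 vol_pos[OF Q] by (meson divide_right_mono order_trans less_imp_le)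
    then have "(norm (average Q b))\<^sup>2 \<le> (sqrt (wmass w Q) * sqrt (vol Q) / vol Q)\<^sup>2"
      by (intro power_mono) auto
    also have "\<dots> = wmass w Q / vol Q"
      using vol_pos[OF Q] by (simp add: power_mult_distrib power_divide) (simp add: power2_eq_square)
    finally show ?thesis using vol_pos[OF Q] by (simp add: field_simps)
  qed
  obtain C K where C: "finite C" "C \<subseteq> cubes" "disjoint C" "F \<subseteq> (\<Union>R\<in>C. sub K R)"
    using finite_tops[OF F] by metis
  have fs: "finite (sub K R)" if "R \<in> C" for R using finite_sub[of R K] C that by auto
  have "(\<Sum>Q\<in>F. osc b Q) \<le> (\<Sum>Q\<in>(\<Union>R\<in>C. sub K R). osc b Q)"
    using C fs by (intro sum_mono2) (auto simp: osc_nonneg)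
  also have "\<dots> \<le> (\<Sum>R\<in>C. \<Sum>Q\<in>sub K R. osc b Q)"
    using C fs by (intro sum_UN_le) (auto simp: osc_nonneg)
  also have "\<dots> \<le> (\<Sum>R\<in>C. wmass w R)"
  proof (rule sum_mono)
    fix R assume "R \<in> C"
    then have R: "R \<in> cubes" using C by auto
    have "(\<Sum>Q\<in>sub K R \<inter> UNIV. osc b Q) \<le> wmass w R"
      by (rule osc_sum_le) (use R bnd cube_integrable_set_integrable[OF b R] cube_finiteD(4)[OF wc] ch_cubes
         in \<open>auto simp: up_closed_def\<close>)
    then show "(\<Sum>Q\<in>sub K R. osc b Q) \<le> wmass w R" by simp
  qed
  also have "\<dots> \<le> wmass w UNIV"
    using C cube_sets wt by (intro sum_measure_le) (auto intro!: fmeasurableI)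
  also have "\<dots> \<le> E" using wU emeasure_wmeasure_eq_measure[OF wt] E(2) by simp
  finally show ?thesis .
qed

end

section \<open>Small tails, almost everywhere limits, and the Cauchy criterion\<close>

lemma mono_tail:
  fixes e :: "'a \<Rightarrow> real"
  assumes "\<And>x. 0 \<le> e x" and E: "\<And>F. finite F \<Longrightarrow> F \<subseteq> X \<Longrightarrow> sum e F \<le> E" and \<epsilon>: "0 < \<epsilon>"
  obtains F0 where "finite F0" "F0 \<subseteq> X" "\<And>F. finite F \<Longrightarrow> F \<subseteq> X \<Longrightarrow> F \<inter> F0 = {} \<Longrightarrow> sum e F \<le> \<epsilon>"
proof -
  define S where "S = sum e ` {F. finite F \<and> F \<subseteq> X}"
  have S: "S \<noteq> {}" "bdd_above S" using E by (auto simp: S_def intro!: bdd_aboveI)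
  have "Sup S - \<epsilon> < Sup S" using \<epsilon> by simp
  then obtain y where y: "y \<in> S" "Sup S - \<epsilon> < y" using less_cSup_iff[OF S] by blast
  then obtain F0 where F0: "finite F0" "F0 \<subseteq> X" "y = sum e F0" unfolding S_def by auto
  show thesis
  proof (rule that[OF F0(1,2)])
    fix F assume F: "finite F" "F \<subseteq> X" "F \<inter> F0 = {}"
    then have "sum e F + sum e F0 = sum e (F \<union> F0)" using F0 by (simp add: sum.union_disjoint)
    also have "\<dots> \<le> Sup S" using F F0 S by (intro cSup_upper) (auto simp: S_def)
    finally show "sum e F \<le> \<epsilon>" using y F0 by linarith
  qed
qed

text \<open>On a fixed ball of radius j the terms of index at least j are controlled by a geometric
  series, so the total is finite almost everywhere there; countably many balls exhaust the
  space.\<close>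

lemma fast_L1_summable:
  fixes v :: "nat \<Rightarrow> real ^ 'n \<Rightarrow> real"
  assumes v [measurable]: "\<And>m. v m \<in> borel_measurable lebesgue" and v0: "\<And>m x. 0 \<le> v m x"
    and le: "\<And>m. (\<integral>\<^sup>+x\<in>cball 0 (real m). ennreal (v m x) \<partial>lebesgue) \<le> ennreal ((1/2) ^ m)"
  shows "AE x in lebesgue. summable (\<lambda>m. v m x)"
proof -
  have "AE x in lebesgue. x \<in> cball 0 (real j) \<longrightarrow> summable (\<lambda>m. v m x)" for j
  proof -
    have cb [measurable]: "cball 0 (real j) \<in> sets (lebesgue :: (real ^ 'n) measure)" by simp
    define w where "w m x = ennreal (v (m + j) x) * indicator (cball 0 (real j)) x" for m x
    have wm [measurable]: "w m \<in> borel_measurable lebesgue" for m unfolding w_def by measurable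
    have "(\<integral>\<^sup>+x. (\<Sum>m. w m x) \<partial>lebesgue) = (\<Sum>m. \<integral>\<^sup>+x. w m x \<partial>lebesgue)"
      by (rule nn_integral_suminf) simp
    also have "\<dots> \<le> (\<Sum>m. ennreal ((1/2) ^ (m + j)))"
    proof (intro suminf_le)
      fix m
      have "(\<integral>\<^sup>+x. w m x \<partial>lebesgue) \<le> (\<integral>\<^sup>+x\<in>cball 0 (real (m + j)). ennreal (v (m + j) x) \<partial>lebesgue)"
        unfolding w_def by (intro nn_integral_mono mult_left_mono) (auto simp: indicator_def)
      also have "\<dots> \<le> ennreal ((1/2) ^ (m + j))" by (rule le)
      finally show "(\<integral>\<^sup>+x. w m x \<partial>lebesgue) \<le> ennreal ((1/2) ^ (m + j))" .
    qed auto
    also have "\<dots> < top"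
    proof -
      have "summable (\<lambda>m. (1/2) ^ (m + j) :: real)" by (rule summable_ignore_initial_segment) simp
      then show ?thesis by (subst suminf_ennreal2) auto
    qed
    finally have "(\<integral>\<^sup>+x. (\<Sum>m. w m x) \<partial>lebesgue) \<noteq> \<infinity>" by (simp add: less_top)
    then have "AE x in lebesgue. (\<Sum>m. w m x) \<noteq> \<infinity>"
      by (intro nn_integral_PInf_AE) auto
    then show ?thesis
    proof eventually_elim
      case (elim x)
      show ?case
      proof
        assume "x \<in> cball 0 (real j)"
        then have "(\<Sum>m. ennreal (v (m + j) x)) \<noteq> top" using elim by (simp add: w_def)
        then have "summable (\<lambda>m. v (m + j) x)" using v0 by (intro summable_suminf_not_top) auto
        then show "summable (\<lambda>m. v m x)" using summable_iff_shift[of "\<lambda>m. v m x" j] by simp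
      qed
    qed
  qed
  then have "AE x in lebesgue. \<forall>j. x \<in> cball 0 (real j) \<longrightarrow> summable (\<lambda>m. v m x)"
    unfolding AE_all_countable by blast
  then show ?thesis
  proof eventually_elim
    case (elim x)
    obtain j :: nat where "norm x \<le> real j" using real_arch_simple by blast
    then show ?case using elim by (auto simp: dist_norm)
  qed
qed

lemma compact_in_cball:
  fixes K :: "'a :: real_normed_vector set"
  assumes "compact K"
  shows "\<exists>j. \<forall>m\<ge>j. K \<subseteq> cball 0 (real m)"
proof -
  obtain B where B: "\<And>x. x \<in> K \<Longrightarrow> norm x \<le> B" using compact_imp_bounded[OF assms] unfolding bounded_iff by blast
  obtain j :: nat where j: "B \<le> real j" using real_arch_simple by blast
  have "K \<subseteq> cball 0 (real m)" if "j \<le> m" for m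
  proof -
    have "B \<le> real m" using j that by simp
    then show ?thesis using B by force
  qed
  then show ?thesis by (intro exI[of _ j]) simp
qed

context dyadic begin

lemma Linfc_cube_integrable:
  assumes "f \<in> Linfc" shows "cube_integrable f"
proof -
  obtain B where B: "\<And>x. norm (f x) \<le> B" using assms unfolding Linfc_def bounded_iff by auto
  have [measurable]: "f \<in> borel_measurable lebesgue" using assms by (simp add: Linfc_def)
  have "0 \<le> B" using B[of 0] norm_ge_zero order_trans by blast
  then have "cube_finite (\<lambda>x. norm (f x))" using B by (intro cube_finite_bound[OF cube_finite_one, of _ B]) auto
  then show ?thesis by (simp add: cube_integrable_def)
qed

lemma Linfc_norm_finite:
  assumes f: "f \<in> Linfc" and w: "cube_finite w" "\<And>x. 0 < w x" and p: "0 < p"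
  shows "(\<integral>\<^sup>+x. ennreal (norm (f x) powr p * w x) \<partial>lebesgue) < top"
proof -
  obtain B where B: "\<And>x. norm (f x) \<le> B" using f unfolding Linfc_def bounded_iff by auto
  obtain K where K: "compact K" "\<And>x. x \<notin> K \<Longrightarrow> f x = 0" using f unfolding Linfc_def by auto
  have Km [measurable]: "K \<in> sets lebesgue" using K by (simp add: borel_compact sets_completionI_sets)
  note [measurable] = cube_finiteD(1)[OF w(1)]
  have "(\<integral>\<^sup>+x. ennreal (norm (f x) powr p * w x) \<partial>lebesgue)
     \<le> (\<integral>\<^sup>+x. ennreal (B powr p) * (ennreal (w x) * indicator K x) \<partial>lebesgue)"
  proof (intro nn_integral_mono)
    fix x
    show "ennreal (norm (f x) powr p * w x) \<le> ennreal (B powr p) * (ennreal (w x) * indicator K x)"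
    proof (cases "x \<in> K")
      case True
      have "norm (f x) powr p * w x \<le> B powr p * w x"
        using p w(2)[of x] B[of x] by (intro mult_right_mono powr_mono2) auto
      then show ?thesis using True by (simp add: ennreal_mult'[symmetric] ennreal_leI)
    qed (simp add: K)
  qed
  also have "\<dots> = ennreal (B powr p) * mass w K" unfolding mass_def by (rule nn_integral_cmult) auto
  also have "\<dots> < top" 
    using cube_finite_compact[OF w(1) K(1)] emeasure_wmeasure[OF cube_finiteD(1)[OF w(1)] Km] by (simp add: ennreal_mult_less_top)
  finally show ?thesis .
qed

text \<open>The Cauchy criterion for unconditional convergence in each L^1(K): finite sums that
  avoid a suitable \<open>F0\<close> are small.\<close>

definition para_cauchy :: "(real ^ 'n \<Rightarrow> 'k :: {real_normed_field, euclidean_space}) \<Rightarrow> (real ^ 'n \<Rightarrow> 'k) \<Rightarrow> bool" where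
  "para_cauchy b f \<longleftrightarrow> (\<forall>K \<epsilon>. compact K \<longrightarrow> 0 < \<epsilon> \<longrightarrow> (\<exists>F0. finite F0 \<and> F0 \<subseteq> cubes \<and>
     (\<forall>F. finite F \<longrightarrow> F \<subseteq> cubes \<longrightarrow> F \<inter> F0 = {} \<longrightarrow>
       (\<integral>\<^sup>+x\<in>K. ennreal (norm (partial_para b f F x)) \<partial>lebesgue) \<le> ennreal \<epsilon>)))"

text \<open>The averages of f are bounded, so they come out of the form. Cauchy-Schwarz then leaves
  a tail of the convergent square sum of b and a square sum of the test function, the latter at most
  \<open>vol K\<close>.\<close>

lemma para_cauchy_L2:
  fixes b f :: "real ^ 'n \<Rightarrow> 'k :: {real_normed_field, euclidean_space}"
  assumes b: "cube_integrable b" and E: "(\<integral>\<^sup>+x. ennreal ((norm (b x))\<^sup>2) \<partial>lebesgue) \<le> ennreal E" "0 \<le> E"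
    and f: "f \<in> Linfc"
  shows "para_cauchy b f"
  unfolding para_cauchy_def
proof (intro allI impI)
  fix K :: "(real ^ 'n) set" and \<epsilon> :: real assume K: "compact K" and \<epsilon>: "0 < \<epsilon>"
  obtain B where B0: "\<And>x. norm (f x) \<le> B" using f unfolding Linfc_def bounded_iff by auto
  have B: "0 \<le> B" using B0[of 0] norm_ge_zero order_trans by blast
  have Km [measurable]: "K \<in> sets lebesgue" using K by (simp add: borel_compact sets_completionI_sets)
  have avf: "norm (average Q f) \<le> B" if Q: "Q \<in> cubes" for Q
  proof -
    have bc: "cube_finite (\<lambda>x. norm (f x))" using Linfc_cube_integrable[OF f] by (simp add: cube_integrable_def)
    have "ennreal (wmass (\<lambda>x. norm (f x)) Q) = mass (\<lambda>x. norm (f x)) Q"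
      using cube_finiteD(6)[OF bc Q] by simp
    also have "\<dots> \<le> (\<integral>\<^sup>+x. ennreal B * indicator Q x \<partial>lebesgue)"
      unfolding mass_def using B0 by (intro nn_integral_mono mult_right_mono ennreal_leI) auto
    also have "\<dots> = ennreal B * emeasure lebesgue Q" using cube_sets[OF Q] by (rule nn_integral_cmult_indicator)
    also have "\<dots> = ennreal (B * vol Q)"
      using cube_lmeasurable[OF Q] B by (simp add: emeasure_eq_measure2 ennreal_mult)
    finally have "wmass (\<lambda>x. norm (f x)) Q \<le> B * vol Q" using B by (simp add: ennreal_le_iff)
    then have "wmass (\<lambda>x. norm (f x)) Q / vol Q \<le> B" using vol_pos[OF Q] by (simp add: pos_divide_le_eq)
    then show ?thesis using norm_average_le[OF Linfc_cube_integrable[OF f] Q] by linarith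
  qed
  define c where "c = B * sqrt (vol K)"
  have c: "c \<ge> 0" using B by (simp add: c_def)
  \<comment> \<open>Chosen so that \<open>c * sqrt \<delta> \<le> \<epsilon>\<close>; adding 1
    covers the case \<open>c = 0\<close>.\<close>
  define \<delta> where "\<delta> = (\<epsilon> / (c + 1))\<^sup>2"
  have \<delta>: "\<delta> > 0" using \<epsilon> c by (simp add: \<delta>_def)
  obtain F0 where F0: "finite F0" "F0 \<subseteq> cubes"
    "\<And>F. finite F \<Longrightarrow> F \<subseteq> cubes \<Longrightarrow> F \<inter> F0 = {} \<Longrightarrow> sum (osc b) F \<le> \<delta>"
    using mono_tail[of "osc b" cubes E \<delta>] osc_nonneg osc_finite_sum_le[OF b E] \<delta> by metis
  show "\<exists>F0. finite F0 \<and> F0 \<subseteq> cubes \<and>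
     (\<forall>F. finite F \<longrightarrow> F \<subseteq> cubes \<longrightarrow> F \<inter> F0 = {} \<longrightarrow>
       (\<integral>\<^sup>+x\<in>K. ennreal (norm (partial_para b f F x)) \<partial>lebesgue) \<le> ennreal \<epsilon>)"
  proof (intro exI[of _ F0] conjI F0(1,2) allI impI)
    fix F assume F: "finite F" "F \<subseteq> cubes" "F \<inter> F0 = {}"
    obtain C where C: "\<And>x. norm (partial_para b f F x) \<le> C" using partial_para_bounded[OF F(1,2)] by metis
    define g where "g x = indicat_real K x *\<^sub>R sgn (partial_para b f F x)" for x
    note L = L1_by_pairing[OF partial_para_measurable[OF F(1,2)] C K, folded g_def[abs_def]]
    have gE: "(\<integral>\<^sup>+x. ennreal ((norm (g x))\<^sup>2) \<partial>lebesgue) \<le> ennreal (vol K)"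
    proof -
      have "(\<integral>\<^sup>+x. ennreal ((norm (g x))\<^sup>2) \<partial>lebesgue) \<le> (\<integral>\<^sup>+x. indicator K x \<partial>lebesgue)"
      proof (intro nn_integral_mono)
        fix x
        have "(norm (g x))\<^sup>2 \<le> (indicat_real K x)\<^sup>2" using L(2)[of x] by (intro power_mono) (auto simp: g_def)
        then show "ennreal ((norm (g x))\<^sup>2) \<le> indicator K x" 
          by (cases "x \<in> K") (auto simp: ennreal_leI power_le_one_iff)
      qed
      also have "\<dots> = emeasure lebesgue K" by simp
      also have "\<dots> = ennreal (vol K)" using lmeasurable_compact[OF K] by (simp add: emeasure_eq_measure2)
      finally show ?thesis .
    qed
    have "(LINT x|lebesgue. inner (partial_para b f F x) (g x)) \<le> (\<Sum>Q\<in>F. norm (average Q f) * osc2 b g Q)"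
      using L(1) by (intro partial_para_pairing(2)[OF F(1,2) b]) (simp add: g_def[abs_def])
    also have "\<dots> \<le> (\<Sum>Q\<in>F. B * osc2 b g Q)"
      using F avf by (intro sum_mono mult_right_mono osc2_nonneg) auto
    also have "\<dots> = B * (\<Sum>Q\<in>F. osc2 b g Q)" by (simp add: sum_distrib_left)
    also have "\<dots> \<le> B * (sqrt (\<Sum>Q\<in>F. osc b Q) * sqrt (\<Sum>Q\<in>F. osc g Q))"
      using B F by (intro mult_left_mono osc2_sum_le) auto
    also have "\<dots> \<le> B * (sqrt \<delta> * sqrt (vol K))"
      using B \<delta> F F0(3) osc_finite_sum_le[OF _ gE _ F(1,2)] L(1)
      by (intro mult_left_mono mult_mono) (auto simp: g_def[abs_def] intro!: sum_nonneg osc_nonneg)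
    also have "\<dots> = c * (\<epsilon> / (c + 1))" using \<epsilon> c by (simp add: \<delta>_def c_def)
    also have "\<dots> \<le> \<epsilon>" using \<epsilon> c by (simp add: field_simps)
    finally show "(\<integral>\<^sup>+x\<in>K. ennreal (norm (partial_para b f F x)) \<partial>lebesgue) \<le> ennreal \<epsilon>"
      using L(3) by (simp add: ennreal_leI g_def)
  qed
qed

section \<open>Convergence of the paraproduct\<close>

text \<open>Convergence along the net of finite subsets allows picking partial sums with error
  \<open>(1/2) ^ m\<close> on the ball of radius m; such fast convergence is pointwise almost
  everywhere.\<close>

lemma has_paraproduct_AE_limit:
  fixes b f g :: "real ^ 'n \<Rightarrow> 'k :: {real_normed_field, euclidean_space}"
  assumes g: "has_paraproduct cubes b f g"
  shows "\<exists>G :: nat \<Rightarrow> _. (\<forall>m. finite (G m) \<and> G m \<subseteq> cubes) \<and>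
    (AE x in lebesgue. (\<lambda>m. partial_para b f (G m) x) \<longlonglongrightarrow> g x)"
proof -
  have "\<exists>F. finite F \<and> F \<subseteq> cubes \<and>
     (\<integral>\<^sup>+x\<in>cball 0 (real m). ennreal (norm (partial_para b f F x - g x)) \<partial>lebesgue) \<le> ennreal ((1/2) ^ m)" for m
  proof -
    have "((\<lambda>F. \<integral>\<^sup>+x\<in>cball 0 (real m). ennreal (norm (partial_para b f F x - g x)) \<partial>lebesgue) \<longlongrightarrow> 0)
      (finite_subsets_at_top cubes)"
      using g unfolding has_paraproduct_def partial_para_def by simp
    then have "\<forall>\<^sub>F F in finite_subsets_at_top cubes.
      (\<integral>\<^sup>+x\<in>cball 0 (real m). ennreal (norm (partial_para b f F x - g x)) \<partial>lebesgue) < ennreal ((1/2) ^ m)"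
      by (rule order_tendstoD) simp
    then obtain X where X: "finite X \<and> X \<subseteq> cubes \<and> (\<forall>Y. finite Y \<and> X \<subseteq> Y \<and> Y \<subseteq> cubes \<longrightarrow>
      (\<integral>\<^sup>+x\<in>cball 0 (real m). ennreal (norm (partial_para b f Y x - g x)) \<partial>lebesgue) < ennreal ((1/2) ^ m))"
      unfolding eventually_finite_subsets_at_top by (rule exE)
    then have "(\<integral>\<^sup>+x\<in>cball 0 (real m). ennreal (norm (partial_para b f X x - g x)) \<partial>lebesgue) < ennreal ((1/2) ^ m)"
      by (elim conjE allE[of _ X]) simp
    with X show ?thesis by (intro exI[of _ X]) (simp add: less_imp_le)
  qed
  then have "\<forall>m. \<exists>F. finite F \<and> F \<subseteq> cubes \<and>
     (\<integral>\<^sup>+x\<in>cball 0 (real m). ennreal (norm (partial_para b f F x - g x)) \<partial>lebesgue) \<le> ennreal ((1/2) ^ m)"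
    by (rule allI)
  then obtain G where "\<forall>m. finite (G m) \<and> G m \<subseteq> cubes \<and>
     (\<integral>\<^sup>+x\<in>cball 0 (real m). ennreal (norm (partial_para b f (G m) x - g x)) \<partial>lebesgue) \<le> ennreal ((1/2) ^ m)"
    by (rule exE[OF choice])
  then have G: "finite (G m)" "G m \<subseteq> cubes"
     "(\<integral>\<^sup>+x\<in>cball 0 (real m). ennreal (norm (partial_para b f (G m) x - g x)) \<partial>lebesgue) \<le> ennreal ((1/2) ^ m)" for m
    by simp_all
  have [measurable]: "g \<in> borel_measurable lebesgue" using g by (simp add: has_paraproduct_def L1loc_def)
  have [measurable]: "partial_para b f (G m) \<in> borel_measurable lebesgue" for m
    using partial_para_measurable G by blast
  have "AE x in lebesgue. summable (\<lambda>m. norm (partial_para b f (G m) x - g x))"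
    by (rule fast_L1_summable) (use G(3) in auto)
  then have "AE x in lebesgue. (\<lambda>m. partial_para b f (G m) x) \<longlonglongrightarrow> g x"
    by eventually_elim (auto dest!: summable_LIMSEQ_zero simp: tendsto_norm_zero_iff LIM_zero_iff)
  with G(1,2) show ?thesis by (intro exI[of _ G]) simp
qed

text \<open>Fatou along the almost everywhere convergent sequence turns the uniform bound on partial
  sums into a bound for the limit.\<close>

lemma has_paraproduct_norm_le:
  fixes b f g :: "real ^ 'n \<Rightarrow> 'k :: {real_normed_field, euclidean_space}"
  assumes g: "has_paraproduct cubes b f g" and \<tau>: "\<tau> \<in> borel_measurable lebesgue" "\<And>x. 0 < \<tau> x" and q: "0 < q"
    and le: "\<And>F. finite F \<Longrightarrow> F \<subseteq> cubes \<Longrightarrow>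
      (\<integral>\<^sup>+x. ennreal (norm (partial_para b f F x) powr q * \<tau> x) \<partial>lebesgue) \<le> C"
  shows "(\<integral>\<^sup>+x. ennreal (norm (g x) powr q * \<tau> x) \<partial>lebesgue) \<le> C"
proof -
  obtain G :: "nat \<Rightarrow> _" where "(\<forall>m. finite (G m) \<and> G m \<subseteq> cubes) \<and>
    (AE x in lebesgue. (\<lambda>m. partial_para b f (G m) x) \<longlonglongrightarrow> g x)"
    by (rule exE[OF has_paraproduct_AE_limit[OF g]])
  then have G: "finite (G m)" "G m \<subseteq> cubes"
    "AE x in lebesgue. (\<lambda>m. partial_para b f (G m) x) \<longlonglongrightarrow> g x" for m by simp_all
  have [measurable]: "partial_para b f (G m) \<in> borel_measurable lebesgue" for m
    using partial_para_measurable G by blast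
  note [measurable] = \<tau>(1)
  have "AE x in lebesgue. ennreal (norm (g x) powr q * \<tau> x) =
     liminf (\<lambda>m. ennreal (norm (partial_para b f (G m) x) powr q * \<tau> x))"
    using G(3)
  proof eventually_elim
    case (elim x)
    have "(\<lambda>m. ennreal (norm (partial_para b f (G m) x) powr q * \<tau> x)) \<longlonglongrightarrow> ennreal (norm (g x) powr q * \<tau> x)"
      using q by (intro tendsto_ennrealI tendsto_mult tendsto_powr2 tendsto_norm elim tendsto_const) auto
    then show ?case by (simp add: lim_imp_Liminf)
  qed
  then have "(\<integral>\<^sup>+x. ennreal (norm (g x) powr q * \<tau> x) \<partial>lebesgue) =
     (\<integral>\<^sup>+x. liminf (\<lambda>m. ennreal (norm (partial_para b f (G m) x) powr q * \<tau> x)) \<partial>lebesgue)"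
    by (rule nn_integral_cong_AE)
  also have "\<dots> \<le> liminf (\<lambda>m. \<integral>\<^sup>+x. ennreal (norm (partial_para b f (G m) x) powr q * \<tau> x) \<partial>lebesgue)"
    by (rule nn_integral_liminf) auto
  also have "\<dots> \<le> liminf (\<lambda>m::nat. C)"
    by (intro Liminf_mono always_eventually allI le G)
  finally show ?thesis by (simp add: Liminf_const)
qed

text \<open>Completeness of L^1 on compact sets, done by hand with one limit function for all K:
  fast partial sums along growing families, their pointwise limit g, and Fatou for the
  error.\<close>

lemma para_cauchy_imp_has_paraproduct:
  fixes b f :: "real ^ 'n \<Rightarrow> 'k :: {real_normed_field, euclidean_space}"
  assumes pc: "para_cauchy b f"
  shows "\<exists>g. has_paraproduct cubes b f g"
proof -
  define P where "P m F0 \<longleftrightarrow> finite F0 \<and> F0 \<subseteq> cubes \<and> (\<forall>F. finite F \<longrightarrow> F \<subseteq> cubes \<longrightarrow> F \<inter> F0 = {} \<longrightarrow>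
       (\<integral>\<^sup>+x\<in>cball 0 (real m). ennreal (norm (partial_para b f F x)) \<partial>lebesgue) \<le> ennreal ((1/2) ^ m))" for m :: nat and F0
  have "\<forall>m. \<exists>F0. P m F0"
    using pc unfolding para_cauchy_def P_def by simp
  then obtain F0 where F0: "\<And>m. P m (F0 m)" by metis
  \<comment> \<open>The union makes the families increasing, so that what is added after stage m
    avoids \<open>F0 m\<close> and is small on the ball of radius m.\<close>
  define G where "G m = (\<Union>i\<le>m. F0 i)" for m
  have G: "finite (G m)" "G m \<subseteq> cubes" "F0 m \<subseteq> G m" for m
    using F0 by (auto simp: G_def P_def)
  have Gmono: "G m \<subseteq> G k" if "m \<le> k" for m k
    unfolding G_def using that by (intro UN_mono) auto
  define h where "h m = partial_para b f (G m)" for m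
  have hm [measurable]: "h m \<in> borel_measurable lebesgue" for m
    unfolding h_def by (intro partial_para_measurable G)
  have diff: "(\<integral>\<^sup>+x\<in>cball 0 (real m). ennreal (norm (partial_para b f F x - h m x)) \<partial>lebesgue) \<le> ennreal ((1/2) ^ m)"
    if F: "finite F" "F \<subseteq> cubes" "G m \<subseteq> F" for m F
  proof -
    have "partial_para b f F x - h m x = partial_para b f (F - G m) x" for x
    proof -
      have "F = (F - G m) \<union> G m" using F by auto
      then have "partial_para b f F x = partial_para b f (F - G m) x + partial_para b f (G m) x"
        using partial_para_Un[of "F - G m" "G m"] F G by (metis Diff_disjoint Int_commute finite_Diff)
      then show ?thesis by (simp add: h_def)
    qed
    moreover have "(F - G m) \<inter> F0 m = {}" "finite (F - G m)" "F - G m \<subseteq> cubes" using G(3)[of m] F by auto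
    ultimately show ?thesis using F0[of m] unfolding P_def by simp
  qed
  define g where "g x = lim (\<lambda>m. h m x)" for x
  have gm [measurable]: "g \<in> borel_measurable lebesgue"
    unfolding g_def by (intro borel_measurable_lim_metric hm)
  have "AE x in lebesgue. summable (\<lambda>m. norm (h (Suc m) x - h m x))"
  proof (rule fast_L1_summable)
    fix m
    show "(\<integral>\<^sup>+x\<in>cball 0 (real m). ennreal (norm (h (Suc m) x - h m x)) \<partial>lebesgue) \<le> ennreal ((1/2) ^ m)"
      using diff[of "G (Suc m)" m] G Gmono[of m "Suc m"] by (simp add: h_def)
  qed auto
  then have lim: "AE x in lebesgue. (\<lambda>m. h m x) \<longlonglongrightarrow> g x"
  proof eventually_elim
    case (elim x)
    then have "summable (\<lambda>m. h (Suc m) x - h m x)" by (rule summable_norm_cancel)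
    then have "convergent (\<lambda>n. \<Sum>m<n. h (Suc m) x - h m x)" by (simp add: summable_iff_convergent)
    then have "convergent (\<lambda>n. h n x - h 0 x)" using sum_lessThan_telescope[of "\<lambda>m. h m x"] by simp
    then have "convergent (\<lambda>n. h n x)" by (simp add: convergent_diff_const_right_iff)
    then show ?case by (simp add: g_def convergent_LIMSEQ_iff)
  qed
  \<comment> \<open>Fatou in the index k: \<open>h m - h k\<close> has norm at most
    \<open>(1/2) ^ m\<close> for every \<open>k \<ge> m\<close>.\<close>
  have gh: "(\<integral>\<^sup>+x\<in>cball 0 (real m). ennreal (norm (h m x - g x)) \<partial>lebesgue) \<le> ennreal ((1/2) ^ m)" for m
  proof -
    have cb [measurable]: "cball 0 (real m) \<in> sets (lebesgue :: (real ^ 'n) measure)" by simp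
    have "(\<integral>\<^sup>+x\<in>cball 0 (real m). ennreal (norm (h m x - g x)) \<partial>lebesgue) =
       (\<integral>\<^sup>+x. liminf (\<lambda>k. ennreal (norm (h m x - h k x)) * indicator (cball 0 (real m)) x) \<partial>lebesgue)"
    proof (rule nn_integral_cong_AE)
      show "AE x in lebesgue. ennreal (norm (h m x - g x)) * indicator (cball 0 (real m)) x =
         liminf (\<lambda>k. ennreal (norm (h m x - h k x)) * indicator (cball 0 (real m)) x)"
        using lim
      proof eventually_elim
        case (elim x)
        have "(\<lambda>k. ennreal (norm (h m x - h k x) * indicat_real (cball 0 (real m)) x)) \<longlonglongrightarrow>
           ennreal (norm (h m x - g x) * indicat_real (cball 0 (real m)) x)"
          by (intro tendsto_ennrealI tendsto_intros elim)
        then have "(\<lambda>k. ennreal (norm (h m x - h k x)) * indicator (cball 0 (real m)) x) \<longlonglongrightarrow>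
           ennreal (norm (h m x - g x)) * indicator (cball 0 (real m)) x"
          by (cases "x \<in> cball 0 (real m)") simp_all
        then show ?case by (simp add: lim_imp_Liminf)
      qed
    qed
    also have "\<dots> \<le> liminf (\<lambda>k. \<integral>\<^sup>+x\<in>cball 0 (real m). ennreal (norm (h m x - h k x)) \<partial>lebesgue)"
      by (rule nn_integral_liminf) auto
    also have "\<dots> \<le> liminf (\<lambda>k::nat. ennreal ((1/2) ^ m))"
    proof (rule Liminf_mono)
      show "\<forall>\<^sub>F k in sequentially. (\<integral>\<^sup>+x\<in>cball 0 (real m). ennreal (norm (h m x - h k x)) \<partial>lebesgue) \<le> ennreal ((1/2) ^ m)"
        using eventually_ge_at_top[of m]
      proof eventually_elim
        case (elim k)
        show ?case
          using diff[of "G k" m] G Gmono[OF elim] by (simp add: h_def norm_minus_commute)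
      qed
    qed
    finally show ?thesis by (simp add: Liminf_const)
  qed
  have Fg: "(\<integral>\<^sup>+x\<in>K. ennreal (norm (partial_para b f F x - g x)) \<partial>lebesgue) \<le> ennreal (2 * (1/2) ^ m)"
    if F: "finite F" "F \<subseteq> cubes" "G m \<subseteq> F" and K: "K \<subseteq> cball 0 (real m)" for F K m
  proof -
    have [measurable]: "partial_para b f F \<in> borel_measurable lebesgue" using partial_para_measurable F by blast
    have cb [measurable]: "cball 0 (real m) \<in> sets (lebesgue :: (real ^ 'n) measure)" by simp
    have "(\<integral>\<^sup>+x\<in>K. ennreal (norm (partial_para b f F x - g x)) \<partial>lebesgue) \<le>
      (\<integral>\<^sup>+x. ennreal (norm (partial_para b f F x - h m x)) * indicator (cball 0 (real m)) x +
        ennreal (norm (h m x - g x)) * indicator (cball 0 (real m)) x \<partial>lebesgue)"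
    proof (intro nn_integral_mono)
      fix x
      have "norm (partial_para b f F x - g x) \<le> norm (partial_para b f F x - h m x) + norm (h m x - g x)"
        using norm_triangle_ineq[of "partial_para b f F x - h m x" "h m x - g x"] by simp
      then have "ennreal (norm (partial_para b f F x - g x)) \<le> ennreal (norm (partial_para b f F x - h m x)) + ennreal (norm (h m x - g x))"
        by (simp add: ennreal_leI flip: ennreal_plus)
      then show "ennreal (norm (partial_para b f F x - g x)) * indicator K x \<le>
         ennreal (norm (partial_para b f F x - h m x)) * indicator (cball 0 (real m)) x +
        ennreal (norm (h m x - g x)) * indicator (cball 0 (real m)) x"
        using K by (cases "x \<in> K") (auto simp: indicator_def subset_iff simp del: mem_cball)
    qed
    also have "\<dots> = (\<integral>\<^sup>+x\<in>cball 0 (real m). ennreal (norm (partial_para b f F x - h m x)) \<partial>lebesgue) +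
       (\<integral>\<^sup>+x\<in>cball 0 (real m). ennreal (norm (h m x - g x)) \<partial>lebesgue)"
      by (rule nn_integral_add) auto
    also have "\<dots> \<le> ennreal ((1/2) ^ m) + ennreal ((1/2) ^ m)"
      by (intro add_mono diff F gh)
    also have "\<dots> = ennreal (2 * (1/2) ^ m)" by (simp flip: ennreal_plus)
    finally show ?thesis .
  qed
  have "g \<in> L1loc"
    unfolding L1loc_def
  proof (intro CollectI conjI gm allI impI)
    fix K :: "(real ^ 'n) set" assume K: "compact K"
    have Km [measurable]: "K \<in> sets lebesgue" using lmeasurable_compact[OF K] by auto
    obtain m where "\<forall>k\<ge>m. K \<subseteq> cball 0 (real k)" by (rule exE[OF compact_in_cball[OF K]])
    then have m: "K \<subseteq> cball 0 (real m)" by simp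
    \<comment> \<open>\<open>h m\<close> is bounded, being a finite sum, and g differs from it by a
      function integrable on K.\<close>
    obtain B where B: "0 \<le> B" "\<And>x. norm (h m x) \<le> B" using partial_para_bounded[OF G(1,2)] unfolding h_def by metis
    have "(\<integral>\<^sup>+x. ennreal (norm (indicat_real K x *\<^sub>R g x)) \<partial>lebesgue) \<le>
      (\<integral>\<^sup>+x. ennreal B * indicator K x + ennreal (norm (h m x - g x)) * indicator K x \<partial>lebesgue)"
    proof (intro nn_integral_mono)
      fix x
      have "norm (g x) \<le> B + norm (h m x - g x)"
        using norm_triangle_ineq2[of "g x" "h m x"] B(2)[of x] by (simp add: norm_minus_commute)
      then show "ennreal (norm (indicat_real K x *\<^sub>R g x)) \<le> ennreal B * indicator K x + ennreal (norm (h m x - g x)) * indicator K x"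
        using B(1) by (auto simp: indicator_def ennreal_leI simp flip: ennreal_plus)
    qed
    also have "\<dots> = ennreal B * emeasure lebesgue K + (\<integral>\<^sup>+x\<in>K. ennreal (norm (h m x - g x)) \<partial>lebesgue)"
      by (subst nn_integral_add) (auto simp: nn_integral_cmult_indicator)
    also have "\<dots> \<le> ennreal B * emeasure lebesgue K + ennreal (2 * (1/2) ^ m)"
      using Fg[OF G(1) G(2) _ m, of m] unfolding h_def by (intro add_left_mono) auto
    also have "\<dots> < top" using lmeasurable_compact[OF K] by (auto simp: ennreal_mult_less_top fmeasurable_def)
    finally show "set_integrable lebesgue K g"
      unfolding set_integrable_def by (intro integrableI_bounded) auto
  qed
  moreover have "((\<lambda>F. \<integral>\<^sup>+x\<in>K. ennreal (norm (partial_para b f F x - g x)) \<partial>lebesgue) \<longlongrightarrow> 0) (finite_subsets_at_top cubes)"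
    if K: "compact K" for K
  proof (rule order_tendstoI)
    fix a :: ennreal assume a: "0 < a"
    obtain j where "\<forall>m\<ge>j. K \<subseteq> cball 0 (real m)" by (rule exE[OF compact_in_cball[OF K]])
    then have j: "K \<subseteq> cball 0 (real m)" if "j \<le> m" for m using that by simp
    have "\<exists>c>0. ennreal c \<le> a"
    proof (cases a)
      case (real c)
      then show ?thesis using a by (intro exI[of _ c]) auto
    qed (auto intro: exI[of _ 1])
    then obtain c where c: "0 < c" "ennreal c \<le> a" by auto
    have "(\<lambda>m. 2 * (1/2) ^ m :: real) \<longlonglongrightarrow> 2 * 0" by (intro tendsto_intros LIMSEQ_power_zero) auto
    then have "\<forall>\<^sub>F m in sequentially. 2 * (1/2) ^ m < c" using c by (intro order_tendstoD) auto
    then have "\<forall>\<^sub>F m in sequentially. 2 * (1/2) ^ m < c \<and> j \<le> m" using eventually_ge_at_top by (rule eventually_conj)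
    then have "\<exists>m. 2 * (1/2) ^ m < c \<and> j \<le> m" by (rule eventually_happens'[OF sequentially_bot])
    then obtain m where m: "2 * (1/2) ^ m < c" "j \<le> m" by auto
    have "(\<integral>\<^sup>+x\<in>K. ennreal (norm (partial_para b f F x - g x)) \<partial>lebesgue) < a"
      if "finite F \<and> G m \<subseteq> F \<and> F \<subseteq> cubes" for F
    proof -
      have "(\<integral>\<^sup>+x\<in>K. ennreal (norm (partial_para b f F x - g x)) \<partial>lebesgue) \<le> ennreal (2 * (1/2) ^ m)"
        using that j[OF m(2)] by (intro Fg) auto
      also have "\<dots> < ennreal c" using m by (simp add: ennreal_lessI c)
      finally show ?thesis using c by simp
    qed
    then show "\<forall>\<^sub>F F in finite_subsets_at_top cubes. (\<integral>\<^sup>+x\<in>K. ennreal (norm (partial_para b f F x - g x)) \<partial>lebesgue) < a"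
      unfolding eventually_finite_subsets_at_top using G by (intro exI[of _ "G m"]) auto
  qed simp
  ultimately show ?thesis
    unfolding has_paraproduct_def partial_para_def by (intro exI[of _ g]) auto
qed

text \<open>Collects both demands of the definition. \<open>paraproduct\<close> is an arbitrary
  choice among the limits, but the Fatou bound holds for each of them.\<close>

lemma paraproduct_norm_le:
  fixes b :: "real ^ 'n \<Rightarrow> 'k :: {real_normed_field, euclidean_space}"
  assumes pc: "\<And>f. f \<in> Linfc \<Longrightarrow> para_cauchy b f"
    and \<tau>: "\<tau> \<in> borel_measurable lebesgue" "\<And>x. 0 < \<tau> x" and \<mu>: "cube_finite \<mu>" "\<And>x. 0 < \<mu> x" and q: "0 < q" "0 < p" and N: "0 \<le> N"
    and le: "\<And>f F B. f \<in> Linfc \<Longrightarrow> finite F \<Longrightarrow> F \<subseteq> cubes \<Longrightarrow> 0 \<le> B \<Longrightarrow>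
      (\<integral>\<^sup>+x. ennreal (norm (f x) powr p * \<mu> x) \<partial>lebesgue) = ennreal B \<Longrightarrow>
      (\<integral>\<^sup>+x. ennreal (norm (partial_para b f F x) powr q * \<tau> x) \<partial>lebesgue) \<le> ennreal ((N * B powr (1 / p)) powr q)"
  shows "paraproduct_norm cubes p \<mu> q \<tau> b \<le> ennreal N"
proof -
  have ex: "\<exists>g. has_paraproduct cubes b f g" if "f \<in> Linfc" for f
    using para_cauchy_imp_has_paraproduct[OF pc[OF that]] .
  have "Lp_norm q \<tau> (paraproduct cubes b f) \<le> ennreal N * Lp_norm p \<mu> f" if f: "f \<in> Linfc" for f
  proof -
    have g: "has_paraproduct cubes b f (paraproduct cubes b f)"
      unfolding paraproduct_def using ex[OF f] by (rule someI_ex)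
    obtain B where B: "0 \<le> B" "(\<integral>\<^sup>+x. ennreal (norm (f x) powr p * \<mu> x) \<partial>lebesgue) = ennreal B"
      using Linfc_norm_finite[OF f \<mu> q(2)] by (cases "\<integral>\<^sup>+x. ennreal (norm (f x) powr p * \<mu> x) \<partial>lebesgue") auto
    have "(\<integral>\<^sup>+x. ennreal (norm (paraproduct cubes b f x) powr q * \<tau> x) \<partial>lebesgue) \<le> ennreal ((N * B powr (1 / p)) powr q)"
      by (rule has_paraproduct_norm_le[OF g \<tau> q(1)]) (rule le[OF f _ _ B])
    then obtain A where A: "0 \<le> A" "A \<le> (N * B powr (1 / p)) powr q"
       "(\<integral>\<^sup>+x. ennreal (norm (paraproduct cubes b f x) powr q * \<tau> x) \<partial>lebesgue) = ennreal A"
      by (cases "\<integral>\<^sup>+x. ennreal (norm (paraproduct cubes b f x) powr q * \<tau> x) \<partial>lebesgue") (auto simp: top_unique ennreal_le_iff)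
    have "A powr (1 / q) \<le> ((N * B powr (1 / p)) powr q) powr (1 / q)"
      using A q by (intro powr_mono2) auto
    also have "\<dots> = N * B powr (1 / p)" using q N by (simp add: powr_powr)
    finally have "ennreal (A powr (1 / q)) \<le> ennreal N * ennreal (B powr (1 / p))"
      using N by (simp add: ennreal_leI flip: ennreal_mult)
    then show ?thesis unfolding Lp_norm_def A(3) B(2) epowr_def using A B by simp
  qed
  then have "op_norm Linfc p \<mu> q \<tau> (paraproduct cubes b) \<le> ennreal N"
    unfolding op_norm_def using N by (intro Inf_lower) auto
  then show ?thesis
    unfolding paraproduct_norm_def paraproduct_well_defined_def using ex by simp
qed

end

section \<open>Sufficiency\<close>

text \<open>The equality case of Hoelder with \<open>1 / q = 1 / p + 1 / r\<close>: on the extremal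
  function both sides are powers of one integral i, and
  \<open>i powr (1 / q) \<le> N * i powr (1 / p)\<close> gives
  \<open>i powr (1 / r) \<le> N\<close>. Truncation makes i finite and Fatou removes it.\<close>

lemma mult_norm_lower:
  fixes h :: "real ^ 'n \<Rightarrow> 'k :: {real_normed_field, euclidean_space}" and \<mu> lam \<nu> :: "real ^ 'n \<Rightarrow> real"
  assumes pq: "1 < q" "q < p" and r: "1 / r = 1 / q - 1 / p"
    and m: "h \<in> borel_measurable lebesgue" "\<mu> \<in> borel_measurable lebesgue" "\<nu> \<in> borel_measurable lebesgue"
      "lam \<in> borel_measurable lebesgue"
    and pos: "\<And>x. 0 < \<mu> x" "\<And>x. 0 < lam x" "\<And>x. 0 < \<nu> x"
    and \<nu>: "\<And>x. \<nu> x powr (1 - 1 / r) = \<mu> x powr (1 / p) * lam x powr (- 1 / q)"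
    and N: "0 \<le> N" and le: "\<And>f. f \<in> Lp p \<mu> \<Longrightarrow> Lp_norm q lam (\<lambda>x. h x * f x) \<le> ennreal N * Lp_norm p \<mu> f"
  shows "(\<integral>\<^sup>+x. ennreal (norm (h x) powr r * \<nu> x powr (1 - r)) \<partial>lebesgue) \<le> ennreal (N powr r)"
proof -
  note [measurable] = m
  have "1 / p < 1 / q" using pq by (simp add: frac_less2)
  then have "1 / r > 0" using r by simp
  then have r0: "r > 0" by simp
  have p0: "p > 0" "q > 0" using pq by auto
  define \<phi> where "\<phi> x = norm (h x) powr r * \<nu> x powr (1 - r)" for x
  have \<phi>m [measurable]: "\<phi> \<in> borel_measurable lebesgue" unfolding \<phi>_def by measurable
  have \<phi>0: "0 \<le> \<phi> x" for x by (simp add: \<phi>_def)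
  \<comment> \<open>On \<open>B k\<close> the density \<phi> is at most k and the volume is finite,
    so the truncated integral may be divided out.\<close>
  define B where "B k = {x. \<phi> x \<le> real k} \<inter> cball 0 (real k)" for k :: nat
  have cb [measurable]: "cball 0 (real k) \<in> sets (lebesgue :: (real ^ 'n) measure)" for k by simp
  have Bm [measurable]: "B k \<in> sets lebesgue" for k
  proof -
    have "{x \<in> space lebesgue. \<phi> x \<le> real k} \<in> sets lebesgue" by measurable
    then show ?thesis unfolding B_def by (intro sets.Int cb) simp
  qed
  \<comment> \<open>The extremal function: \<open>|t|\<^sup>p \<mu>\<close> and \<open>|h t|\<^sup>q \<lambda>\<close> both equal \<open>\<phi>\<close>.\<close>
  define t where "t x = norm (h x) powr (r / p) * \<nu> x powr ((1 - r) / p) * \<mu> x powr (- 1 / p)" for x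
  have tm [measurable]: "t \<in> borel_measurable lebesgue" unfolding t_def by measurable
  have t0: "0 \<le> t x" for x by (simp add: t_def)
  have t1: "t x powr p * \<mu> x = \<phi> x" for x
  proof -
    have 1: "(\<mu> x powr (- 1 / p)) powr p * \<mu> x = 1"
      using p0 pos(1)[of x] powr_add[of "\<mu> x" "- 1" 1] by (simp add: powr_powr)
    have "t x powr p * \<mu> x = (norm (h x) powr (r / p)) powr p * (\<nu> x powr ((1 - r) / p)) powr p *
       ((\<mu> x powr (- 1 / p)) powr p * \<mu> x)"
      by (simp only: t_def powr_mult mult_ac)
    then show ?thesis using p0 unfolding 1 by (simp add: \<phi>_def powr_powr)
  qed
  have t2: "(norm (h x) * t x) powr q * lam x = \<phi> x" for x
  proof (cases "h x = 0")
    case False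
    then have h0: "norm (h x) > 0" by simp
    have e1: "q + r / p * q = r"
    proof -
      have "r / q = 1 + r / p" using r r0 by (simp add: field_simps)
      then have "q * (r / q) = q * (1 + r / p)" by simp
      then show ?thesis using p0 by (simp add: algebra_simps)
    qed
    have e2: "(1 - r) / p * q + - q * (1 - 1 / r) = 1 - r"
    proof -
      have "(1 - r) / p * q + - q * (1 - 1 / r) = (1 - r) * q * (1 / p + 1 / r)"
        using r0 by (simp add: field_simps)
      also have "1 / p + 1 / r = 1 / q" using r by simp
      finally show ?thesis using p0 by simp
    qed
    have "(\<mu> x powr (1 / p) * lam x powr (- 1 / q)) powr (- q) = \<nu> x powr (- q * (1 - 1 / r))"
      unfolding \<nu>[symmetric] by (simp add: powr_powr mult.commute)
    moreover have "(\<mu> x powr (1 / p) * lam x powr (- 1 / q)) powr (- q) = \<mu> x powr (- q / p) * lam x"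
      using p0 pos(2)[of x] by (simp add: powr_mult powr_powr)
    ultimately have 1: "\<mu> x powr (- q / p) * lam x = \<nu> x powr (- q * (1 - 1 / r))" by simp
    have "(norm (h x) * t x) powr q * lam x
       = (norm (h x) powr q * norm (h x) powr (r / p * q)) * (\<nu> x powr ((1 - r) / p * q) * (\<mu> x powr (- q / p) * lam x))"
      by (simp add: t_def powr_mult powr_powr mult_ac)
    also have "norm (h x) powr q * norm (h x) powr (r / p * q) = norm (h x) powr r"
      using e1 by (simp flip: powr_add)
    also have "\<nu> x powr ((1 - r) / p * q) * (\<mu> x powr (- q / p) * lam x) = \<nu> x powr (1 - r)"
      unfolding 1 powr_add[symmetric] e2 ..
    finally show ?thesis by (simp add: \<phi>_def)
  qed (use r0 p0 in \<open>simp add: \<phi>_def\<close>)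
  have trunc: "(\<integral>\<^sup>+x. ennreal (\<phi> x * indicat_real (B k) x) \<partial>lebesgue) \<le> ennreal (N powr r)" for k
  proof -
    define f where "f x = (of_real (t x * indicat_real (B k) x) :: 'k)" for x
    have fm [measurable]: "f \<in> borel_measurable lebesgue" unfolding f_def by measurable
    have nf: "norm (f x) = t x * indicat_real (B k) x" for x using t0[of x] by (simp add: f_def norm_mult)
    define I where "I = (\<integral>\<^sup>+x. ennreal (\<phi> x * indicat_real (B k) x) \<partial>lebesgue)"
    have f1: "norm (f x) powr p * \<mu> x = \<phi> x * indicat_real (B k) x" for x
      using t1[of x] p0 by (cases "x \<in> B k") (simp_all add: nf)
    have f2: "norm (h x * f x) powr q * lam x = \<phi> x * indicat_real (B k) x" for x
      using t2[of x] p0 by (cases "x \<in> B k") (simp_all add: nf norm_mult)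
    have "I \<le> (\<integral>\<^sup>+x. ennreal (real k) * indicator (cball (0 :: real ^ 'n) (real k)) x \<partial>lebesgue)"
      unfolding I_def
    proof (intro nn_integral_mono)
      fix x :: "real ^ 'n" show "ennreal (\<phi> x * indicat_real (B k) x) \<le> ennreal (real k) * indicator (cball 0 (real k)) x"
        by (cases "x \<in> B k") (auto simp: B_def intro!: ennreal_leI)
    qed
    also have "\<dots> = ennreal (real k) * emeasure lebesgue (cball (0 :: real ^ 'n) (real k))"
      by (rule nn_integral_cmult_indicator) simp
    also have "\<dots> < top" 
      using lmeasurable_cball[of "0 :: real ^ 'n" "real k"] by (auto simp: ennreal_mult_less_top fmeasurable_def)
    finally obtain i where i: "0 \<le> i" "I = ennreal i" by (cases I) auto
    have np: "Lp_norm p \<mu> f = ennreal (i powr (1 / p))"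
      unfolding Lp_norm_def f1 I_def[symmetric] i(2) epowr_def using i(1) by simp
    have nq: "Lp_norm q lam (\<lambda>x. h x * f x) = ennreal (i powr (1 / q))"
      unfolding Lp_norm_def f2 I_def[symmetric] i(2) epowr_def using i(1) by simp
    have "f \<in> Lp p \<mu>" unfolding Lp_def using np by simp
    then have "ennreal (i powr (1 / q)) \<le> ennreal N * ennreal (i powr (1 / p))" using le[of f] np nq by simp
    then have le': "i powr (1 / q) \<le> N * i powr (1 / p)" using N by (simp flip: ennreal_mult)
    have "i \<le> N powr r"
    proof (cases "i = 0")
      case False
      then have i0: "i > 0" using i by simp
      have "i powr (1 / q) = i powr (1 / r) * i powr (1 / p)" using r by (simp flip: powr_add)
      then have "i powr (1 / r) \<le> N" using le' i0 by simp
      then have "(i powr (1 / r)) powr r \<le> N powr r" using r0 by (intro powr_mono2) auto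
      then show ?thesis using r0 i0 by (simp add: powr_powr)
    qed simp
    then show ?thesis using i I_def by (simp add: ennreal_leI)
  qed
  have "(\<integral>\<^sup>+x. ennreal (\<phi> x) \<partial>lebesgue) = (\<integral>\<^sup>+x. liminf (\<lambda>k. ennreal (\<phi> x * indicat_real (B k) x)) \<partial>lebesgue)"
  proof (rule nn_integral_cong)
    fix x :: "real ^ 'n"
    obtain k0 :: nat where k0: "max (\<phi> x) (norm x) \<le> real k0" using real_arch_simple by blast
    have "\<forall>\<^sub>F k in sequentially. ennreal (\<phi> x * indicat_real (B k) x) = ennreal (\<phi> x)"
      using eventually_ge_at_top[of k0]
    proof eventually_elim
      case (elim k)
      then have "real k0 \<le> real k" by simp
      then have "x \<in> B k" using k0 by (simp add: B_def)
      then show ?case by simp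
    qed
    then have "(\<lambda>k. ennreal (\<phi> x * indicat_real (B k) x)) \<longlonglongrightarrow> ennreal (\<phi> x)"
      by (rule tendsto_eventually)
    then show "ennreal (\<phi> x) = liminf (\<lambda>k. ennreal (\<phi> x * indicat_real (B k) x))"
      by (simp add: lim_imp_Liminf)
  qed
  also have "\<dots> \<le> liminf (\<lambda>k. \<integral>\<^sup>+x. ennreal (\<phi> x * indicat_real (B k) x) \<partial>lebesgue)"
    by (rule nn_integral_liminf) auto
  also have "\<dots> \<le> liminf (\<lambda>k::nat. ennreal (N powr r))"
    by (intro Liminf_mono always_eventually allI trunc)
  finally show ?thesis by (simp add: Liminf_const \<phi>_def)
qed

context dyadic begin

lemma L1loc_cube_integrable:
  assumes "b \<in> L1loc" shows "cube_integrable b"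
proof -
  have [measurable]: "b \<in> borel_measurable lebesgue" using assms by (simp add: L1loc_def)
  have "emeasure (wmeasure (\<lambda>x. norm (b x))) Q < top" if Q: "Q \<in> cubes" for Q
  proof -
    obtain B where "\<forall>x\<in>Q. norm x \<le> B" using cube_bounded[OF Q] unfolding bounded_iff by (rule exE)
    then have B: "Q \<subseteq> cball 0 B" by auto
    have cb: "cball 0 B \<in> sets (lebesgue :: (real ^ 'n) measure)" by simp
    have "set_integrable lebesgue (cball 0 B) b" using assms by (simp add: L1loc_def)
    then have "(\<integral>\<^sup>+x. ennreal (norm (indicat_real (cball 0 B) x *\<^sub>R b x)) \<partial>lebesgue) < top"
      unfolding set_integrable_def by (auto simp: integrable_iff_bounded)
    also have "(\<integral>\<^sup>+x. ennreal (norm (indicat_real (cball 0 B) x *\<^sub>R b x)) \<partial>lebesgue) = emeasure (wmeasure (\<lambda>x. norm (b x))) (cball 0 B)"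
      using cb by (subst emeasure_wmeasure) (auto simp: mass_def indicator_def intro!: nn_integral_cong)
    finally have 1: "emeasure (wmeasure (\<lambda>x. norm (b x))) (cball 0 B) < top" .
    have "emeasure (wmeasure (\<lambda>x. norm (b x))) Q \<le> emeasure (wmeasure (\<lambda>x. norm (b x))) (cball 0 B)"
      using B cb by (intro emeasure_mono) auto
    then show ?thesis using 1 by (rule le_less_trans)
  qed
  then show ?thesis by (simp add: cube_integrable_def cube_finite_def)
qed

lemma weight_cube_finite: assumes "weight w" shows "cube_finite w"
proof -
  have "cube_integrable w" using assms L1loc_cube_integrable by (auto simp: weight_def)
  moreover have "(\<lambda>x. norm (w x)) = w" using assms by (auto simp: weight_def less_imp_le)
  ultimately show ?thesis by (simp add: cube_integrable_def)
qed

lemma eaverage_eq: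
  assumes "w \<in> borel_measurable lebesgue" "Q \<in> cubes" "emeasure (wmeasure w) Q < top"
  shows "eaverage Q w = ennreal (wmass w Q / vol Q)"
proof -
  have "emeasure lebesgue Q = ennreal (vol Q)" using cube_lmeasurable[OF assms(2)] by (simp add: emeasure_eq_measure2)
  moreover have "mass w Q = ennreal (wmass w Q)"
    using emeasure_wmeasure[OF assms(1) cube_sets[OF assms(2)]] emeasure_wmeasure_eq_measure[OF assms(3)] by simp
  ultimately show ?thesis using vol_pos[OF assms(2)] by (simp add: eaverage_def divide_ennreal)
qed

text \<open>The average of w is positive on every cube, so an infinite mass of the dual weight would
  make the characteristic infinite. What remains restates the characteristic in real masses.\<close>

lemma Ap_char_bound:
  assumes w: "weight w" and p: "1 < p" and A: "Ap_char cubes p w \<le> ennreal A" "0 \<le> A"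
  defines "\<sigma> \<equiv> \<lambda>x. w x powr (- conj_exp p / p)"
  shows "cube_finite \<sigma>"
    and "Q \<in> cubes \<Longrightarrow> wmass w Q * wmass \<sigma> Q powr (p - 1) \<le> A * vol Q powr p"
proof -
  have wpos: "\<And>x. 0 < w x" using w by (simp add: weight_def)
  note wc = weight_cube_finite[OF w]
  have [measurable]: "w \<in> borel_measurable lebesgue" using cube_finiteD(1)[OF wc] .
  have sm [measurable]: "\<sigma> \<in> borel_measurable lebesgue" unfolding \<sigma>_def by measurable
  have cp: "p / conj_exp p = p - 1" using p by (simp add: conj_exp_def)
  have char: "eaverage Q w * epowr (eaverage Q \<sigma>) (p - 1) \<le> ennreal A" if "Q \<in> cubes" for Q
  proof -
    have "eaverage Q w * epowr (eaverage Q \<sigma>) (p / conj_exp p) \<le> Ap_char cubes p w"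
      unfolding Ap_char_def \<sigma>_def using that by (intro SUP_upper)
    then show ?thesis using A(1) cp by simp
  qed
  have ew: "eaverage Q w = ennreal (wmass w Q / vol Q)" if "Q \<in> cubes" for Q
    using that wc cube_finiteD by (intro eaverage_eq) auto
  have U: "wmass w Q / vol Q > 0" if "Q \<in> cubes" for Q
    using cube_finite_pos[OF wc wpos that] vol_pos[OF that] by simp
  have sfin: "emeasure (wmeasure \<sigma>) Q < top" if Q: "Q \<in> cubes" for Q
  proof (rule ccontr)
    assume "\<not> ?thesis"
    then have "mass \<sigma> Q = top" using emeasure_wmeasure[OF sm cube_sets[OF Q]] by (auto simp: not_less top_unique)
    then have "eaverage Q \<sigma> = top"
      using cube_lmeasurable[OF Q] by (simp add: eaverage_def emeasure_eq_measure2 ennreal_top_divide)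
    then have "eaverage Q w * top \<le> ennreal A" using char[OF Q] by (simp add: epowr_def)
    moreover have "eaverage Q w \<noteq> 0" using ew[OF Q] U[OF Q] by (auto simp: zero_less_divide_iff)
    ultimately show False by (simp add: ennreal_mult_top top_unique)
  qed
  then show "cube_finite \<sigma>" by (simp add: cube_finite_def)
  assume Q: "Q \<in> cubes"
  have "eaverage Q \<sigma> = ennreal (wmass \<sigma> Q / vol Q)" by (intro eaverage_eq sm Q sfin)
  then have "ennreal (wmass w Q / vol Q) * ennreal ((wmass \<sigma> Q / vol Q) powr (p - 1)) \<le> ennreal A"
    using char[OF Q] ew[OF Q] by (simp add: epowr_def)
  then have "wmass w Q / vol Q * (wmass \<sigma> Q / vol Q) powr (p - 1) \<le> A"
    using A(2) by (simp flip: ennreal_mult)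
  then have "wmass w Q * wmass \<sigma> Q powr (p - 1) / (vol Q * vol Q powr (p - 1)) \<le> A"
    using vol_pos[OF Q] by (simp add: powr_divide)
  moreover have "vol Q * vol Q powr (p - 1) = vol Q powr p"
    using vol_pos[OF Q] powr_add[of "vol Q" 1 "p - 1"] by simp
  ultimately show "wmass w Q * wmass \<sigma> Q powr (p - 1) \<le> A * vol Q powr p"
    using vol_pos[OF Q] by (simp add: pos_divide_le_eq)
qed

end

section \<open>The two-weight setting: exponents, dual weights, and the uniform bounds\<close>

locale weight_pair = dyadic D for D :: "int \<Rightarrow> (real ^ 'n) set set" +
  fixes p q r s :: real and \<mu> lam \<nu> \<sigma> \<omega> :: "real ^ 'n \<Rightarrow> real" and A L :: real
  assumes pq: "1 < q" "q < p" and r_def: "r = 1 / (1 / q - 1 / p)" and s_def: "s = conj_exp q"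
    and weights: "weight \<mu>" "weight lam"
    and \<sigma>_def: "\<sigma> = (\<lambda>x. \<mu> x powr (- conj_exp p / p))" and \<omega>_def: "\<omega> = (\<lambda>x. lam x powr (- conj_exp q / q))"
    and \<nu>: "\<And>x. 0 < \<nu> x"
      "\<And>x. \<nu> x powr (1 / p + 1 / conj_exp q) = \<mu> x powr (1 / p) * lam x powr (- 1 / q)"
    and A: "Ap_char cubes p \<mu> \<le> ennreal A" "0 < A" and L: "Ap_char cubes q lam \<le> ennreal L" "0 < L"
begin

lemma exponents: "1 < r" "1 < p" "1 < s" "1 / r + 1 / p + 1 / s = 1" "1 / q + 1 / s = 1"
  "1 / r = 1 / q - 1 / p" "1 / p + 1 / conj_exp q = 1 - 1 / r" "1 / (s - 1) = q - 1"
proof -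
  show "1 < p" using pq by simp
  have 1: "1 / p < 1 / q" using pq by (simp add: frac_less2)
  moreover have "1 / q - 1 / p < 1" using pq by (smt (verit) divide_less_eq_1_pos divide_pos_pos)
  ultimately show "1 < r" by (simp add: r_def)
  show s1: "1 < s" using pq by (simp add: s_def conj_exp_def)
  show q: "1 / q + 1 / s = 1" using pq by (simp add: s_def conj_exp_def field_simps)
  show r: "1 / r = 1 / q - 1 / p" by (simp add: r_def)
  then show "1 / r + 1 / p + 1 / s = 1" using q by simp
  then show "1 / p + 1 / conj_exp q = 1 - 1 / r" by (simp add: s_def)
  show "1 / (s - 1) = q - 1" using pq by (simp add: s_def conj_exp_def field_simps)
qed

lemma \<mu>_facts: "cube_finite \<mu>" "0 < \<mu> x" and lam_facts: "cube_finite lam" "0 < lam x"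
  using weights weight_cube_finite by (auto simp: weight_def)

lemma \<sigma>_facts: "cube_finite \<sigma>" "0 < \<sigma> x" "\<mu> x * \<sigma> x powr (p - 1) = 1"
proof -
  show "cube_finite \<sigma>" unfolding \<sigma>_def
    using pq A by (intro Ap_char_bound(1)[OF weights(1) _ A(1)]) auto
  show "0 < \<sigma> x" using \<mu>_facts(2)[of x] by (simp add: \<sigma>_def)
  have "- conj_exp p / p * (p - 1) = - 1" using pq by (simp add: conj_exp_def)
  then show "\<mu> x * \<sigma> x powr (p - 1) = 1"
    using \<mu>_facts(2)[of x] powr_add[of "\<mu> x" 1 "- 1"] by (simp add: \<sigma>_def powr_powr)
qed

lemma \<omega>_facts: "cube_finite \<omega>" "0 < \<omega> x" "\<omega> x * lam x powr (s - 1) = 1"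
proof -
  show "cube_finite \<omega>" unfolding \<omega>_def
    using pq L by (intro Ap_char_bound(1)[OF weights(2) _ L(1)]) auto
  show "0 < \<omega> x" using lam_facts(2)[of x] by (simp add: \<omega>_def)
  have "- conj_exp q / q + (s - 1) = 0" using pq by (simp add: conj_exp_def s_def field_simps)
  then show "\<omega> x * lam x powr (s - 1) = 1"
    using lam_facts(2)[of x] by (simp add: \<omega>_def flip: powr_add)
qed

lemma \<nu>_eq: "\<nu> x powr (1 - 1 / r) = \<mu> x powr (1 / p) * \<omega> x powr (1 / s)"
proof -
  have "- conj_exp q / q * (1 / s) = - 1 / q" using exponents(3) by (simp add: s_def)
  then have "\<omega> x powr (1 / s) = lam x powr (- 1 / q)" by (simp add: \<omega>_def powr_powr)
  then show ?thesis using \<nu>(2)[of x] exponents(7) by simp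
qed

lemma \<nu>_facts: "cube_finite \<nu>"
  by (rule weight_interpolation(1)[OF exponents(1-4) \<mu>_facts \<omega>_facts(1,2) \<nu>(1) \<nu>_eq])

text \<open>Duality of Muckenhoupt classes: the A_q bound of \<open>lam\<close> raised to the power
  s - 1, where \<open>(q - 1) * (s - 1) = 1\<close>.\<close>

lemma \<omega>_char:
  assumes Q: "Q \<in> cubes"
  shows "wmass \<omega> Q * wmass lam Q powr (s - 1) \<le> L powr (s - 1) * vol Q powr s"
proof -
  have s1: "s - 1 = 1 / (q - 1)" using pq by (simp add: s_def conj_exp_def field_simps)
  have "wmass lam Q * wmass \<omega> Q powr (q - 1) \<le> L * vol Q powr q"
    unfolding \<omega>_def using pq L by (intro Ap_char_bound(2)[OF weights(2) _ L(1) _ Q]) auto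
  then have "(wmass lam Q * wmass \<omega> Q powr (q - 1)) powr (s - 1) \<le> (L * vol Q powr q) powr (s - 1)"
    using exponents(3) by (intro powr_mono2) auto
  moreover have "(q - 1) * (s - 1) = 1" "q * (s - 1) = s"
    using pq by (simp_all add: s1) (simp add: s_def conj_exp_def)
  ultimately show ?thesis by (simp add: powr_mult powr_powr mult.commute)
qed

end

text \<open>Split off from \<open>weight_pair\<close> because the A_infinity characteristic of \<nu>
  is not assumed finite; the infinite case is treated without N.\<close>

locale two_weight = weight_pair D p q r s \<mu> lam \<nu> \<sigma> \<omega> A L
  for D :: "int \<Rightarrow> (real ^ 'n) set set" and p q r s \<mu> lam \<nu> \<sigma> \<omega> A L +
  fixes N :: real
  assumes N: "Ainf_char cubes \<nu> \<le> ennreal N" "0 < N"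
begin

definition K0 :: real where
  "K0 = form_const r p s CARD('n) * A powr (1 / (p - 1)) * L * N powr (1 / r)"

lemma K0_nonneg: "0 \<le> K0"
  using form_const_pos[OF exponents(1-3)] L by (simp add: K0_def less_imp_le)

lemma two_weight_form:
  fixes b g :: "real ^ 'n \<Rightarrow> 'k :: euclidean_space" and f :: "real ^ 'n \<Rightarrow> 'l :: euclidean_space"
  assumes b: "cube_integrable b" "(\<integral>\<^sup>+x. ennreal (norm (b x) powr r * \<nu> x powr (1 - r)) \<partial>lebesgue) \<le> ennreal Bb" "0 \<le> Bb"
    and f: "cube_integrable f" "(\<integral>\<^sup>+x. ennreal (norm (f x) powr p * \<mu> x) \<partial>lebesgue) \<le> ennreal Bf" "0 \<le> Bf"
    and g: "cube_integrable g" "(\<integral>\<^sup>+x. ennreal (norm (g x) powr s * \<omega> x) \<partial>lebesgue) \<le> ennreal Bg" "0 \<le> Bg"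
    and F: "finite F" "F \<subseteq> cubes"
  shows "(\<Sum>Q\<in>F. norm (average Q f) * osc2 b g Q) \<le> K0 * Bb powr (1 / r) * Bf powr (1 / p) * Bg powr (1 / s)"
proof -
  \<comment> \<open>This is where the dependence on the characteristic of \<open>lam\<close> becomes
    linear.\<close>
  have "(L powr (s - 1)) powr (1 / (s - 1)) = L" using exponents(3) L by (simp add: powr_powr)
  then show ?thesis
    using form_bound[OF exponents(1-4) \<mu>_facts \<sigma>_facts(1,2) \<omega>_facts(1,2) lam_facts \<sigma>_facts(3) \<omega>_facts(3) A(2)
      _ _ \<omega>_char \<nu>(1) \<nu>_eq N b f g F] Ap_char_bound(2)[OF weights(1) exponents(2) A(1)] A(2) L(2)
    by (simp add: K0_def \<sigma>_def)
qed

lemma para_Lq_bound: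
  fixes b f :: "real ^ 'n \<Rightarrow> 'k :: {real_normed_field, euclidean_space}"
  assumes b: "cube_integrable b" "(\<integral>\<^sup>+x. ennreal (norm (b x) powr r * \<nu> x powr (1 - r)) \<partial>lebesgue) \<le> ennreal Bb" "0 \<le> Bb"
    and f: "cube_integrable f" "(\<integral>\<^sup>+x. ennreal (norm (f x) powr p * \<mu> x) \<partial>lebesgue) \<le> ennreal Bf" "0 \<le> Bf"
    and F: "finite F" "F \<subseteq> cubes"
  shows "(\<integral>\<^sup>+x. ennreal (norm (partial_para b f F x) powr q * lam x) \<partial>lebesgue)
    \<le> ennreal ((K0 * Bb powr (1 / r) * Bf powr (1 / p)) powr q)"
proof -
  obtain B where B: "\<And>x. norm (partial_para b f F x) \<le> B" using partial_para_bounded[OF F] by metis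
  show ?thesis
  proof (rule duality_Lq[OF pq(1) exponents(5) partial_para_measurable[OF F] B partial_para_zero[OF F] F lam_facts
      cube_finiteD(1)[OF \<omega>_facts(1)] \<omega>_facts(2,3)])
    show "0 \<le> K0 * Bb powr (1 / r) * Bf powr (1 / p)" using K0_nonneg by simp
    fix g :: "real ^ 'n \<Rightarrow> 'k" and Bg
    assume g: "cube_integrable g" "0 \<le> Bg" "(\<integral>\<^sup>+x. ennreal (norm (g x) powr s * \<omega> x) \<partial>lebesgue) \<le> ennreal Bg"
    show "(LINT x|lebesgue. inner (partial_para b f F x) (g x)) \<le> K0 * Bb powr (1 / r) * Bf powr (1 / p) * Bg powr (1 / s)"
      by (rule order_trans[OF partial_para_pairing(2)[OF F b(1) g(1)] two_weight_form[OF b f g(1,3,2) F]])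
  qed
qed

text \<open>Testing the form against a sign function on K gives a bound proportional to the norm of
  the symbol. It makes the remainder of the symbol negligible in \<open>para_cauchy\<close>.\<close>

lemma para_L1_bound:
  fixes b f :: "real ^ 'n \<Rightarrow> 'k :: {real_normed_field, euclidean_space}"
  assumes b: "cube_integrable b" "(\<integral>\<^sup>+x. ennreal (norm (b x) powr r * \<nu> x powr (1 - r)) \<partial>lebesgue) \<le> ennreal Bb" "0 \<le> Bb"
    and f: "cube_integrable f" "(\<integral>\<^sup>+x. ennreal (norm (f x) powr p * \<mu> x) \<partial>lebesgue) \<le> ennreal Bf" "0 \<le> Bf"
    and F: "finite F" "F \<subseteq> cubes" and K: "compact K"
  shows "(\<integral>\<^sup>+x\<in>K. ennreal (norm (partial_para b f F x)) \<partial>lebesgue)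
    \<le> ennreal (K0 * Bb powr (1 / r) * Bf powr (1 / p) * wmass \<omega> K powr (1 / s))"
proof -
  obtain B where B: "\<And>x. norm (partial_para b f F x) \<le> B" using partial_para_bounded[OF F] by metis
  define g where "g x = indicat_real K x *\<^sub>R sgn (partial_para b f F x)" for x
  note L = L1_by_pairing[OF partial_para_measurable[OF F] B K, folded g_def]
  have Km: "K \<in> sets lebesgue" using lmeasurable_compact[OF K] by auto
  have "(\<integral>\<^sup>+x. ennreal (norm (g x) powr s * \<omega> x) \<partial>lebesgue) \<le> (\<integral>\<^sup>+x\<in>K. ennreal (\<omega> x) \<partial>lebesgue)"
  proof (intro nn_integral_mono)
    fix x
    show "ennreal (norm (g x) powr s * \<omega> x) \<le> ennreal (\<omega> x) * indicator K x"
    proof (cases "x \<in> K")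
      case True
      have "norm (g x) powr s \<le> 1 powr s" using L(2)[of x] True exponents(3) by (intro powr_mono2) (auto simp: g_def)
      then show ?thesis using True \<omega>_facts(2)[of x] by (simp add: ennreal_leI mult_left_le_one_le)
    qed (simp add: g_def)
  qed
  also have "\<dots> = emeasure (wmeasure \<omega>) K"
    using emeasure_wmeasure[OF cube_finiteD(1)[OF \<omega>_facts(1)] Km] by (simp add: mass_def)
  also have "\<dots> = ennreal (wmass \<omega> K)"
    by (intro emeasure_wmeasure_eq_measure cube_finite_compact \<omega>_facts K)
  finally have gB: "(\<integral>\<^sup>+x. ennreal (norm (g x) powr s * \<omega> x) \<partial>lebesgue) \<le> ennreal (wmass \<omega> K)" .
  have gc: "cube_integrable g" using L(1) by (simp add: g_def[abs_def])
  have "(LINT x|lebesgue. inner (partial_para b f F x) (g x))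
      \<le> K0 * Bb powr (1 / r) * Bf powr (1 / p) * wmass \<omega> K powr (1 / s)"
    by (rule order_trans[OF partial_para_pairing(2)[OF F b(1) gc] two_weight_form[OF b f gc gB _ F]]) simp
  then show ?thesis using L(3) by (simp add: ennreal_leI g_def)
qed

text \<open>
  The symbol is split into a bounded compactly supported part, handled by orthogonality, and a part
  of small norm, handled by the uniform bound.
\<close>

lemma para_cauchy:
  fixes b f :: "real ^ 'n \<Rightarrow> 'k :: {real_normed_field, euclidean_space}"
  assumes b: "cube_integrable b" "(\<integral>\<^sup>+x. ennreal (norm (b x) powr r * \<nu> x powr (1 - r)) \<partial>lebesgue) < top"
    and f: "f \<in> Linfc"
  shows "para_cauchy b f"
  unfolding para_cauchy_def
proof (intro allI impI)
  fix K :: "(real ^ 'n) set" and \<epsilon> :: real assume K: "compact K" and \<epsilon>: "0 < \<epsilon>"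
  have [measurable]: "b \<in> borel_measurable lebesgue" "\<nu> \<in> borel_measurable lebesgue"
    using b(1) cube_finiteD(1)[OF \<nu>_facts] by (auto simp: cube_integrable_def)
  have fc: "cube_integrable f" using Linfc_cube_integrable[OF f] .
  obtain Bf where Bf: "0 \<le> Bf" "(\<integral>\<^sup>+x. ennreal (norm (f x) powr p * \<mu> x) \<partial>lebesgue) = ennreal Bf"
    using Linfc_norm_finite[OF f \<mu>_facts, of p] exponents(2)
    by (cases "\<integral>\<^sup>+x. ennreal (norm (f x) powr p * \<mu> x) \<partial>lebesgue") auto
  define c where "c = K0 * Bf powr (1 / p) * wmass \<omega> K powr (1 / s)"
  have c: "0 \<le> c" using K0_nonneg by (simp add: c_def)
  \<comment> \<open>Chosen so that the uniform bound \<open>c * \<delta> powr (1 / r)\<close> is at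
    most half of \<epsilon>.\<close>
  define \<delta> where "\<delta> = (\<epsilon> / 2 / (c + 1)) powr r"
  have \<delta>: "0 < \<delta>" using \<epsilon> c by (simp add: \<delta>_def)
  define B where "B k = {x. norm (b x) \<le> real k} \<inter> cball 0 (real k)" for k :: nat
  have cb [measurable]: "cball 0 (real k) \<in> sets (lebesgue :: (real ^ 'n) measure)" for k by simp
  have Bm [measurable]: "B k \<in> sets lebesgue" for k
  proof -
    have "{x \<in> space lebesgue. norm (b x) \<le> real k} \<in> sets lebesgue" by measurable
    then show ?thesis unfolding B_def by (intro sets.Int cb) simp
  qed
  define b1 where "b1 k x = indicat_real (B k) x *\<^sub>R b x" for k x
  define b2 where "b2 k x = indicat_real (- B k) x *\<^sub>R b x" for k x
  have b12: "b x = b1 k x + b2 k x" for k x by (auto simp: b1_def b2_def indicator_def)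
  have m1 [measurable]: "b1 k \<in> borel_measurable lebesgue" "b2 k \<in> borel_measurable lebesgue" for k
    unfolding b1_def b2_def by measurable
  have bc: "cube_finite (\<lambda>x. norm (b x))" using b(1) by (simp add: cube_integrable_def)
  have c1: "cube_integrable (b1 k)" "cube_integrable (b2 k)" for k
    unfolding cube_integrable_def
    by (auto intro!: cube_finite_bound[OF bc, of _ 1] simp: b1_def b2_def indicator_def)
  \<comment> \<open>Dominated convergence: each x lies in \<open>B k\<close> for all large k, and
    there \<open>b2 k\<close> vanishes.\<close>
  have "(\<lambda>k. \<integral>\<^sup>+x. ennreal (norm (b2 k x) powr r * \<nu> x powr (1 - r)) \<partial>lebesgue) \<longlonglongrightarrow> (\<integral>\<^sup>+x. (0 :: ennreal) \<partial>(lebesgue :: (real ^ 'n) measure))"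
  proof (rule nn_integral_dominated_convergence[where w = "\<lambda>x. ennreal (norm (b x) powr r * \<nu> x powr (1 - r))"])
    show "AE x in lebesgue. (\<lambda>k. ennreal (norm (b2 k x) powr r * \<nu> x powr (1 - r))) \<longlonglongrightarrow> 0"
    proof (rule AE_I2)
      fix x :: "real ^ 'n"
      obtain k0 :: nat where k0: "max (norm (b x)) (norm x) \<le> real k0" using real_arch_simple by blast
      have "\<forall>\<^sub>F k in sequentially. ennreal (norm (b2 k x) powr r * \<nu> x powr (1 - r)) = 0"
        using eventually_ge_at_top[of k0]
      proof eventually_elim
        case (elim k)
        then have "real k0 \<le> real k" by simp
        then have "x \<in> B k" using k0 by (simp add: B_def)
        then show ?case by (simp add: b2_def)
      qed
      then show "(\<lambda>k. ennreal (norm (b2 k x) powr r * \<nu> x powr (1 - r))) \<longlonglongrightarrow> 0" by (rule tendsto_eventually)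
    qed
    show "AE x in lebesgue. ennreal (norm (b2 k x) powr r * \<nu> x powr (1 - r)) \<le> ennreal (norm (b x) powr r * \<nu> x powr (1 - r))" for k
      using exponents(1) by (intro AE_I2 ennreal_leI mult_right_mono powr_mono2) (auto simp: b2_def indicator_def)
  qed (use b(2) in auto)
  then have "(\<lambda>k. \<integral>\<^sup>+x. ennreal (norm (b2 k x) powr r * \<nu> x powr (1 - r)) \<partial>lebesgue) \<longlonglongrightarrow> 0" by simp
  then have "\<forall>\<^sub>F k in sequentially. (\<integral>\<^sup>+x. ennreal (norm (b2 k x) powr r * \<nu> x powr (1 - r)) \<partial>lebesgue) < ennreal \<delta>"
    using \<delta> by (intro order_tendstoD) auto
  then have "\<exists>k. (\<integral>\<^sup>+x. ennreal (norm (b2 k x) powr r * \<nu> x powr (1 - r)) \<partial>lebesgue) < ennreal \<delta>"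
    by (rule eventually_happens'[OF sequentially_bot])
  then obtain k where "(\<integral>\<^sup>+x. ennreal (norm (b2 k x) powr r * \<nu> x powr (1 - r)) \<partial>lebesgue) < ennreal \<delta>"
    by (rule exE)
  note k = less_imp_le[OF this]
  define E where "E = (real k)\<^sup>2 * measure lebesgue (cball (0 :: real ^ 'n) (real k))"
  have E: "(\<integral>\<^sup>+x. ennreal ((norm (b1 k x))\<^sup>2) \<partial>lebesgue) \<le> ennreal E"
  proof -
    have "(\<integral>\<^sup>+x. ennreal ((norm (b1 k x))\<^sup>2) \<partial>lebesgue) \<le> (\<integral>\<^sup>+x. ennreal ((real k)\<^sup>2) * indicator (cball (0 :: real ^ 'n) (real k)) x \<partial>lebesgue)"
    proof (intro nn_integral_mono)
      fix x :: "real ^ 'n"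
      show "ennreal ((norm (b1 k x))\<^sup>2) \<le> ennreal ((real k)\<^sup>2) * indicator (cball 0 (real k)) x"
        by (cases "x \<in> B k") (auto simp: b1_def B_def intro!: ennreal_leI power_mono)
    qed
    also have "\<dots> = ennreal ((real k)\<^sup>2) * emeasure lebesgue (cball (0 :: real ^ 'n) (real k))"
      by (rule nn_integral_cmult_indicator) simp
    also have "\<dots> = ennreal E"
      using lmeasurable_cball[of "0 :: real ^ 'n" "real k"] by (simp add: E_def emeasure_eq_measure2 ennreal_mult)
    finally show ?thesis .
  qed
  have "para_cauchy (b1 k) f" by (rule para_cauchy_L2[OF c1(1) E _ f]) (simp add: E_def)
  then have "\<exists>F0. finite F0 \<and> F0 \<subseteq> cubes \<and> (\<forall>F. finite F \<longrightarrow> F \<subseteq> cubes \<longrightarrow> F \<inter> F0 = {} \<longrightarrow>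
       (\<integral>\<^sup>+x\<in>K. ennreal (norm (partial_para (b1 k) f F x)) \<partial>lebesgue) \<le> ennreal (\<epsilon> / 2))"
    unfolding para_cauchy_def using K \<epsilon> by simp
  then obtain F0 where F0: "finite F0" "F0 \<subseteq> cubes" "\<forall>F. finite F \<longrightarrow> F \<subseteq> cubes \<longrightarrow> F \<inter> F0 = {} \<longrightarrow>
       (\<integral>\<^sup>+x\<in>K. ennreal (norm (partial_para (b1 k) f F x)) \<partial>lebesgue) \<le> ennreal (\<epsilon> / 2)"
    by (elim exE conjE)
  show "\<exists>F0. finite F0 \<and> F0 \<subseteq> cubes \<and> (\<forall>F. finite F \<longrightarrow> F \<subseteq> cubes \<longrightarrow> F \<inter> F0 = {} \<longrightarrow>
       (\<integral>\<^sup>+x\<in>K. ennreal (norm (partial_para b f F x)) \<partial>lebesgue) \<le> ennreal \<epsilon>)"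
  proof (intro exI[of _ F0] conjI F0(1,2) allI impI)
    fix F assume F: "finite F" "F \<subseteq> cubes" "F \<inter> F0 = {}"
    have Km [measurable]: "K \<in> sets lebesgue" using lmeasurable_compact[OF K] by auto
    have [measurable]: "partial_para b' f F \<in> borel_measurable lebesgue" for b' :: "real ^ 'n \<Rightarrow> 'k"
      by (rule partial_para_measurable[OF F(1,2)])
    have eq: "partial_para b f F x = partial_para (b1 k) f F x + partial_para (b2 k) f F x" for x
    proof -
      have "b = (\<lambda>x. b1 k x + b2 k x)" using b12 by blast
      then show ?thesis using partial_para_add[OF F(2) c1(1)[of k] c1(2)[of k], of f x] by simp
    qed
    have 1: "(\<integral>\<^sup>+x\<in>K. ennreal (norm (partial_para (b1 k) f F x)) \<partial>lebesgue) \<le> ennreal (\<epsilon> / 2)"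
      using F0(3) F by simp
    have "(\<integral>\<^sup>+x\<in>K. ennreal (norm (partial_para (b2 k) f F x)) \<partial>lebesgue)
        \<le> ennreal (K0 * \<delta> powr (1 / r) * Bf powr (1 / p) * wmass \<omega> K powr (1 / s))"
      using \<delta> Bf by (intro para_L1_bound[OF c1(2) k _ fc _ _ F(1,2) K]) auto
    also have "K0 * \<delta> powr (1 / r) * Bf powr (1 / p) * wmass \<omega> K powr (1 / s) = c * (\<epsilon> / 2 / (c + 1))"
      using \<epsilon> c exponents(1) by (simp add: c_def \<delta>_def powr_powr)
    also have "ennreal \<dots> \<le> ennreal (\<epsilon> / 2)"
      using \<epsilon> c by (intro ennreal_leI) (simp add: field_simps)
    finally have 2: "(\<integral>\<^sup>+x\<in>K. ennreal (norm (partial_para (b2 k) f F x)) \<partial>lebesgue) \<le> ennreal (\<epsilon> / 2)" .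
    have "(\<integral>\<^sup>+x\<in>K. ennreal (norm (partial_para b f F x)) \<partial>lebesgue) \<le>
      (\<integral>\<^sup>+x. ennreal (norm (partial_para (b1 k) f F x)) * indicator K x + ennreal (norm (partial_para (b2 k) f F x)) * indicator K x \<partial>lebesgue)"
      unfolding eq
      by (intro nn_integral_mono) (auto simp: indicator_def norm_triangle_ineq intro!: ennreal_leI simp flip: ennreal_plus)
    also have "\<dots> = (\<integral>\<^sup>+x\<in>K. ennreal (norm (partial_para (b1 k) f F x)) \<partial>lebesgue) + (\<integral>\<^sup>+x\<in>K. ennreal (norm (partial_para (b2 k) f F x)) \<partial>lebesgue)"
      by (rule nn_integral_add) auto
    also have "\<dots> \<le> ennreal (\<epsilon> / 2) + ennreal (\<epsilon> / 2)" using 1 2 by (rule add_mono)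
    also have "\<dots> = ennreal \<epsilon>" using \<epsilon> by (simp flip: ennreal_plus)
    finally show "(\<integral>\<^sup>+x\<in>K. ennreal (norm (partial_para b f F x)) \<partial>lebesgue) \<le> ennreal \<epsilon>" .
  qed
qed

lemma paraproduct_norm_bound:
  fixes b :: "real ^ 'n \<Rightarrow> 'k :: {real_normed_field, euclidean_space}"
  assumes b: "cube_integrable b" "(\<integral>\<^sup>+x. ennreal (norm (b x) powr r * \<nu> x powr (1 - r)) \<partial>lebesgue) \<le> ennreal (M powr r)" "0 \<le> M"
  shows "paraproduct_norm cubes p \<mu> q lam b \<le> ennreal (K0 * M)"
proof (rule paraproduct_norm_le)
  show "para_cauchy b f" if "f \<in> Linfc" for f
    using b(2) by (intro para_cauchy b(1) that) (auto intro: le_less_trans)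
  show "0 \<le> K0 * M" using K0_nonneg b(3) by simp
  fix f :: "real ^ 'n \<Rightarrow> 'k" and F B
  assume f: "f \<in> Linfc" "finite F" "F \<subseteq> cubes" "0 \<le> B"
    "(\<integral>\<^sup>+x. ennreal (norm (f x) powr p * \<mu> x) \<partial>lebesgue) = ennreal B"
  have "(M powr r) powr (1 / r) = M" using b(3) exponents(1) by (simp add: powr_powr)
  then show "(\<integral>\<^sup>+x. ennreal (norm (partial_para b f F x) powr q * lam x) \<partial>lebesgue) \<le> ennreal ((K0 * M * B powr (1 / p)) powr q)"
    using para_Lq_bound[OF b(1,2) _ Linfc_cube_integrable[OF f(1)] _ f(4,2,3)] f(5) by simp
qed (use pq \<mu>_facts lam_facts cube_finiteD(1) in auto)

end

lemma ennreal_le_mult_Inf: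
  assumes "0 < k" "\<And>y. y \<in> Y \<Longrightarrow> a \<le> ennreal k * y"
  shows "a \<le> ennreal k * Inf Y"
proof -
  have "a / ennreal k \<le> y" if "y \<in> Y" for y
    using assms(2)[OF that] assms(1) by (intro divide_le_posI_ennreal) (auto simp: mult.commute)
  then have "a / ennreal k \<le> Inf Y" by (rule Inf_greatest)
  then have "ennreal k * (a / ennreal k) \<le> ennreal k * Inf Y" by (rule mult_left_mono) simp
  moreover have "ennreal k * (a / ennreal k) = a"
    using assms(1) by (simp add: ennreal_times_divide mult_divide_eq_ennreal mult.commute)
  ultimately show ?thesis by simp
qed

section \<open>Invariance under constants, and positivity of the characteristics\<close>

context dyadic begin

lemma ex_cube: "\<exists>Q. Q \<in> cubes"
  using level_cover level_cubes by blast

text \<open>The series sees its symbol only through the martingale differences. The predicates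
  \<open>has_paraproduct\<close> then coincide, so even the choice made by
  \<open>paraproduct\<close> is the same.\<close>

lemma paraproduct_norm_cong:
  fixes b b' :: "real ^ 'n \<Rightarrow> 'k :: {real_normed_field, euclidean_space}"
  assumes eq: "\<And>Q x. Q \<in> cubes \<Longrightarrow> mart_diff cubes Q b x = mart_diff cubes Q b' x"
  shows "paraproduct_norm cubes p \<mu> q lam b = paraproduct_norm cubes p \<mu> q lam b'"
proof -
  have "has_paraproduct cubes b f g \<longleftrightarrow> has_paraproduct cubes b' f g" for f g
  proof -
    have ev: "\<forall>\<^sub>F F in finite_subsets_at_top cubes.
       (\<integral>\<^sup>+x\<in>K. ennreal (norm ((\<Sum>Q\<in>F. mart_diff cubes Q b x * average Q f) - g x)) \<partial>lebesgue) =
       (\<integral>\<^sup>+x\<in>K. ennreal (norm ((\<Sum>Q\<in>F. mart_diff cubes Q b' x * average Q f) - g x)) \<partial>lebesgue)" for K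
    proof (rule eventually_finite_subsets_at_top_weakI)
      fix F assume "finite F" "F \<subseteq> cubes"
      then have "(\<Sum>Q\<in>F. mart_diff cubes Q b x * average Q f) = (\<Sum>Q\<in>F. mart_diff cubes Q b' x * average Q f)" for x
        using eq by (intro sum.cong) auto
      then show "(\<integral>\<^sup>+x\<in>K. ennreal (norm ((\<Sum>Q\<in>F. mart_diff cubes Q b x * average Q f) - g x)) \<partial>lebesgue) =
       (\<integral>\<^sup>+x\<in>K. ennreal (norm ((\<Sum>Q\<in>F. mart_diff cubes Q b' x * average Q f) - g x)) \<partial>lebesgue)" by simp
    qed
    show ?thesis unfolding has_paraproduct_def using tendsto_cong[OF ev] by simp
  qed
  then have "has_paraproduct cubes b = has_paraproduct cubes b'" by (intro ext)
  then show ?thesis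
    unfolding paraproduct_norm_def paraproduct_well_defined_def paraproduct_def[abs_def] by (simp only:)
qed

lemma average_diff_const:
  fixes b :: "real ^ 'n \<Rightarrow> 'k :: euclidean_space"
  assumes b: "cube_integrable b" and Q: "Q \<in> cubes"
  shows "average Q (\<lambda>x. b x - c) = average Q b - c"
proof -
  have "set_integrable lebesgue Q (\<lambda>x. c)"
    using cube_lmeasurable[OF Q] by (auto simp: set_integrable_def fmeasurable_def intro!: integrable_scaleR_left integrable_real_indicator)
  then have "(LINT x:Q|lebesgue. b x - c) = (LINT x:Q|lebesgue. b x) - (LINT x:Q|lebesgue. c)"
    by (rule set_integral_diff(2)[OF cube_integrable_set_integrable[OF b Q]])
  moreover have "(LINT x:Q|lebesgue. c) = vol Q *\<^sub>R c"
  proof -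
    have "(LINT x|lebesgue. indicat_real Q x *\<^sub>R c) = (LINT x|lebesgue. indicat_real Q x) *\<^sub>R c"
      using cube_lmeasurable[OF Q] by (intro integral_scaleR_left) (auto simp: fmeasurable_def)
    then show ?thesis using cube_sets[OF Q] by (simp add: set_lebesgue_integral_def)
  qed
  ultimately show ?thesis using vol_pos[OF Q] by (simp add: average_def scaleR_diff_right)
qed

lemma mart_diff_diff_const:
  fixes b :: "real ^ 'n \<Rightarrow> 'k :: euclidean_space"
  assumes b: "cube_integrable b" and Q: "Q \<in> cubes"
  shows "mart_diff cubes Q (\<lambda>x. b x - c) x = mart_diff cubes Q b x"
  unfolding mart_diff_eq[OF Q] using average_diff_const[OF b] Q ch_cubes by simp

lemma paraproduct_norm_diff_const:
  fixes b :: "real ^ 'n \<Rightarrow> 'k :: {real_normed_field, euclidean_space}"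
  assumes b: "cube_integrable b"
  shows "paraproduct_norm cubes p \<mu> q lam (\<lambda>x. b x - c) = paraproduct_norm cubes p \<mu> q lam b"
  by (intro paraproduct_norm_cong mart_diff_diff_const b)

lemma paraproduct_norm_zero:
  fixes b :: "real ^ 'n \<Rightarrow> 'k :: {real_normed_field, euclidean_space}"
  assumes z: "\<And>Q x. Q \<in> cubes \<Longrightarrow> mart_diff cubes Q b x = 0"
    and "weight \<mu>" "weight lam" "0 < p" "0 < q"
  shows "paraproduct_norm cubes p \<mu> q lam b = 0"
proof -
  have pz: "partial_para b f F x = 0" if "F \<subseteq> cubes" for f F x
    using z that unfolding partial_para_def by (intro sum.neutral) auto
  have "paraproduct_norm cubes p \<mu> q lam b \<le> ennreal 0"
  proof (rule paraproduct_norm_le)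
    show "para_cauchy b f" for f
      unfolding para_cauchy_def by (intro allI impI exI[of _ "{}"]) (auto simp: pz)
  qed (use assms weight_cube_finite cube_finiteD(1) in \<open>auto simp: pz weight_def\<close>)
  then show ?thesis by simp
qed

text \<open>Positivity makes the constant in front of the infimum nonzero, so that it can be divided
  out in \<open>ennreal_le_mult_Inf\<close>.\<close>

lemma Ap_char_pos: assumes w: "weight w" and "1 < p" shows "0 < Ap_char cubes p w"
proof -
  obtain Q where Q: "Q \<in> cubes" using ex_cube by blast
  have wpos: "\<And>x. 0 < w x" using w by (simp add: weight_def)
  note wc = weight_cube_finite[OF w]
  define \<sigma> where "\<sigma> x = w x powr (- conj_exp p / p)" for x
  have [measurable]: "w \<in> borel_measurable lebesgue" using cube_finiteD(1)[OF wc] .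
  have sm [measurable]: "\<sigma> \<in> borel_measurable lebesgue" unfolding \<sigma>_def by measurable
  have "eaverage Q w > 0"
    using eaverage_eq[OF cube_finiteD(1)[OF wc] Q cube_finiteD(2)[OF wc Q]] cube_finite_pos[OF wc wpos Q] vol_pos[OF Q]
    by simp
  moreover have "eaverage Q \<sigma> > 0"
  proof (rule ccontr)
    assume "\<not> ?thesis"
    then have "mass \<sigma> Q = 0" using cube_lmeasurable[OF Q] by (auto simp: eaverage_def fmeasurable_def ennreal_divide_eq_0_iff)
    then have e0: "emeasure (wmeasure \<sigma>) Q = 0" using emeasure_wmeasure[OF sm cube_sets[OF Q]] by simp
    have "AE x in lebesgue. ennreal (\<sigma> x) * indicator Q x = 0"
      using \<open>mass \<sigma> Q = 0\<close> cube_sets[OF Q] unfolding mass_def by (subst (asm) nn_integral_0_iff_AE) auto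
    then have "AE x in lebesgue. x \<notin> Q"
    proof eventually_elim
      case (elim x)
      have "0 < \<sigma> x" using wpos[of x] by (simp add: \<sigma>_def)
      then show ?case using elim by (auto simp: indicator_def ennreal_eq_0_iff split: if_splits)
    qed
    then have "Q \<in> null_sets lebesgue" using AE_iff_null_sets[OF cube_sets[OF Q]] by simp
    then have "emeasure lebesgue Q = 0" by auto
    then show False using vol_pos[OF Q] by (simp add: measure_def)
  qed
  ultimately have "0 < eaverage Q w * epowr (eaverage Q \<sigma>) (p / conj_exp p)"
    by (cases "eaverage Q \<sigma>") (auto simp: epowr_def ennreal_zero_less_mult_iff)
  also have "\<dots> \<le> Ap_char cubes p w" unfolding Ap_char_def \<sigma>_def by (intro SUP_upper Q)
  finally show ?thesis .
qed

lemma Ainf_char_pos: assumes w: "cube_finite w" "\<And>x. 0 < w x" shows "0 < Ainf_char cubes w"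
proof -
  obtain Q where Q: "Q \<in> cubes" using ex_cube by blast
  define a where "a = mass w Q / emeasure lebesgue Q"
  have V: "mass w Q = ennreal (wmass w Q)" "0 < wmass w Q"
    using cube_finiteD(6)[OF w(1) Q] cube_finite_pos[OF w Q] by auto
  have e: "emeasure lebesgue Q = ennreal (vol Q)" using cube_lmeasurable[OF Q] by (simp add: emeasure_eq_measure2)
  have a: "0 < a" using V vol_pos[OF Q] by (simp add: a_def e divide_ennreal)
  have "0 < a * emeasure lebesgue Q / mass w Q"
    using a V vol_pos[OF Q] by (auto simp: e ennreal_zero_less_mult_iff ennreal_zero_less_divide)
  also have "\<dots> = (\<integral>\<^sup>+x. a * indicator Q x \<partial>lebesgue) / mass w Q"
    using cube_sets[OF Q] by (simp add: nn_integral_cmult_indicator)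
  also have "\<dots> \<le> (\<integral>\<^sup>+x\<in>Q. (SUP R\<in>{R \<in> cubes. x \<in> R \<and> R \<subseteq> Q}. mass w R / emeasure lebesgue R) \<partial>lebesgue) / mass w Q"
  proof (intro divide_right_mono_ennreal nn_integral_mono)
    fix x
    show "a * indicator Q x \<le> (SUP R\<in>{R \<in> cubes. x \<in> R \<and> R \<subseteq> Q}. mass w R / emeasure lebesgue R) * indicator Q x"
    proof (cases "x \<in> Q")
      case True
      have "a \<le> (SUP R\<in>{R \<in> cubes. x \<in> R \<and> R \<subseteq> Q}. mass w R / emeasure lebesgue R)"
        unfolding a_def using True Q by (intro SUP_upper) auto
      then show ?thesis using True by simp
    qed simp
  qed
  also have "\<dots> \<le> Ainf_char cubes w" unfolding Ainf_char_def using Q by (intro SUP_upper)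
  finally show ?thesis .
qed

end

context weight_pair begin

text \<open>Hoelder on one cube: a symbol whose distance to c is small in the norm of order r has
  its average over Q close to c. It serves the degenerate case in which the infimum over c is
  0.\<close>

lemma average_close:
  fixes b :: "real ^ 'n \<Rightarrow> 'k :: euclidean_space"
  assumes b: "cube_integrable b" and M: "0 \<le> M"
    and le: "(\<integral>\<^sup>+x. ennreal (norm (b x - c) powr r * \<nu> x powr (1 - r)) \<partial>lebesgue) \<le> ennreal (M powr r)"
    and bc: "cube_integrable (\<lambda>x. b x - c)" and Q: "Q \<in> cubes"
  shows "norm (average Q b - c) \<le> M * (wmass \<nu> Q powr (1 - 1 / r) / vol Q)"
proof -
  define a where "a x = norm (b x - c) powr r * \<nu> x powr (1 - r)" for x
  have [measurable]: "\<nu> \<in> borel_measurable lebesgue" "(\<lambda>x. b x - c) \<in> borel_measurable lebesgue"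
    using cube_finiteD(1)[OF \<nu>_facts] bc by (auto simp: cube_integrable_def)
  have am: "a \<in> borel_measurable lebesgue" unfolding a_def by measurable
  have "emeasure (wmeasure a) Q \<le> emeasure (wmeasure a) UNIV" by (intro emeasure_mono) auto
  also have "\<dots> \<le> ennreal (M powr r)" using le by (subst emeasure_wmeasure[OF am]) (auto simp: mass_def a_def)
  finally have 1: "emeasure (wmeasure a) Q \<le> ennreal (M powr r)" .
  then have 2: "emeasure (wmeasure a) Q < top" by (auto intro: le_less_trans)
  then have 3: "wmass a Q \<le> M powr r" using 1 emeasure_wmeasure_eq_measure[OF 2] by simp
  have "wmass (\<lambda>x. norm (b x - c)) Q \<le> wmass a Q powr (1 / r) * wmass \<nu> Q powr (1 - 1 / r)"
  proof (rule wmeasure_holder(3)[OF am])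
    fix x
    have "a x powr (1 / r) * \<nu> x powr (1 - 1 / r) = norm (b x - c) * (\<nu> x powr ((1 - r) / r) * \<nu> x powr (1 - 1 / r))"
      using exponents(1) by (simp add: a_def powr_mult powr_powr)
    also have "\<nu> x powr ((1 - r) / r) * \<nu> x powr (1 - 1 / r) = 1"
      using exponents(1) \<nu>(1)[of x] by (simp add: diff_divide_distrib flip: powr_add)
    finally show "norm (b x - c) \<le> a x powr (1 / r) * \<nu> x powr (1 - 1 / r)" by simp
  qed (use exponents(1) \<nu>(1) cube_sets[OF Q] cube_finiteD(2)[OF \<nu>_facts Q] 2 in \<open>auto simp: a_def less_imp_le\<close>)
  also have "\<dots> \<le> (M powr r) powr (1 / r) * wmass \<nu> Q powr (1 - 1 / r)"
    using 3 exponents(1) by (intro mult_right_mono powr_mono2) auto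
  also have "(M powr r) powr (1 / r) = M" using M exponents(1) by (simp add: powr_powr)
  finally have "wmass (\<lambda>x. norm (b x - c)) Q / vol Q \<le> M * wmass \<nu> Q powr (1 - 1 / r) / vol Q"
    using vol_pos[OF Q] by (simp add: divide_right_mono)
  then show ?thesis using norm_average_le[OF bc Q] average_diff_const[OF b Q, of c] by simp
qed

lemma mult_norm_lower_weights:
  fixes b :: "real ^ 'n \<Rightarrow> 'k :: {real_normed_field, euclidean_space}"
  assumes "h \<in> borel_measurable lebesgue" "0 \<le> M"
    "\<forall>f\<in>Lp p \<mu>. Lp_norm q lam (\<lambda>x. h x * f x) \<le> ennreal M * Lp_norm p \<mu> (f :: real ^ 'n \<Rightarrow> 'k)"
  shows "(\<integral>\<^sup>+x. ennreal (norm (h x) powr r * \<nu> x powr (1 - r)) \<partial>lebesgue) \<le> ennreal (M powr r)"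
proof (rule mult_norm_lower[OF pq exponents(6) assms(1) _ _ _ \<mu>_facts(2) lam_facts(2) \<nu>(1)])
  show "\<nu> x powr (1 - 1 / r) = \<mu> x powr (1 / p) * lam x powr (- 1 / q)" for x
    using \<nu>(2)[of x] exponents(7) by simp
qed (use assms cube_finiteD(1) \<mu>_facts(1) lam_facts(1) \<nu>_facts in auto)

text \<open>If the infimum I is 0 the paraproduct must vanish; if I > 0 and the A_infinity
  characteristic is infinite the right-hand side is infinite; otherwise the bound for
  \<open>b - c\<close> is applied for each c and the infimum is taken.\<close>

theorem sufficiency:
  fixes b :: "real ^ 'n \<Rightarrow> 'k :: {real_normed_field, euclidean_space}"
  assumes b: "b \<in> L1loc" and A_eq: "Ap_char cubes p \<mu> = ennreal A" and L_eq: "Ap_char cubes q lam = ennreal L"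
  shows "paraproduct_norm cubes p \<mu> q lam b
          \<le> ennreal (form_const r p s CARD('n)) * epowr (Ap_char cubes p \<mu>) (1 / (p - 1)) * Ap_char cubes q lam
              * epowr (Ainf_char cubes \<nu>) (1 / q - 1 / p)
              * (INF c. mult_norm p \<mu> q lam (\<lambda>x. b x - c))"
proof -
  define I where "I = (INF c. mult_norm p \<mu> q lam (\<lambda>x. b x - c))"
  define k where "k = form_const r p s CARD('n) * A powr (1 / (p - 1)) * L"
  have k: "0 < k" using form_const_pos[OF exponents(1-3)] A L by (simp add: k_def)
  have keq: "ennreal (form_const r p s CARD('n)) * epowr (Ap_char cubes p \<mu>) (1 / (p - 1)) * Ap_char cubes q lam = ennreal k"
    using A L form_const_pos[OF exponents(1-3), of "CARD('n)"]
    by (simp add: A_eq L_eq epowr_def k_def ennreal_mult less_imp_le)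
  have bi: "cube_integrable b" using L1loc_cube_integrable[OF b] .
  have bm [measurable]: "b \<in> borel_measurable lebesgue" using bi by (simp add: cube_integrable_def)
  have bci: "cube_integrable (\<lambda>x. b x - c)" for c
  proof -
    have "cube_finite (\<lambda>x. norm (b x) + norm c)"
      unfolding cube_finite_def
    proof (intro conjI ballI)
      fix Q assume Q: "Q \<in> cubes"
      have [measurable]: "Q \<in> sets lebesgue" using cube_sets[OF Q] .
      have "mass (\<lambda>x. norm (b x) + norm c) Q =
         (\<integral>\<^sup>+x. ennreal (norm (b x)) * indicator Q x + ennreal (norm c) * indicator Q x \<partial>lebesgue)"
        unfolding mass_def by (intro nn_integral_cong) (auto simp: indicator_def)
      also have "\<dots> = mass (\<lambda>x. norm (b x)) Q + ennreal (norm c) * emeasure lebesgue Q"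
        unfolding mass_def by (subst nn_integral_add) (auto simp: nn_integral_cmult_indicator)
      also have "\<dots> < top"
        using cube_finiteD(6)[OF bi[unfolded cube_integrable_def, THEN conjunct2] Q] cube_lmeasurable[OF Q]
        by (auto simp: ennreal_mult_less_top fmeasurable_def)
      finally show "emeasure (wmeasure (\<lambda>x. norm (b x) + norm c)) Q < top" by (subst emeasure_wmeasure) auto
    qed auto
    then have "cube_finite (\<lambda>x. norm (b x - c))"
      by (rule cube_finite_bound[of _ _ 1]) (auto simp: norm_triangle_ineq4)
    then show ?thesis by (auto simp: cube_integrable_def)
  qed
  have lower: "(\<integral>\<^sup>+x. ennreal (norm (b x - c) powr r * \<nu> x powr (1 - r)) \<partial>lebesgue) \<le> ennreal (M powr r)"
    if "0 \<le> M" "\<forall>f\<in>Lp p \<mu>. Lp_norm q lam (\<lambda>x. (b x - c) * f x) \<le> ennreal M * Lp_norm p \<mu> (f :: real ^ 'n \<Rightarrow> 'k)" for c M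
    using that by (intro mult_norm_lower_weights) auto
  have mn: "mult_norm p \<mu> q lam (\<lambda>x. b x - c) = Inf {ennreal N | N. 0 \<le> N \<and> (\<forall>f\<in>Lp p \<mu>. Lp_norm q lam (\<lambda>x. (b x - c) * f x) \<le> ennreal N * Lp_norm p \<mu> f)}" for c
    by (simp add: mult_norm_def op_norm_def)
  have X: "0 < Ainf_char cubes \<nu>" using Ainf_char_pos \<nu>_facts \<nu>(1) by blast
  have "paraproduct_norm cubes p \<mu> q lam b \<le> ennreal k * epowr (Ainf_char cubes \<nu>) (1 / q - 1 / p) * I"
  proof (cases "I = 0")
    case True
    \<comment> \<open>Here the right-hand side is 0 even if the \<open>A\<^sub>\<infinity>\<close> characteristic is infinite.\<close>
    have close: "\<exists>c. \<forall>Q\<in>cubes. norm (average Q b - c) \<le> e * (wmass \<nu> Q powr (1 - 1 / r) / vol Q)" if "0 < e" for e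
    proof -
      have "I < ennreal e" using True that by simp
      then obtain c where "mult_norm p \<mu> q lam (\<lambda>x. b x - c) < ennreal e" unfolding I_def INF_less_iff by blast
      then obtain M where M: "0 \<le> M" "ennreal M < ennreal e"
        "\<forall>f\<in>Lp p \<mu>. Lp_norm q lam (\<lambda>x. (b x - c) * f x) \<le> ennreal M * Lp_norm p \<mu> (f :: real ^ 'n \<Rightarrow> 'k)"
        unfolding mn Inf_less_iff by auto
      have "norm (average Q b - c) \<le> e * (wmass \<nu> Q powr (1 - 1 / r) / vol Q)" if Q: "Q \<in> cubes" for Q
      proof -
        have "norm (average Q b - c) \<le> M * (wmass \<nu> Q powr (1 - 1 / r) / vol Q)"
          by (rule average_close[OF bi M(1) lower[OF M(1,3)] bci Q])
        also have "\<dots> \<le> e * (wmass \<nu> Q powr (1 - 1 / r) / vol Q)"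
          using M(1,2) by (intro mult_right_mono) (auto simp: ennreal_less_iff)
        finally show ?thesis .
      qed
      then show ?thesis by blast
    qed
    \<comment> \<open>For each e both averages lie near the same constant c, at a distance
      proportional to e, so they cannot differ. Hence every martingale difference of b
      vanishes.\<close>
    have same: "average Q b = average R b" if Q: "Q \<in> cubes" and R: "R \<in> cubes" for Q R
    proof (rule ccontr)
      assume ne: "average Q b \<noteq> average R b"
      define d where "d = norm (average Q b - average R b)"
      define m where "m P = wmass \<nu> P powr (1 - 1 / r) / vol P" for P
      have d: "0 < d" using ne by (simp add: d_def)
      have m: "0 \<le> m P" for P by (simp add: m_def)
      define e where "e = d / 2 / (m Q + m R + 1)"
      have e: "0 < e" using d m[of Q] m[of R] by (simp add: e_def)
      obtain c where c: "\<forall>P\<in>cubes. norm (average P b - c) \<le> e * m P" using close[OF e] unfolding m_def by (rule exE)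
      have "d \<le> norm (average Q b - c) + norm (average R b - c)"
        unfolding d_def using norm_triangle_ineq4[of "average Q b - c" "average R b - c"] by simp
      also have "\<dots> \<le> e * m Q + e * m R" using c Q R by (intro add_mono) auto
      also have "\<dots> \<le> e * (m Q + m R + 1)" using e by (simp add: algebra_simps)
      also have "\<dots> = d / 2"
      proof -
        define X where "X = m Q + m R + 1"
        have "X \<noteq> 0" using m[of Q] m[of R] unfolding X_def by linarith
        then show ?thesis unfolding e_def X_def[symmetric] by simp
      qed
      finally show False using d by simp
    qed
    have "mart_diff cubes Q b x = 0" if Q: "Q \<in> cubes" for Q x
      unfolding mart_diff_eq[OF Q] using same[OF _ Q] ch_cubes by (intro sum.neutral) simp
    then have "paraproduct_norm cubes p \<mu> q lam b = 0"
      using weights pq by (intro paraproduct_norm_zero) auto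
    then show ?thesis by simp
  next
    case False
    show ?thesis
    proof (cases "Ainf_char cubes \<nu>")
      case top
      then show ?thesis using False k by (simp add: epowr_def ennreal_mult_top ennreal_top_mult)
    next
      case (real N)
      then have N: "0 < N" using X by auto
      interpret two_weight D p q r s \<mu> lam \<nu> \<sigma> \<omega> A L N
        by standard (use real N in auto)
      have K0: "0 < K0" using k N by (simp add: K0_def k_def)
      have bnd: "paraproduct_norm cubes p \<mu> q lam b \<le> ennreal K0 * mult_norm p \<mu> q lam (\<lambda>x. b x - c)" for c
        unfolding mn
      proof (rule ennreal_le_mult_Inf[OF K0])
        fix y assume "y \<in> {ennreal N | N. 0 \<le> N \<and> (\<forall>f\<in>Lp p \<mu>. Lp_norm q lam (\<lambda>x. (b x - c) * f x) \<le> ennreal N * Lp_norm p \<mu> f)}"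
        then obtain M where M: "0 \<le> M" "y = ennreal M"
          "\<forall>f\<in>Lp p \<mu>. Lp_norm q lam (\<lambda>x. (b x - c) * f x) \<le> ennreal M * Lp_norm p \<mu> (f :: real ^ 'n \<Rightarrow> 'k)" by auto
        have "paraproduct_norm cubes p \<mu> q lam (\<lambda>x. b x - c) \<le> ennreal (K0 * M)"
          by (rule paraproduct_norm_bound[OF bci lower[OF M(1,3)] M(1)])
        then show "paraproduct_norm cubes p \<mu> q lam b \<le> ennreal K0 * y"
          using M K0 by (simp add: paraproduct_norm_diff_const[OF bi] ennreal_mult)
      qed
      have "paraproduct_norm cubes p \<mu> q lam b \<le> ennreal K0 * I"
        unfolding I_def by (rule ennreal_le_mult_Inf[OF K0]) (use bnd in auto)
      also have "ennreal K0 = ennreal k * epowr (Ainf_char cubes \<nu>) (1 / q - 1 / p)"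
        using real N k exponents(6) by (simp add: epowr_def K0_def k_def ennreal_mult)
      finally show ?thesis .
    qed
  qed
  then show ?thesis unfolding keq I_def .
qed

end

section \<open>Non-necessity\<close>

text \<open>
  The weight blows up along a nested chain of cubes, fast enough that multiplication by the indicator
  of the top cube is unbounded, and slowly enough to be a dyadic \<open>A\<^sub>1\<close> weight.
\<close>

locale chain_weight = dyadic D for D :: "int \<Rightarrow> (real ^ 'n) set set" +
  fixes P :: "nat \<Rightarrow> (real ^ 'n) set" and \<theta> :: real
  assumes P0: "P 0 \<in> cubes" and P_Suc: "\<And>j. P (Suc j) \<in> ch (P j)" and \<theta>: "1 < \<theta>" "\<theta> < 2 ^ CARD('n)"
begin

text \<open>The ratio of consecutive layer masses \<open>\<theta> ^ j * vol (P j)\<close>.\<close>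

definition \<rho> :: real where "\<rho> = \<theta> / 2 ^ CARD('n)"

lemma \<rho>: "0 < \<rho>" "\<rho> < 1"
  using \<theta> by (auto simp: \<rho>_def)

lemma P_cube: "P j \<in> cubes"
  using P0 P_Suc ch_cubes by (cases j) auto

lemma P_lev: "lev (P j) = lev (P 0) + int j"
  by (induction j) (use ch_lev[OF P_cube P_Suc] in auto)

lemma P_vol: "vol (P 0) = (2 ^ CARD('n)) ^ j * vol (P j)"
proof (induction j)
  case (Suc j)
  also have "vol (P j) = 2 ^ CARD('n) * vol (P (Suc j))" by (rule vol_ch[OF P_cube P_Suc])
  finally show ?case by (simp only: power_Suc mult_ac)
qed simp

lemma P_mono: "i \<le> j \<Longrightarrow> P j \<subseteq> P i"
  by (induction rule: dec_induct) (use ch_sub[OF P_cube P_Suc] in auto)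

section \<open>The chain weight satisfies a dyadic A_1 condition\<close>

definition W :: "real ^ 'n \<Rightarrow> ennreal" where
  "W x = 1 + (\<Sum>j. ennreal (\<theta> ^ j) * indicator (P j) x)"

text \<open>
  On the null set where \<open>W\<close> is infinite \<open>enn2real\<close> returns 0; the maximum keeps the weight positive there.
\<close>

definition wt :: "real ^ 'n \<Rightarrow> real" where
  "wt x = max 1 (enn2real (W x))"

lemma W_measurable [measurable]: "W \<in> borel_measurable lebesgue"
proof -
  have [measurable]: "P j \<in> sets lebesgue" for j using P_cube cube_sets by auto
  show ?thesis unfolding W_def by measurable
qed

lemma wt_measurable [measurable]: "wt \<in> borel_measurable lebesgue"
  unfolding wt_def by measurable

lemma wt_ge_1: "1 \<le> wt x"
  by (simp add: wt_def)

lemma wt_le_W: "ennreal (wt x) \<le> W x"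
proof (cases "W x")
  case (real a)
  have "1 \<le> W x" by (simp add: W_def)
  then have "1 \<le> a" using real by (simp add: ennreal_1[symmetric] del: ennreal_1)
  then show ?thesis using real by (simp add: wt_def)
qed simp

text \<open>Off the null intersection of the chain only finitely many layers are active, so
  \<open>W x\<close> is finite and \<open>enn2real\<close> keeps its value.\<close>

lemma wt_ge:
  assumes x: "\<exists>J. x \<notin> P J" and S: "finite S" "\<And>j. j \<in> S \<Longrightarrow> x \<in> P j"
  shows "1 + (\<Sum>j\<in>S. \<theta> ^ j) \<le> wt x"
proof -
  obtain J where J: "x \<notin> P J" using x by auto
  have "x \<notin> P j" if "J \<le> j" for j using J P_mono[OF that] by auto
  then have "(\<Sum>j. ennreal (\<theta> ^ j) * indicator (P j) x) = (\<Sum>j<J. ennreal (\<theta> ^ j) * indicator (P j) x)"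
    by (intro suminf_finite) (auto simp: not_less)
  also have "\<dots> < top" by (auto simp: ennreal_mult_less_top indicator_def)
  finally have fin: "W x < top" by (simp add: W_def)
  have "ennreal (1 + (\<Sum>j\<in>S. \<theta> ^ j)) = 1 + (\<Sum>j\<in>S. ennreal (\<theta> ^ j) * indicator (P j) x)"
    using S \<theta> by (simp add: sum_nonneg)
  also have "\<dots> \<le> W x" unfolding W_def using S(1) by (intro add_left_mono sum_le_suminf) auto
  finally have le: "ennreal (1 + (\<Sum>j\<in>S. \<theta> ^ j)) \<le> W x" .
  obtain a where a: "0 \<le> a" "W x = ennreal a" using fin by (cases "W x") auto
  have "1 + (\<Sum>j\<in>S. \<theta> ^ j) \<le> a" using le a by (simp add: ennreal_le_iff)
  then show ?thesis using a by (simp add: wt_def)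
qed

lemma chain_limit_null: "AE x in lebesgue. \<exists>J. x \<notin> P J"
proof -
  have Ps: "P j \<in> sets lebesgue" for j using P_cube cube_sets by auto
  have small: "emeasure lebesgue (\<Inter>j. P j) \<le> ennreal e" if e: "0 < e" for e
  proof -
    obtain j where j: "vol (P 0) / e < (2 ^ CARD('n)) ^ j"
      using real_arch_pow[of "2 ^ CARD('n)" "vol (P 0) / e"] by auto
    then have "(2 ^ CARD('n)) ^ j * vol (P j) < (2 ^ CARD('n)) ^ j * e"
      using e by (subst P_vol[of j, symmetric]) (simp add: pos_divide_less_eq)
    then have "vol (P j) < e" by simp
    have "emeasure lebesgue (\<Inter>j. P j) \<le> emeasure lebesgue (P j)" using Ps by (intro emeasure_mono) auto
    also have "\<dots> = ennreal (vol (P j))" using cube_lmeasurable[OF P_cube] by (simp add: emeasure_eq_measure2)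
    also have "\<dots> \<le> ennreal e" using \<open>vol (P j) < e\<close> by (intro ennreal_leI) simp
    finally show ?thesis .
  qed
  have "emeasure lebesgue (\<Inter>j. P j) \<le> 0"
  proof (rule ennreal_le_epsilon)
    fix e :: real assume "0 < e"
    from small[OF this] show "emeasure lebesgue (\<Inter>j. P j) \<le> 0 + ennreal e" by simp
  qed
  then have "(\<Inter>j. P j) \<in> null_sets lebesgue" using Ps by (intro null_setsI) auto
  then have "AE x in lebesgue. x \<notin> (\<Inter>j. P j)" by (rule AE_not_in)
  then show ?thesis by eventually_elim auto
qed

text \<open>The sum of the layers present on all of Q. It bounds \<open>wt\<close> from below almost
  everywhere on Q and plays the role of the essential infimum in the A_1 condition.\<close>

definition low :: "(real ^ 'n) set \<Rightarrow> real" where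
  "low Q = 1 + (\<Sum>j | Q \<subseteq> P j. \<theta> ^ j)"

lemma finite_above: assumes "Q \<in> cubes" shows "finite {j. Q \<subseteq> P j}"
proof -
  have "j \<le> nat (lev Q - lev (P 0))" if "Q \<subseteq> P j" for j
    using cube_lev_mono[OF P_cube assms that] P_lev[of j] by linarith
  then have "{j. Q \<subseteq> P j} \<subseteq> {..nat (lev Q - lev (P 0))}" by auto
  then show ?thesis by (rule finite_subset) simp
qed

lemma low_ge_1: "1 \<le> low Q"
  using \<theta> by (simp add: low_def sum_nonneg)

lemma low_ge: assumes "Q \<in> cubes" "Q \<subseteq> P j" shows "\<theta> ^ j \<le> low Q"
proof -
  have "\<theta> ^ j \<le> (\<Sum>j | Q \<subseteq> P j. \<theta> ^ j)"
    using finite_above[OF assms(1)] assms(2) \<theta> by (intro member_le_sum) auto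
  then show ?thesis by (simp add: low_def)
qed

lemma wt_ge_low: assumes "Q \<in> cubes" "x \<in> Q" "\<exists>J. x \<notin> P J" shows "low Q \<le> wt x"
  unfolding low_def using assms finite_above by (intro wt_ge) auto

text \<open>The A_1 constant of the weight: 1 for the layers containing Q, and the geometric series
  of ratio \<rho> for those inside.\<close>

definition CA :: real where "CA = 1 + 1 / (1 - \<rho>)"

lemma CA_pos: "0 < CA"
  using \<rho> by (simp add: CA_def add_pos_pos)

text \<open>The layers over Q contribute \<open>low Q * vol Q\<close>, counting the constant 1.
  Those strictly inside Q decay geometrically with ratio \<rho> from a first term of at most
  \<open>low Q * vol Q\<close>.\<close>

lemma mass_wt_le:
  assumes Q: "Q \<in> cubes" shows "mass wt Q \<le> ennreal (CA * low Q * vol Q)"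
proof -
  have Ps [measurable]: "P j \<in> sets lebesgue" for j using P_cube cube_sets by auto
  have Qs [measurable]: "Q \<in> sets lebesgue" using cube_sets[OF Q] .
  \<comment> \<open>The index of the first chain cube whose generation is at least that of Q;
    \<open>nat\<close> gives 0 when Q has an earlier generation than \<open>P 0\<close>.\<close>
  define k where "k = nat (lev Q - lev (P 0))"
  define a where "a j = (if k \<le> j then \<rho> ^ (j - k) else 0)" for j
  define u where "u j = (if j \<in> {j. Q \<subseteq> P j} then \<theta> ^ j * vol Q else 0) + low Q * vol Q * a j" for j
  have a0: "0 \<le> a j" for j using \<rho> by (simp add: a_def)
  have lv: "0 \<le> low Q * vol Q" using low_ge_1[of Q] by simp
  have t: "\<theta> ^ j * vol (P j \<inter> Q) \<le> u j" for j
  proof (cases "Q \<subseteq> P j")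
    case True
    then have "P j \<inter> Q = Q" by auto
    then show ?thesis using True lv a0[of j] by (simp add: u_def)
  next
    case False
    show ?thesis
    proof (cases "P j \<inter> Q = {}")
      case True
      then show ?thesis using lv a0[of j] False by (simp add: u_def)
    next
      case ne: False
      then have sub: "P j \<subset> Q" using cube_nest[OF P_cube Q ne] False by auto
      then have lt: "lev Q < lev (P j)" using cube_lev_less[OF Q P_cube] by blast
      then have kj: "k \<le> j" using P_lev[of j] by (simp add: k_def)
      have th: "\<theta> ^ j * vol (P j) = \<theta> ^ k * \<rho> ^ (j - k) * vol (P k)"
      proof -
        have "(2 ^ CARD('n)) ^ j * vol (P j) = (2 ^ CARD('n)) ^ k * vol (P k)"
          using P_vol[of j] P_vol[of k] by simp
        also have "(2 ^ CARD('n) :: real) ^ j = (2 ^ CARD('n)) ^ k * (2 ^ CARD('n)) ^ (j - k)"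
          using kj by (simp flip: power_add)
        finally have "vol (P k) = (2 ^ CARD('n)) ^ (j - k) * vol (P j)" by simp
        moreover have "\<theta> ^ j = \<theta> ^ k * \<theta> ^ (j - k)" using kj by (simp flip: power_add)
        ultimately show ?thesis by (simp add: \<rho>_def power_divide)
      qed
      \<comment> \<open>Either \<open>P k\<close> has the generation of Q and meets it, hence equals
        Q, or k = 0 and Q contains \<open>P 0\<close>.\<close>
      have "\<theta> ^ k * vol (P k) \<le> low Q * vol Q"
      proof (cases "lev (P 0) \<le> lev Q")
        case True
        then have lk: "lev (P k) = lev Q" using P_lev[of k] by (simp add: k_def)
        have "P j \<subseteq> P k" using P_mono[OF kj] .
        then have "P k \<inter> Q \<noteq> {}" using ne by auto
        then have "P k = Q" using level_disjoint[of "P k" "lev Q" Q] cube_lev[OF P_cube[of k]] cube_lev[OF Q] lk by simp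
        then show ?thesis using low_ge[OF Q, of k] vol_pos[OF Q] by (simp add: mult_right_mono)
      next
        case False
        then have k0: "k = 0" by (simp add: k_def)
        have "P 0 \<inter> Q \<noteq> {}" using P_mono[of 0 j] ne by auto
        then have "P 0 \<subseteq> Q"
          using level_nest[OF cube_lev[OF Q] cube_lev[OF P0]] False by auto
        then have "vol (P 0) \<le> vol Q" using cube_lmeasurable[OF Q] P_cube cube_sets by (intro measure_mono_fmeasurable) auto
        also have "\<dots> \<le> low Q * vol Q" using low_ge_1[of Q] vol_pos[OF Q] by simp
        finally show ?thesis by (simp add: k0)
      qed
      then have "\<rho> ^ (j - k) * (\<theta> ^ k * vol (P k)) \<le> \<rho> ^ (j - k) * (low Q * vol Q)"
        using \<rho> by (intro mult_left_mono) auto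
      moreover have "P j \<inter> Q = P j" using sub by auto
      ultimately show ?thesis using th kj False by (simp add: u_def a_def mult_ac)
    qed
  qed
  have asum: "a sums (1 / (1 - \<rho>))"
  proof -
    have "(\<lambda>j. a (j + k)) sums (1 / (1 - \<rho>))" using geometric_sums[of \<rho>] \<rho> by (simp add: a_def)
    then show ?thesis by (subst (asm) sums_zero_iff_shift) (auto simp: a_def)
  qed
  have usum: "u sums ((\<Sum>j | Q \<subseteq> P j. \<theta> ^ j * vol Q) + low Q * vol Q * (1 / (1 - \<rho>)))"
    unfolding u_def by (intro sums_add sums_mult asum sums_If_finite_set finite_above Q)
  have "(\<Sum>j | Q \<subseteq> P j. \<theta> ^ j * vol Q) + low Q * vol Q * (1 / (1 - \<rho>)) = CA * low Q * vol Q - vol Q"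
  proof -
    have "(\<Sum>j | Q \<subseteq> P j. \<theta> ^ j * vol Q) = (low Q - 1) * vol Q" by (simp add: low_def sum_distrib_right)
    then show ?thesis by (simp add: CA_def algebra_simps)
  qed
  then have usum: "u sums (CA * low Q * vol Q - vol Q)" using usum by simp
  have u0: "0 \<le> u j" for j using t[of j] \<theta> by (meson measure_nonneg mult_nonneg_nonneg order_trans zero_le_power less_imp_le zero_less_one)
  have "mass wt Q \<le> (\<integral>\<^sup>+x. W x * indicator Q x \<partial>lebesgue)"
    unfolding mass_def by (intro nn_integral_mono mult_right_mono wt_le_W) auto
  also have "\<dots> = (\<integral>\<^sup>+x. indicator Q x + (\<Sum>j. ennreal (\<theta> ^ j) * indicator (P j \<inter> Q) x) \<partial>lebesgue)"
    by (intro nn_integral_cong) (auto simp: W_def indicator_def)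
  also have "\<dots> = emeasure lebesgue Q + (\<Sum>j. ennreal (\<theta> ^ j) * emeasure lebesgue (P j \<inter> Q))"
    by (subst nn_integral_add) (auto simp: nn_integral_suminf nn_integral_cmult_indicator)
  also have "(\<Sum>j. ennreal (\<theta> ^ j) * emeasure lebesgue (P j \<inter> Q)) \<le> (\<Sum>j. ennreal (u j))"
  proof (intro suminf_le)
    fix j
    have "P j \<inter> Q \<in> lmeasurable" using cube_lmeasurable[OF P_cube[of j]] Qs by (rule fmeasurable_Int_fmeasurable)
    then have "ennreal (\<theta> ^ j) * emeasure lebesgue (P j \<inter> Q) = ennreal (\<theta> ^ j * vol (P j \<inter> Q))"
      using \<theta> by (simp add: emeasure_eq_measure2 ennreal_mult)
    also have "\<dots> \<le> ennreal (u j)" by (intro ennreal_leI t)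
    finally show "ennreal (\<theta> ^ j) * emeasure lebesgue (P j \<inter> Q) \<le> ennreal (u j)" .
  qed auto
  also have "(\<Sum>j. ennreal (u j)) = ennreal (CA * low Q * vol Q - vol Q)"
    by (rule suminf_ennreal_eq[OF u0 usum])
  also have "emeasure lebesgue Q = ennreal (vol Q)" using cube_lmeasurable[OF Q] by (simp add: emeasure_eq_measure2)
  also have "ennreal (vol Q) + ennreal (CA * low Q * vol Q - vol Q) = ennreal (CA * low Q * vol Q)"
  proof -
    have "0 \<le> CA * low Q * vol Q - vol Q"
      by (rule sums_le[OF u0 sums_zero usum])
    then show ?thesis by (simp flip: ennreal_plus)
  qed
  finally show ?thesis by simp
qed

lemma wt_cube_finite: "cube_finite wt"
  unfolding cube_finite_def
proof (intro conjI ballI wt_measurable)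
  fix Q assume Q: "Q \<in> cubes"
  have "mass wt Q < top" using mass_wt_le[OF Q] by (rule le_less_trans) simp
  then show "emeasure (wmeasure wt) Q < top" using emeasure_wmeasure[OF wt_measurable cube_sets[OF Q]] by simp
qed

lemma cube_finite_weight:
  assumes w: "cube_finite w" "\<And>x. 0 < w x" shows "weight w"
  unfolding weight_def L1loc_def
proof (intro conjI CollectI allI impI w(2) cube_finiteD(1)[OF w(1)])
  fix K :: "(real ^ 'n) set" assume K: "compact K"
  have Km [measurable]: "K \<in> sets lebesgue" using lmeasurable_compact[OF K] by auto
  note [measurable] = cube_finiteD(1)[OF w(1)]
  have "(\<integral>\<^sup>+x. ennreal (norm (indicat_real K x *\<^sub>R w x)) \<partial>lebesgue) = emeasure (wmeasure w) K"
    using w(2) by (subst emeasure_wmeasure) (auto simp: mass_def indicator_def less_imp_le intro!: nn_integral_cong)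
  also have "\<dots> < top" by (rule cube_finite_compact[OF w(1) K])
  finally show "set_integrable lebesgue K w" unfolding set_integrable_def by (intro integrableI_bounded) auto
qed

lemma wt_pos: "0 < wt x" using wt_ge_1[of x] by simp

text \<open>A_1 implies A_q with the same constant: \<open>low Q\<close> bounds \<open>wt\<close>
  from below almost everywhere on Q, hence the negative power from above, and it cancels against the
  bound for the mass.\<close>

lemma wt_Ap: assumes q: "1 < q" shows "wt \<in> Ap_weights cubes q"
proof -
  have "eaverage Q wt * epowr (eaverage Q (\<lambda>x. wt x powr (- conj_exp q / q))) (q / conj_exp q) \<le> ennreal CA"
    if Q: "Q \<in> cubes" for Q
  proof -
    have Qs [measurable]: "Q \<in> sets lebesgue" using cube_sets[OF Q] .
    have e: "emeasure lebesgue Q = ennreal (vol Q)" using cube_lmeasurable[OF Q] by (simp add: emeasure_eq_measure2)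
    define l where "l = low Q"
    have l: "1 \<le> l" using low_ge_1 by (simp add: l_def)
    define e where "e = conj_exp q / q"
    have e0: "0 < e" using q by (simp add: e_def conj_exp_def)
    have qe: "q / conj_exp q = 1 / e" by (simp add: e_def)
    have 1: "eaverage Q wt \<le> ennreal (CA * l)"
    proof -
      have "eaverage Q wt \<le> ennreal (CA * l * vol Q) / ennreal (vol Q)"
        unfolding eaverage_def \<open>emeasure lebesgue Q = _\<close> l_def by (intro divide_right_mono_ennreal mass_wt_le Q)
      also have "\<dots> = ennreal (CA * l)" using vol_pos[OF Q] CA_pos l by (simp add: divide_ennreal)
      finally show ?thesis .
    qed
    have "mass (\<lambda>x. wt x powr - e) Q \<le> (\<integral>\<^sup>+x. ennreal (l powr - e) * indicator Q x \<partial>lebesgue)"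
      unfolding mass_def
    proof (rule nn_integral_mono_AE)
      show "AE x in lebesgue. ennreal (wt x powr - e) * indicator Q x \<le> ennreal (l powr - e) * indicator Q x"
        using chain_limit_null
      proof eventually_elim
        case (elim x)
        show ?case
        proof (cases "x \<in> Q")
          case True
          have "wt x powr - e \<le> l powr - e"
            using wt_ge_low[OF Q True elim] l e0 by (intro powr_mono2') (auto simp: l_def)
          then show ?thesis using True by (simp add: ennreal_leI)
        qed simp
      qed
    qed
    also have "\<dots> = ennreal (l powr - e * vol Q)"
      using cube_lmeasurable[OF Q] by (simp add: nn_integral_cmult_indicator emeasure_eq_measure2 ennreal_mult)
    finally have "eaverage Q (\<lambda>x. wt x powr - e) \<le> ennreal (l powr - e * vol Q) / ennreal (vol Q)"
      unfolding eaverage_def \<open>emeasure lebesgue Q = _\<close> by (rule divide_right_mono_ennreal)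
    also have "\<dots> = ennreal (l powr - e)" using vol_pos[OF Q] by (simp add: divide_ennreal)
    finally have 2: "eaverage Q (\<lambda>x. wt x powr - e) \<le> ennreal (l powr - e)" .
    then obtain y where y: "0 \<le> y" "eaverage Q (\<lambda>x. wt x powr - e) = ennreal y" "y \<le> l powr - e"
      by (cases "eaverage Q (\<lambda>x. wt x powr - e)") (auto simp: top_unique)
    have "y powr (1 / e) \<le> (l powr - e) powr (1 / e)" using y e0 by (intro powr_mono2) auto
    also have "\<dots> = l powr - 1" using e0 by (simp add: powr_powr)
    also have "\<dots> = 1 / l" using l by (simp add: powr_minus_divide)
    finally have 3: "epowr (eaverage Q (\<lambda>x. wt x powr - e)) (1 / e) \<le> ennreal (1 / l)"
      unfolding y(2) epowr_def using y(1) by (simp add: ennreal_leI)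
    have "eaverage Q wt * epowr (eaverage Q (\<lambda>x. wt x powr - e)) (1 / e) \<le> ennreal (CA * l) * ennreal (1 / l)"
      using 1 3 by (rule mult_mono) auto
    also have "\<dots> = ennreal CA" using l CA_pos by (simp flip: ennreal_mult)
    finally show ?thesis unfolding qe by (simp add: e_def)
  qed
  then have "Ap_char cubes q wt \<le> ennreal CA" unfolding Ap_char_def by (intro SUP_least)
  then have "Ap_char cubes q wt < top" by (rule le_less_trans) simp
  then show ?thesis
    unfolding Ap_weights_def using cube_finite_weight[OF wt_cube_finite wt_pos] by simp
qed

lemma one_Ap: assumes p: "1 < p" shows "(\<lambda>_. 1) \<in> Ap_weights cubes p"
proof -
  have "eaverage Q (\<lambda>_. 1) = 1" if Q: "Q \<in> cubes" for Q
    using cube_lmeasurable[OF Q] vol_pos[OF Q] by (simp add: eaverage_def mass_def emeasure_eq_measure2 fmeasurableD divide_ennreal)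
  then have "Ap_char cubes p (\<lambda>_. 1) \<le> 1"
    unfolding Ap_char_def by (intro SUP_least) (simp add: epowr_def)
  then have "Ap_char cubes p (\<lambda>_. 1) < top" by (rule le_less_trans) simp
  then show ?thesis unfolding Ap_weights_def using cube_finite_weight[OF cube_finite_one] by simp
qed

section \<open>Multiplication by the indicator minus any constant is unbounded\<close>

definition top_ind :: "real ^ 'n \<Rightarrow> 'k :: {real_normed_field, euclidean_space}" where
  "top_ind x = of_real (indicat_real (P 0) x)"

lemma top_ind_measurable [measurable]: "top_ind \<in> borel_measurable lebesgue"
proof -
  have [measurable]: "P 0 \<in> sets lebesgue" using P_cube cube_sets by auto
  show ?thesis unfolding top_ind_def by measurable
qed

lemma norm_top_ind: "norm (top_ind x) = indicat_real (P 0) x"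
  by (simp add: top_ind_def)

lemma top_ind_L1loc: "(top_ind :: _ \<Rightarrow> 'k :: {real_normed_field, euclidean_space}) \<in> L1loc"
  unfolding L1loc_def
proof (intro CollectI conjI allI impI top_ind_measurable)
  fix K :: "(real ^ 'n) set" assume K: "compact K"
  have [measurable]: "K \<in> sets lebesgue" using lmeasurable_compact[OF K] by auto
  have "(\<integral>\<^sup>+x. ennreal (norm (indicat_real K x *\<^sub>R (top_ind x :: 'k))) \<partial>lebesgue) \<le> (\<integral>\<^sup>+x. indicator K x \<partial>lebesgue)"
    by (intro nn_integral_mono) (auto simp: norm_top_ind indicator_def)
  also have "\<dots> < top" using lmeasurable_compact[OF K] by (simp add: fmeasurable_def)
  finally show "set_integrable lebesgue K (top_ind :: _ \<Rightarrow> 'k)"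
    unfolding set_integrable_def by (intro integrableI_bounded) auto
qed

text \<open>Tests the multiplier on the indicator of E, whose norm in L^p is
  \<open>vol E powr (1 / p)\<close>.\<close>

lemma mult_norm_test:
  fixes h :: "real ^ 'n \<Rightarrow> 'k :: {real_normed_field, euclidean_space}"
  assumes pq: "1 < q" "q < p" and M: "0 \<le> M"
    "\<forall>f\<in>Lp p (\<lambda>_. 1). Lp_norm q wt (\<lambda>x. h x * f x) \<le> ennreal M * Lp_norm p (\<lambda>_. 1) (f :: real ^ 'n \<Rightarrow> 'k)"
    and E: "E \<in> lmeasurable" "0 < vol E" and a: "0 \<le> a" "\<And>x. x \<in> E \<Longrightarrow> a \<le> norm (h x)"
    and l: "0 \<le> l" "\<And>x. x \<in> E \<Longrightarrow> l \<le> wt x"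
  shows "a * l powr (1 / q) * vol E powr (1 / q - 1 / p) \<le> M"
proof -
  have Em [measurable]: "E \<in> sets lebesgue" using E(1) by auto
  have eE: "emeasure lebesgue E = ennreal (vol E)" using E(1) by (simp add: emeasure_eq_measure2)
  define f where "f x = (of_real (indicat_real E x) :: 'k)" for x
  have [measurable]: "f \<in> borel_measurable lebesgue" unfolding f_def by measurable
  have "(\<integral>\<^sup>+x. ennreal (norm (f x) powr p * 1) \<partial>lebesgue) = (\<integral>\<^sup>+x. indicator E x \<partial>lebesgue)"
    using pq by (intro nn_integral_cong) (auto simp: f_def indicator_def)
  then have np: "Lp_norm p (\<lambda>_. 1) f = ennreal (vol E powr (1 / p))"
    by (simp add: Lp_norm_def epowr_def eE)
  then have "f \<in> Lp p (\<lambda>_. 1)" by (simp add: Lp_def)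
  then have le: "Lp_norm q wt (\<lambda>x. h x * f x) \<le> ennreal (M * vol E powr (1 / p))"
    using M np by (auto simp: ennreal_mult)
  define I where "I = (\<integral>\<^sup>+x. ennreal (norm (h x * f x) powr q * wt x) \<partial>lebesgue)"
  have I: "epowr I (1 / q) \<le> ennreal (M * vol E powr (1 / p))" using le by (simp add: Lp_norm_def I_def)
  then have "I \<noteq> top" by (auto simp: epowr_def top_unique)
  then obtain i where i: "0 \<le> i" "I = ennreal i" by (cases I) auto
  have "ennreal (a powr q * l * vol E) = (\<integral>\<^sup>+x. ennreal (a powr q * l) * indicator E x \<partial>lebesgue)"
    using l by (simp add: nn_integral_cmult_indicator eE ennreal_mult)
  also have "\<dots> \<le> I"
    unfolding I_def
  proof (intro nn_integral_mono)
    fix x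
    show "ennreal (a powr q * l) * indicator E x \<le> ennreal (norm (h x * f x) powr q * wt x)"
    proof (cases "x \<in> E")
      case True
      have "a powr q * l \<le> norm (h x) powr q * wt x"
        using a l True pq by (intro mult_mono powr_mono2) auto
      then show ?thesis using True by (simp add: f_def norm_mult ennreal_leI)
    qed simp
  qed
  finally have "a powr q * l * vol E \<le> i" using i by (simp add: ennreal_le_iff)
  then have "(a powr q * l * vol E) powr (1 / q) \<le> i powr (1 / q)"
    using l pq by (intro powr_mono2) auto
  also have "\<dots> \<le> M * vol E powr (1 / p)" using I i M by (simp add: epowr_def)
  finally have "a * l powr (1 / q) * vol E powr (1 / q) \<le> M * vol E powr (1 / p)"
    using a pq by (simp add: powr_mult powr_powr)
  moreover have "vol E powr (1 / q) = vol E powr (1 / q - 1 / p) * vol E powr (1 / p)"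
    by (simp flip: powr_add)
  ultimately have "(a * l powr (1 / q) * vol E powr (1 / q - 1 / p)) * vol E powr (1 / p) \<le> M * vol E powr (1 / p)"
    by (simp add: mult.assoc)
  then show ?thesis using E(2) by simp
qed

lemma mult_norm_infinite:
  fixes c :: "'k :: {real_normed_field, euclidean_space}"
  assumes pq: "1 < q" "q < p" and \<theta>_eq: "\<theta> = (2 ^ CARD('n)) powr (1 - q / (2 * p))"
  shows "mult_norm p (\<lambda>_. 1) q wt (\<lambda>x. top_ind x - c) = top"
proof -
  define d where "d = 1 / q - 1 / p"
  have d: "0 < d" using pq by (simp add: d_def frac_less2)
  have v0: "0 < vol (P 0)" using vol_pos P0 .
  have "False" if M: "0 \<le> M"
    "\<forall>f\<in>Lp p (\<lambda>_. 1). Lp_norm q wt (\<lambda>x. (top_ind x - c) * f x) \<le> ennreal M * Lp_norm p (\<lambda>_. 1) (f :: real ^ 'n \<Rightarrow> 'k)" for M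
  proof (cases "c = 0")
    case True
    \<comment> \<open>The growth of the test quantity from one chain cube to the next. The exponent
      of \<theta> exceeds the critical value 1 - q/p by q/(2p), which leaves
      \<open>(2 ^ CARD('n)) powr (1 / (2 * p))\<close>.\<close>
    define \<beta> where "\<beta> = \<theta> powr (1 / q) * (1 / 2 ^ CARD('n)) powr d"
    have "\<beta> = (2 ^ CARD('n)) powr (1 / (2 * p))"
    proof -
      have "\<beta> = (2 ^ CARD('n)) powr ((1 - q / (2 * p)) * (1 / q)) * (2 ^ CARD('n)) powr (- d)"
        by (simp add: \<beta>_def \<theta>_eq powr_powr powr_divide powr_minus_divide)
      also have "\<dots> = (2 ^ CARD('n)) powr ((1 - q / (2 * p)) * (1 / q) + - d)" by (simp only: powr_add)
      also have "(1 - q / (2 * p)) * (1 / q) + - d = 1 / (2 * p)" using pq by (simp add: d_def field_simps)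
      finally show ?thesis .
    qed
    then have \<beta>: "1 < \<beta>" using pq one_less_power[of "2::real" "CARD('n)"] by (simp add: gr_one_powr)
    \<comment> \<open>The test set is \<open>P j - P (Suc j)\<close>: it keeps at least half of the
      volume, avoids the null intersection, and has \<open>wt\<close> at least
      \<open>\<theta> ^ j\<close>.\<close>
    have le: "\<beta> ^ j * (vol (P 0) / 2) powr d \<le> M" for j
    proof -
      have v: "vol (P j) = 2 ^ CARD('n) * vol (P (Suc j))" by (rule vol_ch[OF P_cube P_Suc])
      have n2: "(2 :: real) \<le> 2 ^ CARD('n)" using power_increasing[of 1 "CARD('n)" "2::real"] by (simp add: Suc_le_eq)
      define E where "E = P j - P (Suc j)"
      have sub: "P (Suc j) \<subseteq> P j" by (rule P_mono) simp
      have vE: "vol E = vol (P j) - vol (P (Suc j))"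
        unfolding E_def using cube_lmeasurable[OF P_cube[of j]] cube_sets[OF P_cube[of "Suc j"]] sub
        by (intro measure_Diff) (auto simp: fmeasurable_def)
      have "2 * vol (P (Suc j)) \<le> vol (P j)" unfolding v using n2 by (intro mult_right_mono) auto
      then have hE: "vol (P j) / 2 \<le> vol E" using vE by simp
      have "1 * (\<theta> ^ j) powr (1 / q) * vol E powr (1 / q - 1 / p) \<le> M"
      proof (rule mult_norm_test[OF pq M])
        show "E \<in> lmeasurable" unfolding E_def
          using cube_lmeasurable[OF P_cube] by (intro fmeasurable.Diff) auto
        show "0 < vol E" using hE vol_pos[OF P_cube[of j]] by linarith
        fix x assume x: "x \<in> E"
        have "x \<in> P 0" using x P_mono[of 0 j] by (auto simp: E_def)
        then show "1 \<le> norm (top_ind x - c)" using True norm_top_ind[of x, where 'a = 'k] by simp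
        have "\<theta> ^ j \<le> low (P j)" by (rule low_ge[OF P_cube]) simp
        also have "\<dots> \<le> wt x" using x by (intro wt_ge_low P_cube) (auto simp: E_def)
        finally show "\<theta> ^ j \<le> wt x" .
      qed (use \<theta> in auto)
      moreover have "(vol (P j) / 2) powr d \<le> vol E powr d" using hE d by (intro powr_mono2) auto
      then have "(\<theta> ^ j) powr (1 / q) * (vol (P j) / 2) powr d \<le> (\<theta> ^ j) powr (1 / q) * vol E powr d"
        by (intro mult_left_mono) auto
      ultimately have 1: "(\<theta> ^ j) powr (1 / q) * (vol (P j) / 2) powr d \<le> M" by (simp add: d_def)
      have "vol (P j) / 2 = (1 / 2 ^ CARD('n)) ^ j * (vol (P 0) / 2)"
        using P_vol[of j] by (simp add: power_divide)
      then have "(vol (P j) / 2) powr d = ((1 / 2 ^ CARD('n)) ^ j) powr d * (vol (P 0) / 2) powr d"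
        by (simp only: powr_mult)
      moreover have "((1 / 2 ^ CARD('n)) ^ j) powr d = ((1 / 2 ^ CARD('n)) powr d) ^ j" "(\<theta> ^ j) powr (1 / q) = (\<theta> powr (1 / q)) ^ j"
        using \<theta> by (simp_all add: powr_realpow[symmetric] powr_powr mult.commute)
      ultimately show ?thesis using 1 by (simp only: \<beta>_def power_mult_distrib mult.assoc)
    qed
    obtain j where "M / (vol (P 0) / 2) powr d < \<beta> ^ j" using real_arch_pow[OF \<beta>] by blast
    then have "M < \<beta> ^ j * (vol (P 0) / 2) powr d" using v0 by (simp add: pos_divide_less_eq)
    then show False using le[of j] by linarith
  next
    case False
    \<comment> \<open>The volume at which the test value \<open>norm c * y powr d\<close> equals M +
      1. Outside \<open>P 0\<close> the multiplier has norm \<open>norm c\<close> and the weight is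
      at least 1, so a huge cube minus \<open>P 0\<close> suffices.\<close>
    define y where "y = ((M + 1) / norm c) powr (1 / d)"
    have "1 < (2::real)" by simp
    then obtain m where m: "1 + (y + 1) / vol (P 0) < 2 ^ m" using real_arch_pow by blast
    obtain Q where Q: "Q \<in> D (lev (P 0) - int m)" "P 0 \<subseteq> Q"
      using level_below[of "P 0" "lev (P 0) - int m" m] cube_lev[OF P0] by auto
    have Qc: "Q \<in> cubes" using level_cubes Q by blast
    have "vol Q = 2 powi (- lev (P 0) * int CARD('n) + int (m * CARD('n)))"
      using vol_level[OF Q(1)] by (simp add: algebra_simps)
    also have "\<dots> = vol (P 0) * 2 ^ (m * CARD('n))"
      unfolding vol_eq[OF P0] by (subst power_int_add) (simp_all only: power_int_of_nat, simp)
    finally have "vol Q = vol (P 0) * 2 ^ (m * CARD('n))" .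
    moreover have "(2::real) ^ m \<le> 2 ^ (m * CARD('n))" by (intro power_increasing) (auto simp: Suc_le_eq)
    ultimately have "vol (P 0) * 2 ^ m \<le> vol Q" using v0 by simp
    moreover have "vol (P 0) + (y + 1) \<le> vol (P 0) * 2 ^ m"
    proof -
      have "vol (P 0) * (1 + (y + 1) / vol (P 0)) \<le> vol (P 0) * 2 ^ m" using m v0 by (intro mult_left_mono) auto
      moreover have "vol (P 0) * (1 + (y + 1) / vol (P 0)) = vol (P 0) + (y + 1)" using v0 by (simp add: field_simps)
      ultimately show ?thesis by linarith
    qed
    ultimately have "y + 1 \<le> vol Q - vol (P 0)" by linarith
    moreover have "vol (Q - P 0) = vol Q - vol (P 0)"
      using cube_lmeasurable[OF Qc] cube_sets[OF P0] Q(2) by (intro measure_Diff) (auto simp: fmeasurable_def)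
    ultimately have vE: "y + 1 \<le> vol (Q - P 0)" by simp
    have y0: "0 \<le> y" by (simp add: y_def)
    have "norm c * 1 powr (1 / q) * vol (Q - P 0) powr (1 / q - 1 / p) \<le> M"
    proof (rule mult_norm_test[OF pq M])
      show "Q - P 0 \<in> lmeasurable" using cube_lmeasurable[OF Qc] cube_lmeasurable[OF P0] by (rule fmeasurable.Diff)
      show "0 < vol (Q - P 0)" using vE y0 by linarith
      show "norm c \<le> norm (top_ind x - c)" if "x \<in> Q - P 0" for x using that by (simp add: top_ind_def)
    qed (use wt_ge_1 in auto)
    then have 1: "norm c * vol (Q - P 0) powr d \<le> M" by (simp add: d_def)
    have "y powr d \<le> vol (Q - P 0) powr d" using vE y0 d by (intro powr_mono2) auto
    moreover have "y powr d = (M + 1) / norm c" using d M(1) False by (simp add: y_def powr_powr)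
    ultimately have "norm c * ((M + 1) / norm c) \<le> norm c * vol (Q - P 0) powr d" by (intro mult_left_mono) auto
    then have "M + 1 \<le> M" using 1 False by simp
    then show False by simp
  qed
  then have empty: "{ennreal N |N. 0 \<le> N \<and> (\<forall>f\<in>Lp p (\<lambda>_. 1). Lp_norm q wt (\<lambda>x. (top_ind x - c) * f x)
     \<le> ennreal N * Lp_norm p (\<lambda>_. 1) (f :: real ^ 'n \<Rightarrow> 'k))} = {}" by blast
  show ?thesis unfolding mult_norm_def op_norm_def by (subst empty) simp
qed

section \<open>The paraproduct with the indicator is bounded\<close>

lemma above_P0:
  assumes "Q \<in> cubes" "P 0 \<subset> Q"
  shows "vol Q = vol (P 0) * (2 ^ CARD('n)) ^ nat (lev (P 0) - lev Q)"
proof -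
  have l: "lev Q < lev (P 0)" using cube_lev_less[OF assms(1) P0 assms(2)] .
  define m where "m = nat (lev (P 0) - lev Q)"
  have lm: "lev Q = lev (P 0) - int m" using l by (simp add: m_def)
  have "- lev Q * int CARD('n) = - lev (P 0) * int CARD('n) + int (CARD('n) * m)"
    unfolding lm by (simp add: algebra_simps)
  then have "vol Q = 2 powi (- lev (P 0) * int CARD('n) + int (CARD('n) * m))"
    using vol_eq[OF assms(1)] by simp
  also have "\<dots> = vol (P 0) * 2 ^ (CARD('n) * m)"
    unfolding vol_eq[OF P0] by (subst power_int_add) (simp_all only: power_int_of_nat, simp)
  finally show ?thesis by (simp add: m_def power_mult)
qed

text \<open>By nesting there is only one cube above \<open>P 0\<close> in each generation, so the
  sum is part of a geometric series.\<close>

lemma sum_above_P0: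
  assumes F: "finite F" "F \<subseteq> {Q \<in> cubes. P 0 \<subset> Q}" and x: "0 < (x :: real)" "x < 1"
  shows "(\<Sum>Q\<in>F. x ^ nat (lev (P 0) - lev Q)) \<le> 1 / (1 - x)"
proof -
  let ?m = "\<lambda>Q. nat (lev (P 0) - lev Q)"
  have inj: "inj_on ?m F"
  proof (rule inj_onI)
    fix Q R assume "Q \<in> F" "R \<in> F" and eq: "?m Q = ?m R"
    then have QR: "Q \<in> cubes" "P 0 \<subset> Q" "R \<in> cubes" "P 0 \<subset> R" using F by auto
    have "lev Q < lev (P 0)" "lev R < lev (P 0)" using cube_lev_less QR P0 by auto
    then have "lev Q = lev R" using eq by simp
    moreover have "Q \<inter> R \<noteq> {}" using QR cube_nonempty[OF P0] by auto
    ultimately show "Q = R" using level_disjoint[of Q "lev Q" R] cube_lev[OF QR(1)] cube_lev[OF QR(3)] by simp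
  qed
  have "(\<Sum>Q\<in>F. x ^ ?m Q) = (\<Sum>m\<in>?m ` F. x ^ m)" using inj by (simp add: sum.reindex)
  also have "\<dots> \<le> (\<Sum>m. x ^ m)" using x F by (intro sum_le_suminf summable_geometric) auto
  also have "\<dots> = 1 / (1 - x)" using x by (intro suminf_geometric) auto
  finally show ?thesis .
qed

lemma average_top_ind:
  assumes Q: "Q \<in> cubes"
  shows "average Q top_ind = (of_real (vol (P 0 \<inter> Q) / vol Q) :: 'k :: {real_normed_field, euclidean_space})"
proof -
  have m: "P 0 \<inter> Q \<in> lmeasurable" using cube_lmeasurable[OF P0] cube_sets[OF Q] by (rule fmeasurable_Int_fmeasurable)
  have "(LINT x:Q|lebesgue. (top_ind x :: 'k)) = (LINT x|lebesgue. indicat_real (P 0 \<inter> Q) x *\<^sub>R (1 :: 'k))"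
    unfolding set_lebesgue_integral_def top_ind_def by (intro Bochner_Integration.integral_cong) (auto simp: indicator_def)
  also have "\<dots> = (LINT x|lebesgue. indicat_real (P 0 \<inter> Q) x) *\<^sub>R 1"
    using m by (intro integral_scaleR_left) (auto simp: fmeasurable_def)
  also have "\<dots> = of_real (vol (P 0 \<inter> Q))" using m by (simp add: of_real_def fmeasurable_def)
  finally show ?thesis by (simp add: average_def scaleR_conv_of_real)
qed

text \<open>Below or away from \<open>P 0\<close> a cube and its children have the same average.
  Above it the average over R is at most \<open>vol (P 0) / vol R\<close>, and comparing a child
  with its parent costs \<open>2 * 2 ^ CARD('n)\<close>.\<close>

lemma mart_diff_top_ind:
  assumes Q: "Q \<in> cubes"
  shows "norm (mart_diff cubes Q (top_ind :: _ \<Rightarrow> 'k :: {real_normed_field, euclidean_space}) x)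
    \<le> (if P 0 \<subset> Q then 2 * 2 ^ CARD('n) * (vol (P 0) / vol Q) * indicat_real Q x else 0)"
proof (cases "P 0 \<subset> Q")
  case True
  define B where "B = 2 * 2 ^ CARD('n) * (vol (P 0) / vol Q)"
  have avR: "norm (average R (top_ind :: _ \<Rightarrow> 'k)) \<le> vol (P 0) / vol R" if R: "R \<in> cubes" for R
  proof -
    have "vol (P 0 \<inter> R) \<le> vol (P 0)" using cube_lmeasurable[OF P0] cube_sets[OF P0] cube_sets[OF R]
      by (intro measure_mono_fmeasurable) auto
    then show ?thesis unfolding average_top_ind[OF R] norm_of_real using vol_pos[OF R] by (simp add: divide_right_mono)
  qed
  have d: "norm (average R (top_ind :: _ \<Rightarrow> 'k) - average Q top_ind) \<le> B" if R: "R \<in> ch Q" for R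
  proof -
    have "norm (average R (top_ind :: _ \<Rightarrow> 'k) - average Q top_ind) \<le> vol (P 0) / vol R + vol (P 0) / vol Q"
      by (rule order_trans[OF norm_triangle_ineq4]) (intro add_mono avR Q ch_cubes[OF R])
    also have "vol (P 0) / vol R = 2 ^ CARD('n) * (vol (P 0) / vol Q)"
      using vol_ch[OF Q R] vol_pos[OF ch_cubes[OF R]] by simp
    also have "2 ^ CARD('n) * (vol (P 0) / vol Q) + vol (P 0) / vol Q \<le> B"
    proof -
      have "1 * (vol (P 0) / vol Q) \<le> 2 ^ CARD('n) * (vol (P 0) / vol Q)" by (intro mult_right_mono) auto
      then show ?thesis unfolding B_def by linarith
    qed
    finally show ?thesis .
  qed
  have "norm (mart_diff cubes Q (top_ind :: _ \<Rightarrow> 'k) x) \<le> (\<Sum>R\<in>ch Q. indicat_real R x * B)"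
    unfolding mart_diff_eq[OF Q] using d by (intro sum_norm_le) (auto simp: indicator_def)
  also have "\<dots> = B * indicat_real Q x" unfolding indicator_ch[OF Q] by (simp add: sum_distrib_left mult.commute)
  finally show ?thesis using True by (simp add: B_def)
next
  case False
  have "average R (top_ind :: _ \<Rightarrow> 'k) = average Q top_ind" if R: "R \<in> ch Q" for R
  proof (cases "P 0 \<inter> Q = {}")
    case True
    then have "P 0 \<inter> R = {}" using ch_sub[OF Q R] by auto
    then show ?thesis using True by (simp add: average_top_ind[OF Q] average_top_ind[OF ch_cubes[OF R]])
  next
    case ne: False
    then have "Q \<subseteq> P 0" using cube_nest[OF P0 Q ne] False by auto
    then have "P 0 \<inter> Q = Q" "P 0 \<inter> R = R" using ch_sub[OF Q R] by auto
    then show ?thesis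
      using vol_pos[OF Q] vol_pos[OF ch_cubes[OF R]]
      by (simp add: average_top_ind[OF Q] average_top_ind[OF ch_cubes[OF R]])
  qed
  then have "mart_diff cubes Q (top_ind :: _ \<Rightarrow> 'k) x = 0"
    unfolding mart_diff_eq[OF Q] by (intro sum.neutral) simp
  then show ?thesis using False by simp
qed

lemma average_Lp_le:
  fixes f :: "real ^ 'n \<Rightarrow> 'k :: euclidean_space"
  assumes f: "cube_integrable f" and p: "1 < p"
    and B: "(\<integral>\<^sup>+x. ennreal (norm (f x) powr p * 1) \<partial>lebesgue) = ennreal B" "0 \<le> B" and Q: "Q \<in> cubes"
  shows "norm (average Q f) \<le> B powr (1 / p) * vol Q powr (- 1 / p)"
proof -
  have [measurable]: "f \<in> borel_measurable lebesgue" using f by (simp add: cube_integrable_def)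
  define a where "a x = norm (f x) powr p" for x
  have am: "a \<in> borel_measurable lebesgue" unfolding a_def by measurable
  have "emeasure (wmeasure a) Q \<le> emeasure (wmeasure a) UNIV" by (intro emeasure_mono) auto
  also have "\<dots> = ennreal B" using B(1) by (subst emeasure_wmeasure[OF am]) (auto simp: mass_def a_def)
  finally have 1: "emeasure (wmeasure a) Q \<le> ennreal B" .
  then have 2: "emeasure (wmeasure a) Q < top" by (auto intro: le_less_trans)
  have 3: "wmass a Q \<le> B" using 1 emeasure_wmeasure_eq_measure[OF 2] B(2) by simp
  have "wmass (\<lambda>x. norm (f x)) Q \<le> wmass a Q powr (1 / p) * wmass (\<lambda>_. 1) Q powr (1 - 1 / p)"
  proof (rule wmeasure_holder(3)[OF am])
    show "norm (f x) \<le> a x powr (1 / p) * 1 powr (1 - 1 / p)" for x using p by (simp add: a_def powr_powr)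
  qed (use p 2 cube_sets[OF Q] cube_finiteD(2)[OF cube_finite_one Q] in \<open>auto simp: a_def\<close>)
  also have "\<dots> \<le> B powr (1 / p) * vol Q powr (1 - 1 / p)"
    unfolding wmeasure_one using 3 p by (intro mult_right_mono powr_mono2) auto
  finally have "wmass (\<lambda>x. norm (f x)) Q / vol Q \<le> B powr (1 / p) * vol Q powr (1 - 1 / p) / vol Q"
    using vol_pos[OF Q] by (simp add: divide_right_mono)
  also have "\<dots> = B powr (1 / p) * vol Q powr (- 1 / p)"
    using vol_pos[OF Q] powr_add[of "vol Q" "- 1 / p" 1] by simp
  finally show ?thesis using norm_average_le[OF f Q] by linarith
qed

text \<open>The factors come, in order, from the martingale differences, from Hoelder's inequality
  with total weight at most 2, from the A_1 mass bound, and from the geometric series over the cubes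
  above \<open>P 0\<close>.\<close>

definition para_const :: "real \<Rightarrow> real \<Rightarrow> real" where
  "para_const p q = (2 * 2 ^ CARD('n)) powr q * 2 powr (q - 1) * CA * vol (P 0) powr (1 - q / p) /
     (1 - (1 / 2 ^ CARD('n)) powr (q / p))"

lemma half_pow: "(2 :: real) \<le> 2 ^ CARD('n)"
  using power_increasing[of 1 "CARD('n)" "2::real"] by (simp add: Suc_le_eq)

text \<open>Only cubes above \<open>P 0\<close> contribute, and on them the mass of
  \<open>wt\<close> is comparable to volume: the singularity is averaged out. What remains decays
  geometrically with the generation.\<close>

lemma para_Lq_le:
  fixes f :: "real ^ 'n \<Rightarrow> 'k :: {real_normed_field, euclidean_space}"
  assumes f: "cube_integrable f" and pq: "1 < q" "q < p"
    and B: "(\<integral>\<^sup>+x. ennreal (norm (f x) powr p * 1) \<partial>lebesgue) = ennreal B" "0 \<le> B"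
    and F: "finite F" "F \<subseteq> cubes"
  shows "(\<integral>\<^sup>+x. ennreal (norm (partial_para top_ind f F x) powr q * wt x) \<partial>lebesgue)
    \<le> ennreal (para_const p q * B powr (q / p))"
proof -
  define G where "G = {Q \<in> F. P 0 \<subset> Q}"
  have G: "finite G" "G \<subseteq> {Q \<in> cubes. P 0 \<subset> Q}" "G \<subseteq> cubes" using F by (auto simp: G_def)
  define v where "v Q = vol (P 0) / vol Q" for Q
  define t where "t Q x = indicat_real Q x * vol Q powr (- 1 / p)" for Q x
  define c where "c = 2 * 2 ^ CARD('n) * B powr (1 / p)"
  have v0: "0 < vol (P 0)" using vol_pos P0 .
  have vpos: "0 \<le> v Q" for Q by (simp add: v_def)
  have c0: "0 \<le> c" by (simp add: c_def)
  let ?m = "\<lambda>Q. nat (lev (P 0) - lev Q)"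
  have veq: "v Q = (1 / 2 ^ CARD('n)) ^ ?m Q" if "Q \<in> G" for Q
  proof -
    have Q: "Q \<in> cubes" "P 0 \<subset> Q" using that G(2) by auto
    show ?thesis unfolding v_def above_P0[OF Q] using v0 by (simp add: power_divide)
  qed
  have "(\<Sum>Q\<in>G. v Q) \<le> 1 / (1 - 1 / 2 ^ CARD('n))"
    using sum_above_P0[OF G(1,2), of "1 / 2 ^ CARD('n)"] half_pow veq by simp
  also have "\<dots> \<le> 2"
  proof -
    have "1 / (2 ^ CARD('n) :: real) \<le> 1 / 2" using half_pow by (intro divide_left_mono) auto
    then have "1 / 2 \<le> 1 - 1 / (2 ^ CARD('n) :: real)" by simp
    then have "1 / (1 - 1 / (2 ^ CARD('n) :: real)) \<le> 1 / (1 / 2)" by (intro divide_left_mono) auto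
    then show ?thesis by simp
  qed
  finally have V: "(\<Sum>Q\<in>G. v Q) \<le> 2" .
  have pw: "norm (partial_para top_ind f F x) \<le> c * (\<Sum>Q\<in>G. v Q * t Q x)" for x
  proof -
    have "norm (partial_para top_ind f F x) \<le> (\<Sum>Q\<in>F. if P 0 \<subset> Q then c * (v Q * t Q x) else 0)"
      unfolding partial_para_def
    proof (intro sum_norm_le)
      fix Q assume "Q \<in> F"
      then have Q: "Q \<in> cubes" using F by auto
      have "norm (mart_diff cubes Q (top_ind :: _ \<Rightarrow> 'k) x * average Q f) \<le>
        (if P 0 \<subset> Q then 2 * 2 ^ CARD('n) * (vol (P 0) / vol Q) * indicat_real Q x else 0) * (B powr (1 / p) * vol Q powr (- 1 / p))"
        unfolding norm_mult using pq
        by (intro mult_mono mart_diff_top_ind Q average_Lp_le[OF f _ B Q]) auto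
      also have "\<dots> = (if P 0 \<subset> Q then c * (v Q * t Q x) else 0)"
        by (simp add: c_def v_def t_def)
      finally show "norm (mart_diff cubes Q (top_ind :: _ \<Rightarrow> 'k) x * average Q f) \<le> (if P 0 \<subset> Q then c * (v Q * t Q x) else 0)" .
    qed
    also have "\<dots> = (\<Sum>Q\<in>G. c * (v Q * t Q x))" unfolding G_def by (rule sum.inter_filter[symmetric]) (rule F)
    finally show ?thesis by (simp add: sum_distrib_left)
  qed
  define D1 where "D1 = c powr q * 2 powr (q - 1)"
  have D1: "0 \<le> D1" by (simp add: D1_def)
  have pwq: "norm (partial_para top_ind f F x) powr q \<le> (\<Sum>Q\<in>G. D1 * (v Q * vol Q powr (- q / p)) * indicat_real Q x)" for x
  proof -
    have t0: "0 \<le> t Q x" for Q by (simp add: t_def)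
    \<comment> \<open>Splitting \<open>v Q\<close> into powers \<open>1 / q\<close> and
      \<open>1 - 1 / q\<close> applies Hoelder with the weights \<open>v Q\<close>, whose total is
      at most 2.\<close>
    have "(\<Sum>Q\<in>G. v Q * t Q x) = (\<Sum>Q\<in>G. (v Q * t Q x powr q) powr (1 / q) * v Q powr (1 - 1 / q))"
    proof (intro sum.cong refl)
      fix Q
      have "(v Q * t Q x powr q) powr (1 / q) * v Q powr (1 - 1 / q) = (v Q powr (1 / q) * v Q powr (1 - 1 / q)) * t Q x"
        using t0[of Q] pq by (simp add: powr_mult powr_powr)
      also have "v Q powr (1 / q) * v Q powr (1 - 1 / q) = v Q" using vpos[of Q] by (simp flip: powr_add)
      finally show "v Q * t Q x = (v Q * t Q x powr q) powr (1 / q) * v Q powr (1 - 1 / q)" by simp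
    qed
    also have "\<dots> \<le> (\<Sum>Q\<in>G. v Q * t Q x powr q) powr (1 / q) * (\<Sum>Q\<in>G. v Q) powr (1 - 1 / q)"
      using G vpos pq by (intro holder_sum) auto
    also have "\<dots> \<le> (\<Sum>Q\<in>G. v Q * t Q x powr q) powr (1 / q) * 2 powr (1 - 1 / q)"
      using V pq vpos by (intro mult_left_mono powr_mono2) (auto intro!: sum_nonneg)
    finally have "c * (\<Sum>Q\<in>G. v Q * t Q x) \<le> c * ((\<Sum>Q\<in>G. v Q * t Q x powr q) powr (1 / q) * 2 powr (1 - 1 / q))"
      using c0 by (rule mult_left_mono)
    then have "norm (partial_para top_ind f F x) powr q \<le> (c * ((\<Sum>Q\<in>G. v Q * t Q x powr q) powr (1 / q) * 2 powr (1 - 1 / q))) powr q"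
      using pq pw[of x] by (intro powr_mono2) auto
    also have "\<dots> = D1 * (\<Sum>Q\<in>G. v Q * t Q x powr q)"
    proof -
      have "(1 - 1 / q) * q = q - 1" using pq by (simp add: algebra_simps)
      then show ?thesis using pq vpos by (simp add: powr_mult powr_powr D1_def sum_nonneg)
    qed
    also have "\<dots> = (\<Sum>Q\<in>G. D1 * (v Q * vol Q powr (- q / p)) * indicat_real Q x)"
      unfolding sum_distrib_left using pq by (intro sum.cong) (auto simp: t_def indicator_def powr_powr)
    finally show ?thesis .
  qed
  have Gs [measurable]: "Q \<in> sets lebesgue" if "Q \<in> G" for Q using that G cube_sets by auto
  have "(\<integral>\<^sup>+x. ennreal (norm (partial_para top_ind f F x) powr q * wt x) \<partial>lebesgue)
    \<le> (\<integral>\<^sup>+x. (\<Sum>Q\<in>G. ennreal (D1 * (v Q * vol Q powr (- q / p))) * (ennreal (wt x) * indicator Q x)) \<partial>lebesgue)"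
  proof (intro nn_integral_mono)
    fix x
    have "norm (partial_para top_ind f F x) powr q * wt x \<le> (\<Sum>Q\<in>G. D1 * (v Q * vol Q powr (- q / p)) * indicat_real Q x) * wt x"
      using pwq wt_pos[of x] by (intro mult_right_mono) auto
    also have "\<dots> = (\<Sum>Q\<in>G. D1 * (v Q * vol Q powr (- q / p)) * (wt x * indicat_real Q x))"
      unfolding sum_distrib_right by (intro sum.cong) (auto simp: mult_ac)
    finally have "ennreal (norm (partial_para top_ind f F x) powr q * wt x) \<le> ennreal \<dots>" by (rule ennreal_leI)
    also have "\<dots> = (\<Sum>Q\<in>G. ennreal (D1 * (v Q * vol Q powr (- q / p)) * (wt x * indicat_real Q x)))"
      using D1 vpos wt_pos[of x] by (intro sum_ennreal[symmetric]) (auto intro!: mult_nonneg_nonneg)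
    also have "\<dots> = (\<Sum>Q\<in>G. ennreal (D1 * (v Q * vol Q powr (- q / p))) * (ennreal (wt x) * indicator Q x))"
      using D1 vpos wt_pos[of x] by (intro sum.cong refl) (auto simp: indicator_def simp flip: ennreal_mult)
    finally show "ennreal (norm (partial_para top_ind f F x) powr q * wt x) \<le> (\<Sum>Q\<in>G. ennreal (D1 * (v Q * vol Q powr (- q / p))) * (ennreal (wt x) * indicator Q x))" .
  qed
  also have "\<dots> = (\<Sum>Q\<in>G. ennreal (D1 * (v Q * vol Q powr (- q / p))) * mass wt Q)"
    unfolding mass_def by (subst nn_integral_sum) (auto intro!: sum.cong nn_integral_cmult)
  also have "\<dots> \<le> (\<Sum>Q\<in>G. ennreal (D1 * CA * vol (P 0) powr (1 - q / p) * ((1 / 2 ^ CARD('n)) powr (q / p)) ^ ?m Q))"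
  proof (rule sum_mono)
    fix Q assume QG: "Q \<in> G"
    then have Q: "Q \<in> cubes" "P 0 \<subset> Q" using G by auto
    \<comment> \<open>No chain cube contains Q, so no layer is constant on Q and
      \<open>low Q\<close> reduces to its summand 1.\<close>
    have "\<not> Q \<subseteq> P j" for j using Q P_mono[of 0 j] by auto
    then have low1: "low Q = 1" by (simp add: low_def)
    have "ennreal (D1 * (v Q * vol Q powr (- q / p))) * mass wt Q \<le> ennreal (D1 * (v Q * vol Q powr (- q / p))) * ennreal (CA * vol Q)"
      using mass_wt_le[OF Q(1)] low1 by (intro mult_left_mono) auto
    also have "\<dots> = ennreal (D1 * (v Q * vol Q powr (- q / p)) * (CA * vol Q))"
      using CA_pos by (simp add: ennreal_mult'')
    also have "D1 * (v Q * vol Q powr (- q / p)) * (CA * vol Q) = D1 * CA * (vol (P 0) * vol Q powr (- q / p))"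
      using vol_pos[OF Q(1)] by (simp add: v_def)
    also have "vol (P 0) * vol Q powr (- q / p) = vol (P 0) powr (1 - q / p) * ((1 / 2 ^ CARD('n)) powr (q / p)) ^ ?m Q"
    proof -
      have "vol Q = vol (P 0) / v Q" using v0 by (simp add: v_def)
      then have "vol Q powr (- q / p) = vol (P 0) powr (- q / p) * v Q powr (q / p)"
        using v0 by (simp add: powr_divide powr_minus field_simps)
      moreover have "v Q powr (q / p) = ((1 / 2 ^ CARD('n)) powr (q / p)) ^ ?m Q"
        unfolding veq[OF QG] by (simp add: powr_realpow[symmetric] powr_powr mult.commute del: power_divide)
      moreover have "vol (P 0) * vol (P 0) powr (- q / p) = vol (P 0) powr (1 - q / p)"
        using v0 powr_add[of "vol (P 0)" 1 "- q / p"] by simp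
      ultimately show ?thesis by (simp add: mult.assoc)
    qed
    finally show "ennreal (D1 * (v Q * vol Q powr (- q / p))) * mass wt Q \<le>
      ennreal (D1 * CA * vol (P 0) powr (1 - q / p) * ((1 / 2 ^ CARD('n)) powr (q / p)) ^ ?m Q)" by (simp add: mult.assoc)
  qed
  also have "\<dots> = ennreal (D1 * CA * vol (P 0) powr (1 - q / p) * (\<Sum>Q\<in>G. ((1 / 2 ^ CARD('n)) powr (q / p)) ^ ?m Q))"
    using D1 CA_pos by (subst sum_ennreal) (auto simp: sum_distrib_left)
  also have "\<dots> \<le> ennreal (D1 * CA * vol (P 0) powr (1 - q / p) * (1 / (1 - (1 / 2 ^ CARD('n)) powr (q / p))))"
  proof (intro ennreal_leI mult_left_mono sum_above_P0[OF G(1,2)])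
    have "(1 / 2 ^ CARD('n) :: real) powr (q / p) < 1 powr (q / p)"
      using half_pow pq by (intro powr_less_mono2) auto
    then show "(1 / 2 ^ CARD('n) :: real) powr (q / p) < 1" by simp
  qed (use D1 CA_pos in auto)
  also have "D1 * CA * vol (P 0) powr (1 - q / p) * (1 / (1 - (1 / 2 ^ CARD('n)) powr (q / p))) = para_const p q * B powr (q / p)"
    using B(2) by (simp add: D1_def c_def para_const_def powr_mult powr_powr)
  finally show ?thesis .
qed

lemma paraproduct_norm_finite:
  assumes pq: "1 < q" "q < p"
  shows "paraproduct_norm cubes p (\<lambda>_. 1) q wt (top_ind :: _ \<Rightarrow> 'k :: {real_normed_field, euclidean_space}) < top"
proof -
  have "(1 / 2 ^ CARD('n) :: real) powr (q / p) < 1 powr (q / p)"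
    using half_pow pq by (intro powr_less_mono2) auto
  then have pc: "0 \<le> para_const p q" unfolding para_const_def using CA_pos by (intro divide_nonneg_nonneg) auto
  have "paraproduct_norm cubes p (\<lambda>_. 1) q wt (top_ind :: _ \<Rightarrow> 'k) \<le> ennreal (para_const p q powr (1 / q))"
  proof (rule paraproduct_norm_le)
    fix f :: "real ^ 'n \<Rightarrow> 'k" assume f: "f \<in> Linfc"
    \<comment> \<open>The symbol lies in L^2, so orthogonality alone gives convergence.\<close>
    show "para_cauchy top_ind f"
    proof (rule para_cauchy_L2[OF L1loc_cube_integrable[OF top_ind_L1loc] _ _ f])
      have "(\<integral>\<^sup>+x. ennreal ((norm (top_ind x :: 'k))\<^sup>2) \<partial>lebesgue) = (\<integral>\<^sup>+x. indicator (P 0) x \<partial>lebesgue)"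
        by (intro nn_integral_cong) (auto simp: norm_top_ind indicator_def)
      also have "\<dots> = ennreal (vol (P 0))"
        using cube_lmeasurable[OF P0] by (simp add: emeasure_eq_measure2 fmeasurableD)
      finally show "(\<integral>\<^sup>+x. ennreal ((norm (top_ind x :: 'k))\<^sup>2) \<partial>lebesgue) \<le> ennreal (vol (P 0))" by simp
    qed simp
  next
    fix f :: "real ^ 'n \<Rightarrow> 'k" and F B
    assume f: "f \<in> Linfc" "finite F" "F \<subseteq> cubes" "0 \<le> B" "(\<integral>\<^sup>+x. ennreal (norm (f x) powr p * 1) \<partial>lebesgue) = ennreal B"
    have "(para_const p q powr (1 / q) * B powr (1 / p)) powr q = para_const p q * B powr (q / p)"
      using pc pq by (simp add: powr_mult powr_powr)
    then show "(\<integral>\<^sup>+x. ennreal (norm (partial_para top_ind f F x) powr q * wt x) \<partial>lebesgue)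
       \<le> ennreal ((para_const p q powr (1 / q) * B powr (1 / p)) powr q)"
      using para_Lq_le[OF Linfc_cube_integrable[OF f(1)] pq f(5,4,2,3)] by simp
  qed (use pq wt_pos cube_finite_one in auto)
  then show ?thesis by (rule le_less_trans) simp
qed

end

lemma (in dyadic) non_necessity:
  assumes pq: "1 < q" "q < p"
  shows "\<exists>\<mu>\<in>Ap_weights cubes p. \<exists>lam\<in>Ap_weights cubes q. \<exists>b\<in>L1loc :: (real ^ 'n \<Rightarrow> 'k :: {real_normed_field, euclidean_space}) set.
           (INF c. mult_norm p \<mu> q lam (\<lambda>x. b x - c)) = top \<and>
           paraproduct_norm cubes p \<mu> q lam b < top"
proof -
  obtain Q0 where Q0: "Q0 \<in> cubes" using ex_cube by blast
  have ne: "\<exists>R. R \<in> ch Q" if Q: "Q \<in> cubes" for Q using ch_Union[OF Q] cube_nonempty[OF Q] by blast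
  define P where "P = rec_nat Q0 (\<lambda>_ Q. SOME R. R \<in> ch Q)"
  have P: "P 0 = Q0" "P (Suc j) = (SOME R. R \<in> ch (P j))" for j by (simp_all add: P_def)
  have Pc: "P j \<in> cubes" for j
  proof (induction j)
    case (Suc j)
    then show ?case unfolding P(2) using someI_ex[OF ne[OF Suc]] ch_cubes by blast
  qed (simp add: P Q0)
  \<comment> \<open>In base \<open>2 ^ CARD('n)\<close> the exponent must lie below 1 for the A_1
    bound and above 1 - q/p for unboundedness; this is the midpoint.\<close>
  define \<theta> :: real where "\<theta> = (2 ^ CARD('n)) powr (1 - q / (2 * p))"
  have n2: "(1 :: real) < 2 ^ CARD('n)" by (rule one_less_power) auto
  have e: "0 < 1 - q / (2 * p)" "1 - q / (2 * p) < 1" using pq by (auto simp: field_simps)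
  interpret chain_weight D P \<theta>
  proof
    show "P 0 \<in> cubes" by (rule Pc)
    show "P (Suc j) \<in> ch (P j)" for j unfolding P(2) by (rule someI_ex[OF ne[OF Pc]])
    show "1 < \<theta>" using n2 e by (simp add: \<theta>_def gr_one_powr)
    have "\<theta> < (2 ^ CARD('n)) powr 1" unfolding \<theta>_def using n2 e by (intro powr_less_mono) auto
    then show "\<theta> < 2 ^ CARD('n)" by simp
  qed
  have "mult_norm p (\<lambda>_. 1) q wt (\<lambda>x. top_ind x - c) = top" for c :: 'k
    by (rule mult_norm_infinite[OF pq \<theta>_def])
  then have "(INF c :: 'k. mult_norm p (\<lambda>_. 1) q wt (\<lambda>x. top_ind x - c)) = top" by simp
  then show ?thesis
    using one_Ap[of p] wt_Ap[OF pq(1)] top_ind_L1loc paraproduct_norm_finite[OF pq] pq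
    by (intro bexI[of _ "\<lambda>_. 1"] bexI[of _ wt] bexI[of _ top_ind] conjI) auto
qed

theorem theorem5p4:
  fixes p q :: real
  assumes "1 < q" and "q < p"
  shows
    "(\<exists>C>0. \<forall>(\<D> :: (real ^ 'n) set set) \<mu> lam \<nu>
          (b :: real ^ 'n \<Rightarrow> 'k :: {real_normed_field, euclidean_space}).
        dyadic_lattice \<D> \<longrightarrow> \<mu> \<in> Ap_weights \<D> p \<longrightarrow> lam \<in> Ap_weights \<D> q \<longrightarrow>
        (\<forall>x. \<nu> x > 0 \<and>
             \<nu> x powr (1 / p + 1 / conj_exp q) = \<mu> x powr (1 / p) * lam x powr (- 1 / q)) \<longrightarrow>
        b \<in> L1loc \<longrightarrow>
        paraproduct_norm \<D> p \<mu> q lam b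
          \<le> ennreal C * epowr (Ap_char \<D> p \<mu>) (1 / (p - 1)) * Ap_char \<D> q lam
              * epowr (Ainf_char \<D> \<nu>) (1 / q - 1 / p)
              * (INF c. mult_norm p \<mu> q lam (\<lambda>x. b x - c)))
     \<and>
     (\<forall>\<D> :: (real ^ 'n) set set. dyadic_lattice \<D> \<longrightarrow>
        (\<exists>\<mu>\<in>Ap_weights \<D> p. \<exists>lam\<in>Ap_weights \<D> q. \<exists>b\<in>L1loc :: (real ^ 'n \<Rightarrow> 'k) set.
           (INF c. mult_norm p \<mu> q lam (\<lambda>x. b x - c)) = top \<and>
           paraproduct_norm \<D> p \<mu> q lam b < top))"
proof -
  have lat: "\<exists>D. dyadic D \<and> dyadic.cubes D = \<D>" if \<D>: "dyadic_lattice \<D>" for \<D> :: "(real ^ 'n) set set"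
  proof -
    obtain D :: "int \<Rightarrow> (real ^ 'n) set set" where D: "\<D> = (\<Union>k. D k)"
      "\<forall>k. partition_on UNIV (D k) \<and> (\<forall>Q\<in>D k. axis_cube (2 powi (- k)) Q) \<and> refines UNIV (D (k + 1)) (D k)"
      using \<D> unfolding dyadic_lattice_def by (elim exE conjE)
    have d: "dyadic D" by standard (use D(2) in auto)
    then show ?thesis using dyadic.cubes_def[OF d] D(1) by (intro exI[of _ D]) simp
  qed
  define s where "s = conj_exp q"
  define r where "r = 1 / (1 / q - 1 / p)"
  \<comment> \<open>r and s are functions of p and q, so C depends only on p, q and the
    dimension.\<close>
  define C where "C = form_const r p s CARD('n)"
  have "1 / p < 1 / q" using assms by (simp add: frac_less2)
  moreover have "1 / q - 1 / p < 1" using assms by (smt (verit) divide_less_eq_1_pos divide_pos_pos)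
  ultimately have "1 < r" by (simp add: r_def)
  moreover have "1 < s" using assms by (simp add: s_def conj_exp_def)
  ultimately have C: "0 < C" unfolding C_def using assms by (intro form_const_pos) auto
  show ?thesis
  proof (intro conjI exI[of _ C] C allI impI)
    fix \<D> :: "(real ^ 'n) set set" and \<mu> lam \<nu> :: "real ^ 'n \<Rightarrow> real" and b :: "real ^ 'n \<Rightarrow> 'k"
    assume \<D>: "dyadic_lattice \<D>" and \<mu>: "\<mu> \<in> Ap_weights \<D> p" and lam: "lam \<in> Ap_weights \<D> q"
      and \<nu>: "\<forall>x. \<nu> x > 0 \<and> \<nu> x powr (1 / p + 1 / conj_exp q) = \<mu> x powr (1 / p) * lam x powr (- 1 / q)"
      and b: "b \<in> L1loc"
    obtain D where D: "dyadic D" "dyadic.cubes D = \<D>" using lat[OF \<D>] by (elim exE conjE)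
    interpret dyadic D by (rule D(1))
    have w: "weight \<mu>" "weight lam" using \<mu> lam by (auto simp: Ap_weights_def)
    obtain A where Aeq: "0 \<le> A" "Ap_char cubes p \<mu> = ennreal A"
      using \<mu> D(2) by (cases "Ap_char cubes p \<mu>") (auto simp: Ap_weights_def)
    obtain L where Leq: "0 \<le> L" "Ap_char cubes q lam = ennreal L"
      using lam D(2) by (cases "Ap_char cubes q lam") (auto simp: Ap_weights_def)
    have "0 < A" "0 < L" using Ap_char_pos[OF w(1), of p] Ap_char_pos[OF w(2), of q] Aeq Leq assms by auto
    then interpret weight_pair D p q r s \<mu> lam \<nu> "\<lambda>x. \<mu> x powr (- conj_exp p / p)" "\<lambda>x. lam x powr (- conj_exp q / q)" A L
      by unfold_locales (use assms w \<nu> Aeq Leq in \<open>auto simp: r_def s_def\<close>)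
    show "paraproduct_norm \<D> p \<mu> q lam b
          \<le> ennreal C * epowr (Ap_char \<D> p \<mu>) (1 / (p - 1)) * Ap_char \<D> q lam
              * epowr (Ainf_char \<D> \<nu>) (1 / q - 1 / p)
              * (INF c. mult_norm p \<mu> q lam (\<lambda>x. b x - c))"
      using sufficiency[OF b Aeq(2) Leq(2)] unfolding D(2) C_def .
  next
    fix \<D> :: "(real ^ 'n) set set" assume \<D>: "dyadic_lattice \<D>"
    obtain D where D: "dyadic D" "dyadic.cubes D = \<D>" using lat[OF \<D>] by (elim exE conjE)
    show "\<exists>\<mu>\<in>Ap_weights \<D> p. \<exists>lam\<in>Ap_weights \<D> q. \<exists>b\<in>L1loc :: (real ^ 'n \<Rightarrow> 'k) set.
           (INF c. mult_norm p \<mu> q lam (\<lambda>x. b x - c)) = top \<and>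
           paraproduct_norm \<D> p \<mu> q lam b < top"
      using dyadic.non_necessity[OF D(1) assms] unfolding D(2) .
  qed
qed

end
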